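(* Let $\phi=\phi(x,t)$, $x\in\mathbb{R}^3$, be a smooth real-valued function transported by a smooth velocity field $u(x,t)\in\mathbb{R}^3$, i.e. $\phi_t+u\cdot\nabla\phi=0$. Assume that for each $t$ the zero level set $\{\phi=0\}=\{x\in\mathbb{R}^3:\phi(x,t)=0\}$ is a smooth closed surface $\partial\Omega$ (the boundary of a regular open connected set $\Omega\subset\mathbb{R}^3$) and that $|\nabla\phi|>0$ in a neighbourhood of $\{\phi=0\}$. Let $n=n(\phi)=\nabla\phi/|\nabla\phi|$. Let $f:\mathbb{R}^3\to\mathbb{R}$ be a smooth function homogeneous of degree one, i.e. $f(sp)=sf(p)$, and set $$J^n(\phi)=\int_{\{\phi=0\}} f(n(\phi))\,d\sigma .$$ Then the derivative of $J^n(\phi)$ with respect to $t$ is $$(J^n(\phi))_t=\int_{\{\phi=0\}}\operatorname{div}_{\partial\Omega}\big(\nabla f(n)\big)\;u\cdot n\;d\sigma .$$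
   Context: $\nabla$ and $\operatorname{div}$ are taken with respect to the space variable $x$, and a subscript $t$ denotes the derivative in $t$; $d\sigma$ is surface measure; $\nabla f(n)$ denotes the vector field $x\mapsto(\nabla f)(n(x,t))$. For a smooth vector field $v$, $[\nabla v]_{ij}=\partial_j v_i$ and the tangential divergence is $\operatorname{div}_{\partial\Omega}(v)=\operatorname{div}(v)-([\nabla v]\,n)\cdot n$.
   Formalization: Adds that the surfaces {φ=0} stay in a bounded set for t in compact time sets; otherwise a component can come in from infinity and J jumps (unit sphere plus sphere of radius 1/t for t>0, f=|p|). f need only be smooth away from 0 and homogeneous for s>0. *)

theory Defs
  imports "HOL-Analysis.Analysis"
begin

text \<open>Smoothness is meant for open sets: all iterated directional derivatives exist as derivatives
  in the full Frechet sense and are continuous.\<close>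

primrec Ck_on ::
  "nat \<Rightarrow> 'a::euclidean_space set \<Rightarrow> ('a \<Rightarrow> 'b::real_normed_vector) \<Rightarrow> bool" where
  "Ck_on 0 U f \<longleftrightarrow> continuous_on U f"
| "Ck_on (Suc k) U f \<longleftrightarrow> (\<forall>x\<in>U. f differentiable (at x)) \<and>
     (\<forall>v. Ck_on k U (\<lambda>x. frechet_derivative f (at x) v))"

definition smooth_on ::
  "'a::euclidean_space set \<Rightarrow> ('a \<Rightarrow> 'b::real_normed_vector) \<Rightarrow> bool" where
  "smooth_on U f \<longleftrightarrow> (\<forall>k. Ck_on k U f)"

definition grad :: "(real^3 \<Rightarrow> real) \<Rightarrow> real^3 \<Rightarrow> real^3" where
  "grad g x = (\<chi> i. frechet_derivative g (at x) (axis i 1))"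

definition div_field :: "(real^3 \<Rightarrow> real^3) \<Rightarrow> real^3 \<Rightarrow> real" where
  "div_field v x = trace (jacobian v (at x))"

text \<open>The tangential divergence at \<open>x\<close> with respect to the unit normal \<open>\<nu>\<close>;
  the library's \<open>jacobian\<close> has the entries \<open>jacobian v (at x) $ i $ j = \<partial>\<^sub>j v\<^sub>i\<close>.\<close>

definition tangential_div :: "real^3 \<Rightarrow> (real^3 \<Rightarrow> real^3) \<Rightarrow> real^3 \<Rightarrow> real" where
  "tangential_div \<nu> v x = div_field v x - (jacobian v (at x) *v \<nu>) \<bullet> \<nu>"

definition area_element :: "(real^2 \<Rightarrow> real^3) \<Rightarrow> real^2 \<Rightarrow> real" where
  "area_element r y =
     norm (cross3 (frechet_derivative r (at y) (axis 1 1)) (frechet_derivative r (at y) (axis 2 1)))"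

definition local_parametrization ::
  "(real^3) set \<Rightarrow> (real^2) set \<Rightarrow> (real^2 \<Rightarrow> real^3) \<Rightarrow> bool" where
  "local_parametrization S U r \<longleftrightarrow>
     open U \<and> smooth_on U r \<and> (\<forall>y\<in>U. area_element r y \<noteq> 0) \<and>
     (\<exists>q. homeomorphism U (r ` U) r q) \<and> openin (top_of_set S) (r ` U)"

definition smooth_surface :: "(real^3) set \<Rightarrow> bool" where
  "smooth_surface S \<longleftrightarrow> (\<forall>p\<in>S. \<exists>U r. local_parametrization S U r \<and> p \<in> r ` U)"

text \<open>Surface measure of an embedded surface \<open>S\<close>, as a Borel measure on the ambient space: the unique
  one that does not charge the complement of \<open>S\<close> and gives a Borel set inside the image of a
  parametrization \<open>r\<close> the area \<open>\<integral> |\<partial>\<^sub>1 r \<times> \<partial>\<^sub>2 r|\<close>.\<close>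

definition is_surface_measure :: "(real^3) set \<Rightarrow> (real^3) measure \<Rightarrow> bool" where
  "is_surface_measure S \<mu> \<longleftrightarrow>
     sets \<mu> = sets borel \<and> emeasure \<mu> (- S) = 0 \<and>
     (\<forall>U r. local_parametrization S U r \<longrightarrow>
       (\<forall>B\<in>sets borel. B \<subseteq> r ` U \<longrightarrow>
         emeasure \<mu> B = (\<integral>\<^sup>+y\<in>{y\<in>U. r y \<in> B}. ennreal (area_element r y) \<partial>lborel)))"

definition surface_measure :: "(real^3) set \<Rightarrow> (real^3) measure" where
  "surface_measure S = (THE \<mu>. is_surface_measure S \<mu>)"

definition zero_level :: "(real^3 \<Rightarrow> real \<Rightarrow> real) \<Rightarrow> real \<Rightarrow> (real^3) set" where
  "zero_level \<phi> t = {x. \<phi> x t = 0}"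

definition unit_normal :: "(real^3 \<Rightarrow> real \<Rightarrow> real) \<Rightarrow> real \<Rightarrow> real^3 \<Rightarrow> real^3" where
  "unit_normal \<phi> t x = (1 / norm (grad (\<lambda>y. \<phi> y t) x)) *\<^sub>R grad (\<lambda>y. \<phi> y t) x"

definition Jn :: "(real^3 \<Rightarrow> real) \<Rightarrow> (real^3 \<Rightarrow> real \<Rightarrow> real) \<Rightarrow> real \<Rightarrow> real" where
  "Jn f \<phi> t = (\<integral>x. f (unit_normal \<phi> t x) \<partial>surface_measure (zero_level \<phi> t))"

end

(*
  By homogeneity f(n) |grad phi| = f(grad phi), so the coarea formula turns J into the limit, as eps -> 0, of the
  volume integrals A_eps(t) of h_eps(phi) f(grad phi) over a fixed neighbourhood W of the surface, where h_eps is a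
  bump of mass 1 supported in [-eps, eps].  For these, differentiation under the integral, the divergence theorem
  applied to h_eps(phi) phi_t (grad f)(grad phi), and Euler's identity grad f(p) . p = f(p) give
  A_eps' = B_eps, the integral of - h_eps(phi) phi_t div((grad f)(grad phi)).  Integrating by parts along
  grad phi / |grad phi|^2 bounds B_eps' by a constant times the volume integral of h_eps(phi), which is bounded
  uniformly in eps and t by Gronwall; so the first order expansion of A_eps at t has an error O((s - t)^2) uniform
  in eps, and it passes to the limit.  The limit of B_eps is the surface integral in the claim, as -phi_t = |grad phi| u . n
  and D(grad f)(p) w . p = 0 makes the divergence of (grad f)(n) tangential.  The coarea limit in a chart also shows that
  overlapping charts give the same area, hence that the surface measure exists.
*)

theory Submission
  imports Defs
begin

section \<open>Integrals and continuously differentiable maps\<close>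

text \<open>The surface is known only through \<open>\<phi>\<close>, so neither charts nor the flow
  of \<open>u\<close> are followed in time; every time derivative is taken of an integral over a
  fixed open set. The obstacle is the limit: layer integrals converge to surface integrals at each
  time separately, and such limits do not commute with differentiation. What helps is that
  differentiation maps layer integrals to layer integrals with the same cutoff: the time derivative
  of \<open>H(P) b\<close> contains a term with \<open>H'\<close>, of size 1 / eps^2, but if
  \<open>V . grad P = P_t b\<close>, then subtracting the divergence of \<open>H(P) V\<close>
  removes it and leaves \<open>H(P) (b_t - div V)\<close>. The step can be repeated, so second
  derivatives are bounded uniformly in eps, and one continuous derivative of the cutoff suffices.
  For \<open>f(grad phi)\<close> the field \<open>V\<close> is dictated by the desired limit; for
  the error bounds any field with the right normal component will do. Since
  \<open>surface_measure\<close> is a definite description, integrals against it carry no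
  information before existence and uniqueness are proved. Existence comes from the chart limit, so
  no transition map between charts is ever differentiated.\<close>

text \<open>The mean value inequality turns the bound on \<open>F'\<close> into the same bound on
  the difference quotients, so dominated convergence applies along every sequence that tends to
  \<open>s0\<close>.\<close>

lemma leibniz_rule_dominated:
  fixes F :: "real \<Rightarrow> 'a \<Rightarrow> real"
  assumes "d > 0"
    and deriv: "\<And>s x. \<bar>s - s0\<bar> < d \<Longrightarrow> ((\<lambda>s. F s x) has_real_derivative F' s x) (at s)"
    and bound: "\<And>s x. \<bar>s - s0\<bar> < d \<Longrightarrow> \<bar>F' s x\<bar> \<le> w x"
    and w: "integrable M w"
    and F: "\<And>s. \<bar>s - s0\<bar> < d \<Longrightarrow> integrable M (F s)"
  shows "((\<lambda>s. \<integral>x. F s x \<partial>M) has_real_derivative (\<integral>x. F' s0 x \<partial>M)) (at s0)"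
proof -
  let ?Q = "\<lambda>s x. (F s x - F s0 x) / (s - s0)"
  have Qlim: "((\<lambda>s. ?Q s x) \<longlongrightarrow> F' s0 x) (at s0)" for x
    using deriv[of s0 x] \<open>d > 0\<close> by (simp add: has_field_derivative_iff)
  have Qint: "integrable M (?Q s)" if "\<bar>s - s0\<bar> < d" for s
    using F[of s] F[of s0] \<open>d > 0\<close> that by auto
  have Qbound: "\<bar>?Q s x\<bar> \<le> w x" if s: "\<bar>s - s0\<bar> < d" "s \<noteq> s0" for s x
  proof -
    have "norm (F s x - F s0 x) \<le> w x * norm (s - s0)"
    proof (rule field_differentiable_bound[where S = "ball s0 d" and f' = "\<lambda>s. F' s x"])
      fix z assume "z \<in> ball s0 d"
      then have z: "\<bar>z - s0\<bar> < d" by (simp add: dist_real_def abs_minus_commute)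
      show "((\<lambda>s. F s x) has_field_derivative F' z x) (at z within ball s0 d)"
        using deriv[OF z] by (rule has_field_derivative_at_within)
      show "norm (F' z x) \<le> w x" using bound[OF z] by simp
    qed (use s \<open>d > 0\<close> in \<open>auto simp: dist_real_def abs_minus_commute\<close>)
    then show ?thesis using s by (simp add: abs_divide divide_le_eq)
  qed
  have main: "(\<lambda>n. \<integral>x. ?Q (X n) x \<partial>M) \<longlonglongrightarrow> (\<integral>x. F' s0 x \<partial>M)"
    if X: "\<And>n. \<bar>X n - s0\<bar> < d" "\<And>n. X n \<noteq> s0" "X \<longlonglongrightarrow> s0" for X :: "nat \<Rightarrow> real"
  proof -
    have XQ: "(\<lambda>n. ?Q (X n) x) \<longlonglongrightarrow> F' s0 x" for x
      using Qlim[of x] X(2,3) unfolding tendsto_at_iff_sequentially by (auto simp: o_def)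
    show ?thesis
    proof (rule integral_dominated_convergence[where w = w])
      show "F' s0 \<in> borel_measurable M"
        by (rule borel_measurable_LIMSEQ_real[OF XQ]) (use Qint[OF X(1)] in auto)
      show "?Q (X n) \<in> borel_measurable M" for n using Qint[OF X(1)] by auto
      show "AE x in M. norm (?Q (X n) x) \<le> w x" for n
        using Qbound[OF X(1) X(2)] by (intro AE_I2) simp
    qed (use w XQ in auto)
  qed
  have "((\<lambda>s. \<integral>x. ?Q s x \<partial>M) \<longlongrightarrow> (\<integral>x. F' s0 x \<partial>M)) (at s0)"
    unfolding tendsto_at_iff_sequentially
  proof (intro allI impI)
    fix X :: "nat \<Rightarrow> real" assume X: "\<forall>i. X i \<in> UNIV - {s0}" "X \<longlonglongrightarrow> s0"
    from X(2) \<open>d > 0\<close> obtain N where N: "\<And>n. n \<ge> N \<Longrightarrow> \<bar>X n - s0\<bar> < d"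
      unfolding LIMSEQ_def by (metis dist_real_def)
    have "(\<lambda>n. \<integral>x. ?Q (X (n + N)) x \<partial>M) \<longlonglongrightarrow> (\<integral>x. F' s0 x \<partial>M)"
      by (rule main) (use X N in \<open>auto intro: LIMSEQ_ignore_initial_segment\<close>)
    then show "((\<lambda>s. \<integral>x. ?Q s x \<partial>M) \<circ> X) \<longlonglongrightarrow> (\<integral>x. F' s0 x \<partial>M)"
      unfolding o_def by (rule LIMSEQ_offset)
  qed
  moreover have "\<forall>\<^sub>F s in at s0. (\<integral>x. ?Q s x \<partial>M) = ((\<integral>x. F s x \<partial>M) - (\<integral>x. F s0 x \<partial>M)) / (s - s0)"
    unfolding eventually_at using \<open>d > 0\<close> F
    by (intro exI[of _ d]) (auto simp: dist_real_def)
  ultimately show ?thesis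
    unfolding has_field_derivative_iff by (rule Lim_transform_eventually)
qed

text \<open>Translation invariance of Lebesgue measure makes the integral of
  \<open>F (s *\<^sub>R e + x)\<close> constant in \<open>s\<close>; differentiating under the
  integral at 0 gives the claim, without Fubini and for any direction.\<close>

lemma integral_directional_derivative_eq_0:
  fixes F :: "'a::euclidean_space \<Rightarrow> real"
  assumes deriv: "\<And>x. (F has_derivative F' x) (at x)"
    and C: "compact C" "\<And>x. x \<notin> C \<Longrightarrow> F x = 0"
    and bound: "\<And>x. \<bar>F' x e\<bar> \<le> B"
  shows "(\<integral>x. F' x e \<partial>lborel) = 0"
proof -
  have cont: "continuous_on UNIV F"
    by (intro continuous_at_imp_continuous_on ballI) (rule has_derivative_continuous[OF deriv])
  have [measurable]: "F \<in> borel_measurable borel" by (rule borel_measurable_continuous_onI[OF cont])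
  have "integrable lborel (\<lambda>x. indicator C x *\<^sub>R F x)"
    by (rule borel_integrable_compact) (use C cont in \<open>auto intro: continuous_on_subset\<close>)
  moreover have "(\<lambda>x. indicator C x *\<^sub>R F x) = F" using C(2) by (fastforce simp: indicator_def)
  ultimately have intF: "integrable lborel F" by simp
  have distr: "distr lborel lborel ((+) c) = lborel" for c :: 'a
  proof -
    have "distr lborel lborel ((+) c) = distr lborel borel ((+) c)"
      by (rule distr_cong) (rule refl sets_lborel)+
    also have "\<dots> = lborel" by (rule lborel_distr_plus)
    finally show ?thesis .
  qed
  have shift_int: "integrable lborel (\<lambda>x. F (c + x))" for c
    using integrable_distr_eq[of "(+) c" lborel lborel F] intF by (simp add: distr)
  have shift: "(\<integral>x. F (c + x) \<partial>lborel) = (\<integral>x. F x \<partial>lborel)" for c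
    using integral_distr[of "(+) c" lborel lborel F] by (simp add: distr)
  \<comment> \<open>Contains every \<open>x\<close> that some shift with parameter in [-1, 1] moves
    into \<open>C\<close>, so that one dominating function serves all the shifts.\<close>
  define C' where "C' = (\<lambda>(y, s). y - s *\<^sub>R e) ` (C \<times> {-1..1::real})"
  have C': "compact C'" unfolding C'_def split_beta
    by (intro compact_continuous_image continuous_intros compact_Times C compact_Icc)
  have F'0: "F' x = (\<lambda>_. 0)" if "x \<notin> C" for x
  proof -
    have "(F has_derivative (\<lambda>_. 0)) (at x)"
      by (rule has_derivative_transform_within_open[where f = "\<lambda>_. 0" and s = "- C"])
         (use C that compact_imp_closed in auto)
    then show ?thesis using deriv has_derivative_unique by blast
  qed
  have B: "B \<ge> 0" using bound[of 0] by linarith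
  have "((\<lambda>s. \<integral>x. F (s *\<^sub>R e + x) \<partial>lborel) has_real_derivative (\<integral>x. F' (0 *\<^sub>R e + x) e \<partial>lborel)) (at 0)"
  proof (rule leibniz_rule_dominated[where d = 1 and w = "\<lambda>x. indicator C' x *\<^sub>R B" and F' = "\<lambda>s x. F' (s *\<^sub>R e + x) e"])
    fix s :: real and x assume s: "\<bar>s - 0\<bar> < 1"
    have "((\<lambda>s. s *\<^sub>R e + x) has_derivative (\<lambda>h. h *\<^sub>R e)) (at s)"
      by (auto intro!: derivative_eq_intros)
    then have "((\<lambda>s. F (s *\<^sub>R e + x)) has_derivative (\<lambda>h. F' (s *\<^sub>R e + x) (h *\<^sub>R e))) (at s)"
      using deriv[of "s *\<^sub>R e + x"] by (rule has_derivative_compose)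
    moreover have "F' (s *\<^sub>R e + x) (h *\<^sub>R e) = F' (s *\<^sub>R e + x) e * h" for h
      using linear_scale[OF has_derivative_linear[OF deriv]] by simp
    ultimately show "((\<lambda>s. F (s *\<^sub>R e + x)) has_real_derivative F' (s *\<^sub>R e + x) e) (at s)"
      by (simp add: has_field_derivative_def)
    show "\<bar>F' (s *\<^sub>R e + x) e\<bar> \<le> indicator C' x *\<^sub>R B"
    proof (cases "s *\<^sub>R e + x \<in> C")
      case True
      have "x = (\<lambda>(y, s). y - s *\<^sub>R e) (s *\<^sub>R e + x, s)" by simp
      then have "x \<in> C'" unfolding C'_def using True s by (intro image_eqI[of x _ "(s *\<^sub>R e + x, s)"]) auto
      then show ?thesis using bound by simp
    qed (use B in \<open>simp add: F'0\<close>)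
  next
    show "integrable lborel (\<lambda>x. indicator C' x *\<^sub>R B)"
      by (rule borel_integrable_compact[OF C']) simp
  qed (use shift_int in auto)
  moreover have "((\<lambda>s. \<integral>x. F (s *\<^sub>R e + x) \<partial>lborel) has_real_derivative 0) (at 0)"
    by (simp add: shift)
  ultimately show ?thesis using DERIV_unique by fastforce
qed

section \<open>Calculus of C^1 maps with explicit derivatives\<close>

text \<open>The derivative is an argument, so that the rules below compute it. Continuity is asked
  for each fixed direction, as in \<open>Ck_on\<close>; in finite dimension this amounts to
  continuity of the derivative.\<close>

definition C1_on ::
  "'a::euclidean_space set \<Rightarrow> ('a \<Rightarrow> 'b::real_normed_vector) \<Rightarrow> ('a \<Rightarrow> 'a \<Rightarrow> 'b) \<Rightarrow> bool" where
  "C1_on S g g' \<longleftrightarrow> (\<forall>x\<in>S. (g has_derivative g' x) (at x)) \<and> (\<forall>v. continuous_on S (\<lambda>x. g' x v))"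

lemma C1_onD:
  assumes "C1_on S g g'"
  shows "x \<in> S \<Longrightarrow> (g has_derivative g' x) (at x)" "continuous_on S (\<lambda>x. g' x v)"
  using assms by (auto simp: C1_on_def)

lemma C1_on_imp_continuous_on: "C1_on S g g' \<Longrightarrow> continuous_on S g"
  by (meson C1_onD(1) continuous_at_imp_continuous_on has_derivative_continuous)

lemma C1_on_subset: "C1_on S g g' \<Longrightarrow> R \<subseteq> S \<Longrightarrow> C1_on R g g'"
  by (auto simp: C1_on_def intro: continuous_on_subset)

lemma C1_on_derivative_linear: "C1_on S g g' \<Longrightarrow> x \<in> S \<Longrightarrow> linear (g' x)"
  using C1_onD(1) has_derivative_linear by blast

lemma linear_expand_Basis:
  fixes w :: "'a::euclidean_space"
  assumes "linear L"
  shows "L w = (\<Sum>i\<in>Basis. (w \<bullet> i) *\<^sub>R L i)"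
  by (metis (no_types, lifting) assms euclidean_representation linear_scale linear_sum sum.cong)

text \<open>Expanding the direction in the basis reduces joint continuity in point and direction to
  continuity for fixed directions.\<close>

lemma C1_on_continuous_derivative:
  fixes w :: "'c::topological_space \<Rightarrow> 'a::euclidean_space"
  assumes "C1_on S g g'" "continuous_on R p" "continuous_on R w" "p ` R \<subseteq> S"
  shows "continuous_on R (\<lambda>z. g' (p z) (w z))"
proof -
  have "continuous_on R (\<lambda>z. \<Sum>i\<in>Basis. (w z \<bullet> i) *\<^sub>R g' (p z) i)"
    by (intro continuous_intros assms continuous_on_compose2[OF C1_onD(2)[OF assms(1)] assms(2)])
  moreover have "g' (p z) (w z) = (\<Sum>i\<in>Basis. (w z \<bullet> i) *\<^sub>R g' (p z) i)" if "z \<in> R" for z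
    by (rule linear_expand_Basis) (use that assms C1_on_derivative_linear in blast)
  ultimately show ?thesis by (auto intro: continuous_on_eq)
qed

lemma C1_on_const: "C1_on S (\<lambda>_. c) (\<lambda>_ _. 0)"
  by (auto simp: C1_on_def)

lemma C1_on_minus: "C1_on S f f' \<Longrightarrow> C1_on S (\<lambda>x. - f x) (\<lambda>x v. - f' x v)"
  by (auto simp: C1_on_def intro!: has_derivative_minus continuous_intros)

lemma C1_on_sum:
  assumes "\<And>i. i \<in> A \<Longrightarrow> C1_on S (f i) (f' i)"
  shows "C1_on S (\<lambda>x. \<Sum>i\<in>A. f i x) (\<lambda>x v. \<Sum>i\<in>A. f' i x v)"
  using assms by (auto simp: C1_on_def intro!: has_derivative_sum continuous_intros)

lemma C1_on_scaleR:
  assumes "C1_on S f f'" "C1_on S g g'"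
  shows "C1_on S (\<lambda>x. f x *\<^sub>R g x) (\<lambda>x v. f x *\<^sub>R g' x v + f' x v *\<^sub>R g x)"
  using assms C1_on_imp_continuous_on[OF assms(1)] C1_on_imp_continuous_on[OF assms(2)]
  by (auto simp: C1_on_def intro!: has_derivative_scaleR continuous_intros)

lemma C1_on_mult:
  fixes f g :: "'a::euclidean_space \<Rightarrow> real"
  assumes "C1_on S f f'" "C1_on S g g'"
  shows "C1_on S (\<lambda>x. f x * g x) (\<lambda>x v. f x * g' x v + f' x v * g x)"
  using C1_on_scaleR[OF assms] by simp

lemma C1_on_inner:
  fixes f g :: "'a::euclidean_space \<Rightarrow> 'b::real_inner"
  assumes "C1_on S f f'" "C1_on S g g'"
  shows "C1_on S (\<lambda>x. f x \<bullet> g x) (\<lambda>x v. f x \<bullet> g' x v + f' x v \<bullet> g x)"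
  using assms C1_on_imp_continuous_on[OF assms(1)] C1_on_imp_continuous_on[OF assms(2)]
  by (auto simp: C1_on_def intro!: has_derivative_inner continuous_intros)

lemma C1_on_inverse:
  fixes f :: "'a::euclidean_space \<Rightarrow> real"
  assumes "C1_on S f f'" "\<And>x. x \<in> S \<Longrightarrow> f x \<noteq> 0"
  shows "C1_on S (\<lambda>x. inverse (f x)) (\<lambda>x v. - (inverse (f x) * f' x v * inverse (f x)))"
  using assms C1_on_imp_continuous_on[OF assms(1)]
  by (auto simp: C1_on_def intro!: has_derivative_inverse continuous_intros)

lemma C1_on_compose:
  fixes g :: "'a::euclidean_space \<Rightarrow> 'b::euclidean_space"
  assumes g: "C1_on S g g'" and F: "C1_on R F F'" and sub: "g ` S \<subseteq> R"
  shows "C1_on S (\<lambda>x. F (g x)) (\<lambda>x v. F' (g x) (g' x v))"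
  unfolding C1_on_def
proof (intro conjI ballI allI)
  show "((\<lambda>x. F (g x)) has_derivative (\<lambda>v. F' (g x) (g' x v))) (at x)" if "x \<in> S" for x
    using has_derivative_compose[OF C1_onD(1)[OF g that] C1_onD(1)[OF F, of "g x"]] that sub by blast
  show "continuous_on S (\<lambda>x. F' (g x) (g' x v))" for v
    by (rule C1_on_continuous_derivative[OF F C1_on_imp_continuous_on[OF g] C1_onD(2)[OF g] sub])
qed

lemma C1_on_vec:
  fixes f :: "'i::finite \<Rightarrow> 'a::euclidean_space \<Rightarrow> real"
  assumes "\<And>i. C1_on S (f i) (f' i)"
  shows "C1_on S (\<lambda>x. \<chi> i. f i x) (\<lambda>x v. \<chi> i. f' i x v)"
  unfolding C1_on_def
proof (intro conjI ballI allI)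
  show "((\<lambda>x. \<chi> i. f i x) has_derivative (\<lambda>v. \<chi> i. f' i x v)) (at x)" if "x \<in> S" for x
    unfolding has_derivative_componentwise_within[of "\<lambda>x. \<chi> i. f i x"]
    using assms that by (auto simp: C1_on_def Basis_vec_def inner_axis)
  show "continuous_on S (\<lambda>x. \<chi> i. f' i x v)" for v
    using assms by (intro continuous_intros) (auto simp: C1_on_def)
qed

lemma Ck_on_Suc_imp_C1_on:
  assumes "Ck_on (Suc 0) S g"
  shows "C1_on S g (\<lambda>x. frechet_derivative g (at x))"
  using assms by (auto simp: C1_on_def frechet_derivative_works[symmetric])

lemma smooth_on_imp_C1_on: "smooth_on S g \<Longrightarrow> C1_on S g (\<lambda>x. frechet_derivative g (at x))"
  unfolding smooth_on_def by (intro Ck_on_Suc_imp_C1_on) blast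

lemma smooth_on_derivative: "smooth_on S g \<Longrightarrow> smooth_on S (\<lambda>x. frechet_derivative g (at x) v)"
  unfolding smooth_on_def by (metis Ck_on.simps(2))

section \<open>Variation of integrals cut off near a level set\<close>

text \<open>The integrand lives on the compact set \<open>C\<close>, so the behaviour of
  \<open>g\<close> near the boundary of \<open>W\<close> is harmless.\<close>

lemma integrable_indicator_cutoff:
  fixes g :: "'a::euclidean_space \<Rightarrow> real"
  assumes "compact C" "C \<subseteq> W" "continuous_on W g" "\<And>x. x \<in> W \<Longrightarrow> x \<notin> C \<Longrightarrow> g x = 0"
  shows "integrable lborel (\<lambda>x. indicator W x * g x)"
proof -
  have "(\<lambda>x. indicator W x * g x) = (\<lambda>x. indicator C x *\<^sub>R g x)"
    using assms(2,4) by (auto simp: indicator_def fun_eq_iff)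
  moreover have "integrable lborel (\<lambda>x. indicator C x *\<^sub>R g x)"
    by (rule borel_integrable_compact) (use assms in \<open>auto intro: continuous_on_subset\<close>)
  ultimately show ?thesis by simp
qed

lemma C1_on_slice:
  assumes "C1_on (W \<times> I) g g'" "t \<in> I"
  shows "C1_on W (\<lambda>x. g (x, t)) (\<lambda>x v. g' (x, t) (v, 0))"
  unfolding C1_on_def
proof (intro conjI ballI allI)
  show "((\<lambda>x. g (x, t)) has_derivative (\<lambda>v. g' (x, t) (v, 0))) (at x)" if "x \<in> W" for x
  proof -
    have "((\<lambda>x. (x, t)) has_derivative (\<lambda>v. (v, 0))) (at x)"
      by (auto intro!: derivative_eq_intros)
    moreover have "(g has_derivative g' (x, t)) (at (x, t))"
      using C1_onD(1)[OF assms(1)] that assms(2) by simp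
    ultimately show ?thesis by (rule has_derivative_compose)
  qed
  show "continuous_on W (\<lambda>x. g' (x, t) (v, 0))" for v
    by (rule continuous_on_compose2[OF C1_onD(2)[OF assms(1)]]) (use assms(2) in \<open>auto intro!: continuous_intros\<close>)
qed

lemma C1_on_time_derivative:
  fixes g :: "'a::euclidean_space \<times> real \<Rightarrow> real"
  assumes "C1_on (W \<times> I) g g'" "x \<in> W" "t \<in> I"
  shows "((\<lambda>s. g (x, s)) has_real_derivative g' (x, t) (0, 1)) (at t)"
proof -
  have "((\<lambda>s. (x, s)) has_derivative (\<lambda>h. (0, h))) (at t)"
    by (auto intro!: derivative_eq_intros)
  moreover have "(g has_derivative g' (x, t)) (at (x, t))"
    using C1_onD(1)[OF assms(1)] assms(2,3) by simp
  ultimately have "((\<lambda>s. g (x, s)) has_derivative (\<lambda>h. g' (x, t) (0, h))) (at t)"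
    by (rule has_derivative_compose)
  moreover have "g' (x, t) (0, h) = g' (x, t) (0, 1) * h" for h
  proof -
    have "linear (g' (x, t))" using C1_on_derivative_linear[OF assms(1)] assms(2,3) by blast
    then show ?thesis using linear_scale[of "g' (x, t)" h "(0, 1)"] by simp
  qed
  then have "(\<lambda>h. g' (x, t) (0, h)) = (*) (g' (x, t) (0, 1))" by (intro ext)
  ultimately show ?thesis unfolding has_field_derivative_def by metis
qed

definition divergence_x :: "('a::euclidean_space \<times> real \<Rightarrow> 'a \<times> real \<Rightarrow> 'a) \<Rightarrow> 'a \<times> real \<Rightarrow> real" where
  "divergence_x V' z = (\<Sum>i\<in>Basis. V' z (i, 0) \<bullet> i)"

text \<open>The integrand is the spatial divergence of \<open>H(P) V\<close>. This field vanishes on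
  \<open>W - C\<close>, where \<open>P\<close> exceeds \<open>e\<close> in absolute value, so its
  extension by 0 is differentiable with compact support.\<close>

lemma integral_cutoff_divergence_eq_0:
  fixes V :: "'a::euclidean_space \<times> real \<Rightarrow> 'a"
  assumes "open W" "compact C" "C \<subseteq> W" "t \<in> I"
    and P: "C1_on (W \<times> I) P P'" and V: "C1_on (W \<times> I) V V'"
    and far: "\<And>x. x \<in> W \<Longrightarrow> x \<notin> C \<Longrightarrow> \<bar>P (x, t)\<bar> > e"
    and H: "\<And>s. (H has_real_derivative H' s) (at s)" "continuous_on UNIV H'"
      "\<And>s. \<bar>s\<bar> > e \<Longrightarrow> H s = 0" "\<And>s. \<bar>s\<bar> > e \<Longrightarrow> H' s = 0"
  shows "(\<integral>x. indicator W x * (H' (P (x, t)) * P' (x, t) (V (x, t), 0) + H (P (x, t)) * divergence_x V' (x, t)) \<partial>lborel) = 0"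
proof -
  have contH: "continuous_on A H" for A
    using H(1) by (meson DERIV_isCont continuous_at_imp_continuous_on)
  have contP: "continuous_on W (\<lambda>x. P (x, t))"
    by (rule C1_on_imp_continuous_on[OF C1_on_slice[OF P \<open>t \<in> I\<close>]])
  have contV: "continuous_on W (\<lambda>x. V (x, t))"
    by (rule C1_on_imp_continuous_on[OF C1_on_slice[OF V \<open>t \<in> I\<close>]])
  have contHP: "continuous_on W (\<lambda>x. H (P (x, t)))" "continuous_on W (\<lambda>x. H' (P (x, t)))"
    using continuous_on_compose2[OF contH contP subset_UNIV] continuous_on_compose2[OF H(2) contP] by auto
  \<comment> \<open>The derivative of the \<open>i\<close>-th component of \<open>H(P) V\<close>,
    extended by 0 outside \<open>W\<close>.\<close>
  define F' where "F' = (\<lambda>i x v. if x \<in> W then H' (P (x, t)) * P' (x, t) (v, 0) * (V (x, t) \<bullet> i) + H (P (x, t)) * (V' (x, t) (v, 0) \<bullet> i) else 0)"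
  have zero: "(\<integral>x. F' i x i \<partial>lborel) = 0" and int: "integrable lborel (\<lambda>x. F' i x i)" if "i \<in> Basis" for i
  proof -
    let ?F = "\<lambda>x. if x \<in> W then H (P (x, t)) * (V (x, t) \<bullet> i) else 0"
    have cont: "continuous_on W (\<lambda>x. H' (P (x, t)) * P' (x, t) (i, 0) * (V (x, t) \<bullet> i) + H (P (x, t)) * (V' (x, t) (i, 0) \<bullet> i))"
      by (intro continuous_intros contHP contV C1_onD(2)[OF C1_on_slice[OF V \<open>t \<in> I\<close>]] C1_onD(2)[OF C1_on_slice[OF P \<open>t \<in> I\<close>]])
    have F'0: "F' i x v = 0" if "x \<notin> C" for x v
      using far[of x] H(3,4) that by (auto simp: F'_def)
    have deriv: "(?F has_derivative F' i x) (at x)" for x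
    proof (cases "x \<in> W")
      case True
      have 1: "((\<lambda>x. P (x, t)) has_derivative (\<lambda>v. P' (x, t) (v, 0))) (at x)"
        by (rule C1_onD(1)[OF C1_on_slice[OF P \<open>t \<in> I\<close>] True])
      have 2: "((\<lambda>x. H (P (x, t))) has_derivative (\<lambda>v. H' (P (x, t)) * P' (x, t) (v, 0))) (at x)"
        by (rule has_derivative_compose[OF 1]) (use H(1) in \<open>simp add: has_field_derivative_def\<close>)
      have "((\<lambda>x. H (P (x, t)) * (V (x, t) \<bullet> i)) has_derivative F' i x) (at x)"
        using True unfolding F'_def
        by (auto intro!: derivative_eq_intros 2 C1_onD(1)[OF C1_on_slice[OF V \<open>t \<in> I\<close>]] simp: algebra_simps)
      then show ?thesis
        by (rule has_derivative_transform_within_open[where s = W]) (use True \<open>open W\<close> in auto)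
    next
      case False
      then have "x \<notin> C" using \<open>C \<subseteq> W\<close> by auto
      have "((\<lambda>_. 0) has_derivative (\<lambda>_. 0)) (at x)" by simp
      then have "(?F has_derivative (\<lambda>_. 0)) (at x)"
        by (rule has_derivative_transform_within_open[where s = "- C"])
           (use \<open>x \<notin> C\<close> \<open>compact C\<close> compact_imp_closed far H(3) in auto)
      moreover have "F' i x = (\<lambda>_. 0)" using F'0 \<open>x \<notin> C\<close> by auto
      ultimately show ?thesis by simp
    qed
    have "continuous_on C (\<lambda>x. F' i x i)"
      by (rule continuous_on_eq[OF continuous_on_subset[OF cont \<open>C \<subseteq> W\<close>]])
         (use \<open>C \<subseteq> W\<close> in \<open>auto simp: F'_def\<close>)
    then have "compact ((\<lambda>x. F' i x i) ` C)"
      using \<open>compact C\<close> by (rule compact_continuous_image)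
    then obtain B where B: "\<And>x. x \<in> C \<Longrightarrow> \<bar>F' i x i\<bar> \<le> B"
      using compact_imp_bounded bounded_iff by (metis imageI real_norm_def)
    show "(\<integral>x. F' i x i \<partial>lborel) = 0"
    proof (rule integral_directional_derivative_eq_0[OF deriv \<open>compact C\<close>])
      show "?F x = 0" if "x \<notin> C" for x using far[of x] H(3) that by auto
      show "\<bar>F' i x i\<bar> \<le> max B 0" for x using B[of x] F'0[of x i] by (cases "x \<in> C") auto
    qed
    have "integrable lborel (\<lambda>x. indicator W x * (H' (P (x, t)) * P' (x, t) (i, 0) * (V (x, t) \<bullet> i) + H (P (x, t)) * (V' (x, t) (i, 0) \<bullet> i)))"
      by (rule integrable_indicator_cutoff[OF \<open>compact C\<close> \<open>C \<subseteq> W\<close> cont]) (use far H(3,4) in auto)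
    moreover have "(\<lambda>x. F' i x i) = (\<lambda>x. indicator W x * (H' (P (x, t)) * P' (x, t) (i, 0) * (V (x, t) \<bullet> i) + H (P (x, t)) * (V' (x, t) (i, 0) \<bullet> i)))"
      by (auto simp: F'_def fun_eq_iff)
    ultimately show "integrable lborel (\<lambda>x. F' i x i)" by simp
  qed
  have "indicator W x * (H' (P (x, t)) * P' (x, t) (V (x, t), 0) + H (P (x, t)) * divergence_x V' (x, t)) = (\<Sum>i\<in>Basis. F' i x i)" for x
  proof (cases "x \<in> W")
    case True
    have "linear (\<lambda>v. P' (x, t) (v, 0))"
      using C1_on_derivative_linear[OF C1_on_slice[OF P \<open>t \<in> I\<close>] True] .
    from linear_expand_Basis[OF this, of "V (x, t)"]
    have "P' (x, t) (V (x, t), 0) = (\<Sum>i\<in>Basis. (V (x, t) \<bullet> i) * P' (x, t) (i, 0))" by simp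
    then show ?thesis using True
      by (simp add: F'_def divergence_x_def sum.distrib sum_distrib_left algebra_simps)
  qed (simp add: F'_def)
  then show ?thesis using zero int by (simp add: Bochner_Integration.integral_sum)
qed

text \<open>The condition on \<open>V\<close> says \<open>V \<cdot> \<nabla>P = P\<^sub>t b\<close>; it makes the terms with \<open>H'\<close> cancel.\<close>

lemma cutoff_integral_has_derivative:
  fixes V :: "'a::euclidean_space \<times> real \<Rightarrow> 'a"
  assumes "open W" "open I" "compact C" "C \<subseteq> W" "t \<in> I"
    and P: "C1_on (W \<times> I) P P'" and V: "C1_on (W \<times> I) V V'" and b: "C1_on (W \<times> I) b b'"
    and far: "\<And>x s. x \<in> W \<Longrightarrow> s \<in> I \<Longrightarrow> x \<notin> C \<Longrightarrow> \<bar>P (x, s)\<bar> > e"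
    and H: "\<And>s. (H has_real_derivative H' s) (at s)" "continuous_on UNIV H'"
      "\<And>s. \<bar>s\<bar> > e \<Longrightarrow> H s = 0" "\<And>s. \<bar>s\<bar> > e \<Longrightarrow> H' s = 0"
    and VP: "\<And>x. x \<in> W \<Longrightarrow> P' (x, t) (V (x, t), 0) = P' (x, t) (0, 1) * b (x, t)"
  shows "((\<lambda>s. \<integral>x. indicator W x * (H (P (x, s)) * b (x, s)) \<partial>lborel) has_real_derivative
           (\<integral>x. indicator W x * (H (P (x, t)) * (b' (x, t) (0, 1) - divergence_x V' (x, t))) \<partial>lborel)) (at t)"
proof -
  have contH: "continuous_on A H" for A
    using H(1) by (meson DERIV_isCont continuous_at_imp_continuous_on)
  define D where "D = (\<lambda>z. H' (P z) * P' z (0, 1) * b z + H (P z) * b' z (0, 1))"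
  have contD: "continuous_on (W \<times> I) D"
    unfolding D_def
    by (intro continuous_intros continuous_on_compose2[OF contH C1_on_imp_continuous_on[OF P] subset_UNIV]
        continuous_on_compose2[OF H(2) C1_on_imp_continuous_on[OF P]] C1_onD(2)[OF P] C1_onD(2)[OF b]
        C1_on_imp_continuous_on[OF b]) auto
  have contHb: "continuous_on (W \<times> I) (\<lambda>z. H (P z) * b z)"
    by (intro continuous_intros continuous_on_compose2[OF contH C1_on_imp_continuous_on[OF P] subset_UNIV]
        C1_on_imp_continuous_on[OF b])
  have slice: "continuous_on W (\<lambda>x. g (x, s))" if "continuous_on (W \<times> I) g" "s \<in> I" for g :: "'a \<times> real \<Rightarrow> real" and s
    by (rule continuous_on_compose2[OF that(1)]) (use that(2) in \<open>auto intro!: continuous_intros\<close>)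
  have D0: "D (x, s) = 0" if "x \<in> W" "x \<notin> C" "s \<in> I" for x s
    using far[of x s] H(3,4) that by (simp add: D_def)
  obtain d where d: "d > 0" "cball t d \<subseteq> I" using \<open>open I\<close> \<open>t \<in> I\<close> open_contains_cball by blast
  have "compact (D ` (C \<times> cball t d))"
    by (intro compact_continuous_image compact_Times \<open>compact C\<close> compact_cball
        continuous_on_subset[OF contD]) (use \<open>C \<subseteq> W\<close> d(2) in auto)
  then obtain B where B: "\<And>z. z \<in> C \<times> cball t d \<Longrightarrow> \<bar>D z\<bar> \<le> B"
    using compact_imp_bounded bounded_iff by (metis imageI real_norm_def)
  have inI: "s \<in> I" "s \<in> cball t d" if "\<bar>s - t\<bar> < d" for s
    using that d(2) by (auto simp: dist_real_def abs_minus_commute subset_iff)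
  have deriv1: "((\<lambda>s. \<integral>x. indicator W x * (H (P (x, s)) * b (x, s)) \<partial>lborel) has_real_derivative
           (\<integral>x. indicator W x * D (x, t) \<partial>lborel)) (at t)"
  proof (rule leibniz_rule_dominated[OF d(1), where F' = "\<lambda>s x. indicator W x * D (x, s)" and w = "\<lambda>x. indicator C x *\<^sub>R B"])
    fix s x assume s: "\<bar>s - t\<bar> < d"
    show "((\<lambda>s. indicator W x * (H (P (x, s)) * b (x, s))) has_real_derivative indicator W x * D (x, s)) (at s)"
    proof (cases "x \<in> W")
      case True
      have 1: "((\<lambda>s. P (x, s)) has_real_derivative P' (x, s) (0, 1)) (at s)"
        by (rule C1_on_time_derivative[OF P True inI(1)[OF s]])
      have "((\<lambda>s. H (P (x, s))) has_real_derivative H' (P (x, s)) * P' (x, s) (0, 1)) (at s)"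
        by (rule DERIV_chain2[OF H(1) 1])
      from DERIV_mult[OF this C1_on_time_derivative[OF b True inI(1)[OF s]]] show ?thesis
        using True by (simp add: D_def algebra_simps)
    qed simp
    show "\<bar>indicator W x * D (x, s)\<bar> \<le> indicator C x *\<^sub>R B"
      using B[of "(x, s)"] inI[OF s] D0[of x s] by (cases "x \<in> C") (auto simp: indicator_def)
  next
    show "integrable lborel (\<lambda>x. indicator C x *\<^sub>R B)"
      by (rule borel_integrable_compact[OF \<open>compact C\<close>]) simp
    show "integrable lborel (\<lambda>x. indicator W x * (H (P (x, s)) * b (x, s)))" if "\<bar>s - t\<bar> < d" for s
      by (rule integrable_indicator_cutoff[OF \<open>compact C\<close> \<open>C \<subseteq> W\<close> slice[OF contHb inI(1)[OF that]]])
         (use far H(3) inI(1)[OF that] in auto)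
  qed
  \<comment> \<open>The divergence of \<open>H(P) V\<close>. Its integral is 0, so it may be
    subtracted from that of \<open>D\<close>, the time derivative of the integrand.\<close>
  let ?E = "\<lambda>x. H' (P (x, t)) * P' (x, t) (V (x, t), 0) + H (P (x, t)) * divergence_x V' (x, t)"
  have cVP: "continuous_on W (\<lambda>x. P' (x, t) (V (x, t), 0))"
    by (rule C1_on_continuous_derivative[OF C1_on_slice[OF P \<open>t \<in> I\<close>]])
       (auto intro!: continuous_intros C1_on_imp_continuous_on[OF C1_on_slice[OF V \<open>t \<in> I\<close>]])
  have contE: "continuous_on W ?E"
    unfolding divergence_x_def
    by (intro continuous_intros cVP C1_onD(2)[OF C1_on_slice[OF V \<open>t \<in> I\<close>]]
       continuous_on_compose2[OF contH C1_on_imp_continuous_on[OF C1_on_slice[OF P \<open>t \<in> I\<close>]] subset_UNIV]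
       continuous_on_compose2[OF H(2) C1_on_imp_continuous_on[OF C1_on_slice[OF P \<open>t \<in> I\<close>]]]) auto
  have intE: "integrable lborel (\<lambda>x. indicator W x * ?E x)"
    by (rule integrable_indicator_cutoff[OF \<open>compact C\<close> \<open>C \<subseteq> W\<close> contE]) (use far H(3,4) \<open>t \<in> I\<close> in auto)
  have intD: "integrable lborel (\<lambda>x. indicator W x * D (x, t))"
    by (rule integrable_indicator_cutoff[OF \<open>compact C\<close> \<open>C \<subseteq> W\<close> slice[OF contD \<open>t \<in> I\<close>]]) (use D0 \<open>t \<in> I\<close> in auto)
  have "(\<integral>x. indicator W x * D (x, t) \<partial>lborel) = (\<integral>x. indicator W x * D (x, t) \<partial>lborel) - (\<integral>x. indicator W x * ?E x \<partial>lborel)"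
    using integral_cutoff_divergence_eq_0[OF \<open>open W\<close> \<open>compact C\<close> \<open>C \<subseteq> W\<close> \<open>t \<in> I\<close> P V far[OF _ \<open>t \<in> I\<close>] H] by simp
  also have "\<dots> = (\<integral>x. indicator W x * D (x, t) - indicator W x * ?E x \<partial>lborel)"
    by (rule Bochner_Integration.integral_diff[OF intD intE, symmetric])
  also have "\<dots> = (\<integral>x. indicator W x * (H (P (x, t)) * (b' (x, t) (0, 1) - divergence_x V' (x, t))) \<partial>lborel)"
    by (rule Bochner_Integration.integral_cong) (auto simp: indicator_def D_def VP algebra_simps)
  finally show ?thesis using deriv1 by simp
qed

section \<open>Coarea limit in a chart\<close>

text \<open>The factor 15 / 16 gives integral 1. The square makes the profile C^1 across -1 and 1,
  which is enough: \<open>cutoff_integral_has_derivative\<close> returns an integral with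
  \<open>H\<close> itself, so \<open>H\<close> is never differentiated twice.\<close>

definition bump :: "real \<Rightarrow> real" where "bump s = 15 / 16 * (max 0 (1 - s\<^sup>2))\<^sup>2"

definition bump_deriv :: "real \<Rightarrow> real" where "bump_deriv s = - (15 / 4 * s * max 0 (1 - s\<^sup>2))"

lemma bump_has_derivative: "(bump has_real_derivative bump_deriv s) (at s)"
proof -
  have sq: "((\<lambda>x. (max 0 x)\<^sup>2) has_real_derivative 2 * max 0 y) (at y)" for y :: real
  proof -
    consider "y < 0" | "y > 0" | "y = 0" by linarith
    then show ?thesis
    proof cases
      case 1
      have "((\<lambda>x. 0) has_real_derivative 2 * max 0 y) (at y)" using 1 by simp
      then show ?thesis
        by (rule has_field_derivative_transform_within_open[where S = "{..<0}"]) (use 1 in auto)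
    next
      case 2
      have "((\<lambda>x. x\<^sup>2) has_real_derivative 2 * max 0 y) (at y)"
        using 2 by (auto intro!: derivative_eq_intros)
      then show ?thesis
        by (rule has_field_derivative_transform_within_open[where S = "{0<..}"]) (use 2 in auto)
    next
      case 3
      have lim: "((\<lambda>h::real. max 0 h) \<longlongrightarrow> max 0 0) (at 0)" by (intro tendsto_intros)
      have "((\<lambda>h. (max 0 h)\<^sup>2 / h) \<longlongrightarrow> 0) (at (0::real))"
        by (rule Lim_transform_eventually[OF lim[simplified]])
           (auto simp: eventually_at_filter power2_eq_square max_def)
      then show ?thesis using 3 by (simp add: DERIV_def)
    qed
  qed
  have "((\<lambda>s. 1 - s\<^sup>2) has_real_derivative - (2 * s)) (at s)" by (auto intro!: derivative_eq_intros)
  from DERIV_cmult[OF DERIV_chain2[OF sq this], of "15 / 16"] show ?thesis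
    unfolding bump_def[abs_def] bump_deriv_def by (simp add: mult_ac)
qed

lemma continuous_on_bump [continuous_intros]: "continuous_on A g \<Longrightarrow> continuous_on A (\<lambda>x. bump (g x))"
  unfolding bump_def by (intro continuous_intros)

lemma isCont_bump: "isCont bump s"
  using bump_has_derivative DERIV_isCont by blast

lemma continuous_bump_deriv: "continuous_on A bump_deriv"
  unfolding bump_deriv_def[abs_def] by (intro continuous_intros)

lemma bump_eq_0:
  assumes "1 \<le> \<bar>s\<bar>"
  shows "bump s = 0" "bump_deriv s = 0"
proof -
  have "1 \<le> s\<^sup>2" using power_mono[OF assms, of 2] by simp
  then show "bump s = 0" "bump_deriv s = 0" by (auto simp: bump_def bump_deriv_def)
qed

lemma bump_nonneg: "0 \<le> bump s"
  by (simp add: bump_def)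

lemma bump_le_1: "bump s \<le> 1"
proof -
  have "(max 0 (1 - s\<^sup>2))\<^sup>2 \<le> 1\<^sup>2" by (intro power_mono) auto
  then have "(max 0 (1 - s\<^sup>2))\<^sup>2 \<le> 1" by simp
  then show ?thesis unfolding bump_def by linarith
qed

lemma bump_measurable [measurable]: "bump \<in> borel_measurable borel"
  by (rule borel_measurable_continuous_onI) (intro continuous_intros)

lemma integral_bump: "(\<integral>s. bump s \<partial>lborel) = 1"
proof -
  let ?A = "\<lambda>s::real. 15 / 16 * (s - 2 * s ^ 3 / 3 + s ^ 5 / 5)"
  have "bump s = indicator {-1..1} s *\<^sub>R bump s" for s
    using bump_eq_0(1)[of s] by (cases "\<bar>s\<bar> \<le> 1") (auto simp: abs_le_iff)
  then have "(\<integral>s. bump s \<partial>lborel) = (\<integral>s. indicator {-1..1} s *\<^sub>R bump s \<partial>lborel)" by metis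
  also have "\<dots> = ?A 1 - ?A (-1)"
  proof (rule integral_FTC_atLeastAtMost)
    show "(?A has_vector_derivative bump x) (at x within {-1..1})" if "-1 \<le> x" "x \<le> 1" for x
    proof -
      have "x\<^sup>2 \<le> 1" using that by (simp add: abs_square_le_1)
      then have "bump x = 15 / 16 * (1 - 2 * x ^ 2 + x ^ 4)"
        by (simp add: bump_def power2_eq_square power4_eq_xxxx algebra_simps)
      then show ?thesis
        unfolding has_real_derivative_iff_has_vector_derivative[symmetric]
        by (auto intro!: derivative_eq_intros simp: field_simps)
    qed
  qed (auto intro!: continuous_intros)
  finally show ?thesis by simp
qed

text \<open>Later \<open>c\<close> is the slope of \<open>\<phi>\<close> along the thickening
  direction, and 1 / c is the amount of height per unit of \<open>\<phi>\<close>.\<close>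

lemma integral_bump_scaled:
  assumes "c > 0"
  shows "(\<integral>s. bump (s * c) \<partial>lborel) = 1 / c"
  using lborel_integral_real_affine[of c bump 0] assms integral_bump by (simp add: mult.commute field_simps)

section \<open>Space as plane times height\<close>

definition proj2 :: "real^3 \<Rightarrow> real^2" where
  "proj2 w = (\<chi> i. if i = 1 then w $ 1 else w $ 2)"

text \<open>Determinants and the change of variables call for maps of \<open>real^3\<close> to
  itself, while a thickened chart has a planar parameter and a height; \<open>proj2\<close> and
  \<open>join3\<close> translate between the two.\<close>

definition join3 :: "(real^2) \<times> real \<Rightarrow> real^3" where
  "join3 z = (\<chi> i. if i = 1 then fst z $ 1 else if i = 2 then fst z $ 2 else snd z)"

lemma join3_nth [simp]: "join3 z $ 1 = fst z $ 1" "join3 z $ 2 = fst z $ 2" "join3 z $ 3 = snd z"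
  by (simp_all add: join3_def)

lemma proj2_nth [simp]: "proj2 w $ 1 = w $ 1" "proj2 w $ 2 = w $ 2"
  by (simp_all add: proj2_def)

lemma proj2_join3 [simp]: "proj2 (join3 z) = fst z"
  by (simp add: vec_eq_iff forall_2)

lemma join3_proj2 [simp]: "join3 (proj2 w, w $ 3) = w"
  by (simp add: vec_eq_iff forall_3)

lemma linear_proj2: "linear proj2"
  by (rule linearI) (simp_all add: vec_eq_iff forall_2)

lemma linear_join3: "linear join3"
  by (rule linearI) (simp_all add: vec_eq_iff forall_3)

lemma continuous_on_proj2 [continuous_intros]: "continuous_on A g \<Longrightarrow> continuous_on A (\<lambda>x. proj2 (g x))"
  using bounded_linear.continuous_on[OF linear_proj2[unfolded linear_conv_bounded_linear]] .

lemma continuous_on_join3 [continuous_intros]: "continuous_on A g \<Longrightarrow> continuous_on A (\<lambda>x. join3 (g x))"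
  using bounded_linear.continuous_on[OF linear_join3[unfolded linear_conv_bounded_linear]] .

lemma join3_measurable [measurable]: "join3 \<in> borel_measurable borel"
  by (rule borel_measurable_continuous_onI) (intro continuous_intros)

lemma prod_Basis_vec:
  fixes f :: "real^'n \<Rightarrow> 'c::comm_monoid_mult"
  shows "(\<Prod>b\<in>Basis. f b) = (\<Prod>i\<in>UNIV. f (axis i 1))"
proof -
  have "(Basis :: (real^'n) set) = range (\<lambda>i. axis i 1)" by (auto simp: Basis_vec_def)
  moreover have "inj (\<lambda>i::'n. axis i (1::real))" by (simp add: inj_on_def axis_eq_axis)
  ultimately show ?thesis using prod.reindex[of "\<lambda>i. axis i 1" UNIV f] by (simp add: o_def)
qed

lemma prod_2: "(\<Prod>i\<in>(UNIV::2 set). f i) = f 1 * f 2"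
  unfolding UNIV_2 by simp

text \<open>Lebesgue measure is determined by the volumes of boxes, and the preimage of a box under
  \<open>join3\<close> is a planar box times an interval.\<close>

lemma lborel_eq_distr_join3: "lborel = distr lborel borel join3"
proof (rule lborel_eqI)
  fix l u :: "real^3" assume le: "\<And>b. b \<in> Basis \<Longrightarrow> l \<bullet> b \<le> u \<bullet> b"
  have le': "l $ i \<le> u $ i" for i using le[of "axis i 1"] by (simp add: inner_axis)
  have "join3 -` box l u = box (proj2 l) (proj2 u) \<times> box (l $ 3) (u $ 3)"
    by (auto simp: mem_box_cart forall_2 forall_3 box_real)
  moreover have "emeasure lborel (box (proj2 l) (proj2 u) \<times> box (l $ 3) (u $ 3)) =
      emeasure lborel (box (proj2 l) (proj2 u)) * emeasure lborel (box (l $ 3) (u $ 3))"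
    unfolding lborel_prod[symmetric] by (rule lborel.emeasure_pair_measure_Times) auto
  moreover have "emeasure lborel (box (proj2 l) (proj2 u)) = (\<Prod>i\<in>UNIV. (proj2 u - proj2 l) $ i)"
  proof -
    have "\<forall>b\<in>Basis. proj2 l \<bullet> b \<le> proj2 u \<bullet> b"
      using le' by (auto simp: Basis_vec_def inner_axis proj2_def)
    then show ?thesis
      by (simp add: emeasure_lborel_box_eq prod_Basis_vec inner_axis)
  qed
  moreover have "emeasure lborel (box (l $ 3) (u $ 3)) = ennreal (u $ 3 - l $ 3)"
    using le'[of 3] by (simp add: emeasure_lborel_box_eq)
  ultimately have "emeasure (distr lborel borel join3) (box l u) =
      ennreal ((u $ 1 - l $ 1) * (u $ 2 - l $ 2)) * ennreal (u $ 3 - l $ 3)"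
    by (simp add: emeasure_distr prod_2)
  also have "\<dots> = ennreal ((u $ 1 - l $ 1) * (u $ 2 - l $ 2) * (u $ 3 - l $ 3))"
    using le'[of 3] by (intro ennreal_mult''[symmetric]) simp
  also have "(u $ 1 - l $ 1) * (u $ 2 - l $ 2) * (u $ 3 - l $ 3) = (\<Prod>b\<in>Basis. (u - l) \<bullet> b)"
    unfolding prod_Basis_vec UNIV_3 by (simp add: inner_axis)
  finally show "emeasure (distr lborel borel join3) (box l u) = (\<Prod>b\<in>Basis. (u - l) \<bullet> b)" .
qed simp

lemma lborel_integral_join3:
  fixes F :: "real^3 \<Rightarrow> real"
  assumes "integrable lborel F"
  shows "(\<integral>w. F w \<partial>lborel) = (\<integral>y. \<integral>s. F (join3 (y, s)) \<partial>lborel \<partial>lborel)"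
proof -
  have [measurable]: "F \<in> borel_measurable borel" using assms by auto
  have "integrable lborel (\<lambda>z. F (join3 z))"
    using assms by (subst (asm) lborel_eq_distr_join3) (simp add: integrable_distr_eq)
  then have "(\<integral>y. \<integral>s. F (join3 (y, s)) \<partial>lborel \<partial>lborel) = (\<integral>z. F (join3 z) \<partial>lborel)"
    using lborel_pair.integral_fst'[of "\<lambda>z. F (join3 z)"] by (simp add: lborel_prod)
  also have "\<dots> = (\<integral>w. F w \<partial>lborel)"
    using integral_distr[of join3 lborel borel F] unfolding lborel_eq_distr_join3[symmetric] by simp
  finally show ?thesis by simp
qed

section \<open>Change of variables and linear algebra for a thickened chart\<close>

text \<open>Reading the scalar integrand as a vector in \<open>real^1\<close> makes
  \<open>has_absolute_integral_change_of_variables\<close> applicable; Borel measurability of both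
  integrands brings the result back from \<open>lebesgue\<close> to \<open>lborel\<close>.\<close>

lemma lborel_integral_change_of_variables:
  fixes g :: "real^'n::{finite,wellorder} \<Rightarrow> real^'n::_" and f :: "real^'n::_ \<Rightarrow> real"
  assumes S: "S \<in> sets borel" and gS: "g ` S \<in> sets borel"
    and der: "\<And>x. x \<in> S \<Longrightarrow> (g has_derivative g' x) (at x)" and inj: "inj_on g S"
    and f: "integrable lborel (\<lambda>x. indicator (g ` S) x * f x)"
    and meas: "(\<lambda>x. indicator S x * (\<bar>det (matrix (g' x))\<bar> * f (g x))) \<in> borel_measurable borel"
  shows "(\<integral>x. indicator (g ` S) x * f x \<partial>lborel) = (\<integral>x. indicator S x * (\<bar>det (matrix (g' x))\<bar> * f (g x)) \<partial>lborel)"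
    and "integrable lborel (\<lambda>x. indicator S x * (\<bar>det (matrix (g' x))\<bar> * f (g x)))"
proof -
  let ?J = "\<lambda>x. \<bar>det (matrix (g' x))\<bar> * f (g x)"
  have 1: "set_integrable lebesgue (g ` S) f"
    using f unfolding set_integrable_def by (simp add: integrable_completion)
  have "(\<lambda>x. vec (f x) :: real^1) absolutely_integrable_on (g ` S)"
    using 1 by (simp add: absolutely_integrable_on_1_iff)
  moreover have "S \<in> sets lebesgue" using S by auto
  ultimately have cv: "(\<lambda>x. \<bar>det (matrix (g' x))\<bar> *\<^sub>R (vec (f (g x)) :: real^1)) absolutely_integrable_on S \<and>
      integral S (\<lambda>x. \<bar>det (matrix (g' x))\<bar> *\<^sub>R (vec (f (g x)) :: real^1)) = integral (g ` S) (\<lambda>x. vec (f x))"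
    using has_absolute_integral_change_of_variables[OF _ has_derivative_at_withinI[OF der] inj,
        of "\<lambda>x. vec (f x)" "integral (g ` S) (\<lambda>x. vec (f x))"] by blast
  then have 2: "set_integrable lebesgue S ?J"
    by (simp add: absolutely_integrable_on_1_iff)
  have "integral S ?J = integral (g ` S) f"
    using cv by (simp add: integral_on_1_eq vec_eq_iff)
  then have "(LINT x:S|lebesgue. ?J x) = (LINT x:g ` S|lebesgue. f x)"
    using set_lebesgue_integral_eq_integral(2)[OF 1] set_lebesgue_integral_eq_integral(2)[OF 2] by simp
  then show "(\<integral>x. indicator (g ` S) x * f x \<partial>lborel) = (\<integral>x. indicator S x * ?J x \<partial>lborel)"
    using f meas unfolding set_lebesgue_integral_def by (simp add: integral_completion)
  show "integrable lborel (\<lambda>x. indicator S x * ?J x)"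
    using 2 meas unfolding set_integrable_def by (simp add: integrable_completion)
qed

text \<open>The operator norm is at most the sum of the norms of the values on the basis. This is
  the form of continuity that \<open>has_derivative_locally_injective\<close> asks for.\<close>

lemma C1_on_onorm_derivative_close:
  assumes g: "C1_on S g g'" and "open S" "a \<in> S" "e > 0"
  shows "\<exists>d>0. \<forall>x. dist a x < d \<longrightarrow> onorm (\<lambda>v. g' x v - g' a v) < e"
proof -
  let ?q = "\<lambda>x. \<Sum>b\<in>Basis. norm (g' x b - g' a b)"
  have cq: "continuous_on S ?q" by (intro continuous_intros C1_onD(2)[OF g])
  have "open (S \<inter> ?q -` {..<e})"
    by (rule continuous_open_preimage[OF cq \<open>open S\<close>]) simp
  moreover have "a \<in> S \<inter> ?q -` {..<e}" using assms by simp
  ultimately obtain d where d: "d > 0" "ball a d \<subseteq> S \<inter> ?q -` {..<e}" by (rule openE)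
  have "onorm (\<lambda>v. g' x v - g' a v) < e" if x: "dist a x < d" for x
  proof -
    have "x \<in> S" "?q x < e" using d(2) x by auto
    have "bounded_linear (\<lambda>v. g' x v - g' a v)"
      using C1_onD(1)[OF g \<open>x \<in> S\<close>] C1_onD(1)[OF g \<open>a \<in> S\<close>]
      by (intro bounded_linear_sub has_derivative_bounded_linear)
    from onorm_componentwise[OF this] show ?thesis using \<open>?q x < e\<close> by linarith
  qed
  then show ?thesis using d(1) by blast
qed

text \<open>In three dimensions a vector orthogonal to \<open>a\<close> and \<open>b\<close> is
  parallel to their cross product; the double cross product identity turns this into an equation
  that also covers the degenerate cases.\<close>

lemma cross3_normal_proportional:
  assumes "n \<bullet> a = 0" "n \<bullet> b = 0"
  shows "\<bar>cross3 a b \<bullet> v\<bar> * norm n = norm (cross3 a b) * \<bar>n \<bullet> v\<bar>"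
proof -
  have "cross3 n (cross3 a b) = 0" using assms by (simp add: Lagrange)
  then have "cross3 v (cross3 n (cross3 a b)) = 0" by simp
  then have "(v \<bullet> cross3 a b) *\<^sub>R n = (v \<bullet> n) *\<^sub>R cross3 a b"
    unfolding Lagrange[of v n "cross3 a b"] by simp
  then have "norm ((v \<bullet> cross3 a b) *\<^sub>R n) = norm ((v \<bullet> n) *\<^sub>R cross3 a b)" by simp
  then show ?thesis by (simp add: inner_commute mult.commute)
qed

text \<open>The columns are the two tangent vectors and \<open>c *\<^sub>R \<nu>\<close>, so the
  determinant is a triple product.\<close>

lemma det_matrix_thickening:
  assumes "linear L"
  shows "det (matrix (\<lambda>v. L (proj2 v) + (c * v $ 3) *\<^sub>R \<nu>)) = c * (cross3 (L (axis 1 1)) (L (axis 2 1)) \<bullet> \<nu>)"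
proof -
  have "proj2 (axis 1 1) = axis 1 1" "proj2 (axis 2 1) = axis 2 1" "proj2 (axis 3 1) = 0"
    by (simp_all add: vec_eq_iff forall_2 axis_def)
  moreover have "L 0 = 0" by (rule linear_0[OF assms])
  ultimately show ?thesis
    by (simp add: det_3 matrix_def cross3_def inner_vec_def sum_3 axis_def algebra_simps)
qed

lemma norm_join3 [simp]: "norm (join3 z) = norm z"
proof -
  have "join3 z \<bullet> join3 z = z \<bullet> z"
    by (cases z) (simp add: inner_vec_def sum_3 sum_2 inner_prod_def)
  then show ?thesis by (simp add: norm_eq_sqrt_inner)
qed

section \<open>Regular level sets and the limit in one chart\<close>

text \<open>A single time slice: \<open>\<phi>\<close> is a fixed function here, and
  \<open>g\<close> is its gradient on a neighbourhood \<open>W\<close> of the zero set.\<close>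

locale regular_level =
  fixes \<phi> :: "real^3 \<Rightarrow> real" and g :: "real^3 \<Rightarrow> real^3" and W :: "(real^3) set"
  assumes open_W: "open W"
    and deriv: "\<And>x. x \<in> W \<Longrightarrow> (\<phi> has_derivative (\<lambda>v. g x \<bullet> v)) (at x)"
    and cont_g: "continuous_on W g"
    and g_nz: "\<And>x. x \<in> W \<Longrightarrow> g x \<noteq> 0"
    and zero_in: "\<And>x. \<phi> x = 0 \<Longrightarrow> x \<in> W"
begin

lemma cont_phi: "continuous_on W \<phi>"
  by (intro continuous_at_imp_continuous_on ballI) (rule has_derivative_continuous[OF deriv])

text \<open>The factor \<open>norm (g x)\<close> is the one of the coarea formula; with it the layer
  integrals tend to the surface integral of \<open>k\<close> itself.\<close>

definition layer_density :: "(real^3 \<Rightarrow> real) \<Rightarrow> real \<Rightarrow> real^3 \<Rightarrow> real" where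
  "layer_density k \<epsilon> x = bump (\<phi> x / \<epsilon>) / \<epsilon> * (k x * norm (g x))"

text \<open>The thickening \<open>R \<epsilon> w = r (w\<^sub>1, w\<^sub>2) + \<epsilon> w\<^sub>3 \<nu>\<close> of the chart, with the fixed direction
  \<open>\<nu> = \<nabla>\<phi>(p)\<close>, is injective near \<open>p\<close>; after substituting it the layer integrals converge by dominated convergence.\<close>

lemma chart_layer_limit:
  assumes chart: "local_parametrization {x. \<phi> x = 0} U r" and y0: "y0 \<in> U"
  obtains \<rho> where "\<rho> > 0" "cball (r y0) \<rho> \<subseteq> W"
    "\<And>k. continuous_on W k \<Longrightarrow> (\<And>x. x \<notin> ball (r y0) \<rho> \<Longrightarrow> k x = 0) \<Longrightarrow>
        integrable lborel (\<lambda>y. indicator U y * (k (r y) * area_element r y))"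
    "\<And>k \<epsilon>. continuous_on W k \<Longrightarrow> (\<And>x. x \<notin> ball (r y0) \<rho> \<Longrightarrow> k x = 0) \<Longrightarrow>
        (\<And>n. \<epsilon> n > 0) \<Longrightarrow> \<epsilon> \<longlonglongrightarrow> 0 \<Longrightarrow>
        (\<lambda>n. \<integral>x. indicator W x * layer_density k (\<epsilon> n) x \<partial>lborel) \<longlonglongrightarrow>
          (\<integral>y. indicator U y * (k (r y) * area_element r y) \<partial>lborel)"
proof -
  define r' where "r' = (\<lambda>y. frechet_derivative r (at y))"
  define N where "N = (\<lambda>y. cross3 (r' y (axis 1 1)) (r' y (axis 2 1)))"
  have "open U" and sm: "smooth_on U r" and area_nz: "\<And>y. y \<in> U \<Longrightarrow> area_element r y \<noteq> 0"
    and hom: "\<exists>q. homeomorphism U (r ` U) r q" and openin_r: "openin (top_of_set {x. \<phi> x = 0}) (r ` U)"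
    using chart unfolding local_parametrization_def by auto
  have sub: "r ` U \<subseteq> {x. \<phi> x = 0}" by (rule openin_imp_subset[OF openin_r])
  have area: "area_element r y = norm (N y)" for y
    by (simp add: area_element_def N_def r'_def)
  have C1r: "C1_on U r r'" unfolding r'_def by (rule smooth_on_imp_C1_on[OF sm])
  have contr: "continuous_on U r" by (rule C1_on_imp_continuous_on[OF C1r])
  have contN: "continuous_on U N"
    unfolding N_def by (intro continuous_on_cross C1_onD(2)[OF C1r])
  have injr: "inj_on r U" using hom unfolding homeomorphism_def by (metis inj_on_inverseI)
  have phir: "\<phi> (r y) = 0" if "y \<in> U" for y using sub that by auto
  have rW: "r y \<in> W" if "y \<in> U" for y using phir[OF that] zero_in by blast
  have linr': "linear (r' y)" if "y \<in> U" for y by (rule C1_on_derivative_linear[OF C1r that])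
  have tangent: "g (r y) \<bullet> r' y v = 0" if "y \<in> U" for y v
  proof -
    have "((\<lambda>y. \<phi> (r y)) has_derivative (\<lambda>v. g (r y) \<bullet> r' y v)) (at y)"
      using C1_onD(1)[OF C1r that] deriv[OF rW[OF that]] by (rule has_derivative_compose)
    moreover have "((\<lambda>y. 0) has_derivative (\<lambda>v. 0)) (at y)" by simp
    then have "((\<lambda>y. \<phi> (r y)) has_derivative (\<lambda>v. 0)) (at y)"
      by (rule has_derivative_transform_within_open[where s = U]) (use that \<open>open U\<close> phir in auto)
    ultimately have "(\<lambda>v. g (r y) \<bullet> r' y v) = (\<lambda>v. 0)" by (rule has_derivative_unique)
    then show ?thesis by metis
  qed
  \<comment> \<open>With \<open>v = \<nu>\<close>: the Jacobian \<open>N . \<nu>\<close> of the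
    thickening, times the coarea factor, divided by the slope \<open>g . \<nu>\<close> of
    \<open>\<phi>\<close>, is in absolute value the area element.\<close>
  have area_identity: "\<bar>N y \<bullet> v\<bar> * norm (g (r y)) = norm (N y) * \<bar>g (r y) \<bullet> v\<bar>" if "y \<in> U" for y v
    unfolding N_def by (rule cross3_normal_proportional) (use tangent[OF that] in auto)
  \<comment> \<open>The direction is frozen because \<open>g\<close> is merely continuous: a
    thickening along \<open>g (r y)\<close> need not be differentiable.\<close>
  define \<nu> where "\<nu> = g (r y0)"
  have nu: "\<nu> \<noteq> 0" unfolding \<nu>_def by (rule g_nz[OF rW[OF y0]])
  have N_nu: "N y0 \<bullet> \<nu> \<noteq> 0"
  proof -
    have "norm (N y0) * \<bar>\<nu> \<bullet> \<nu>\<bar> \<noteq> 0" using area_nz[OF y0] nu by (simp add: area)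
    then show ?thesis using area_identity[OF y0, of \<nu>] unfolding \<nu>_def by auto
  qed
  define F where "F = (\<lambda>z. r (fst z) + snd z *\<^sub>R \<nu>)"
  define R where "R = (\<lambda>c w. r (proj2 w) + (c * w $ 3) *\<^sub>R \<nu>)"
  define R' where "R' = (\<lambda>c w v. r' (proj2 w) (proj2 v) + (c * v $ 3) *\<^sub>R \<nu>)"
  have RF: "R c w = F (proj2 w, c * w $ 3)" for c w by (simp add: R_def F_def)
  have contF: "continuous_on (U \<times> UNIV) F"
    unfolding F_def by (intro continuous_intros continuous_on_compose2[OF contr]) auto
  have R_deriv: "(R c has_derivative R' c w) (at w)" if "proj2 w \<in> U" for c w
  proof -
    have "(proj2 has_derivative proj2) (at w)"
      using linear_proj2 linear_conv_bounded_linear bounded_linear_imp_has_derivative by blast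
    from has_derivative_compose[OF this C1_onD(1)[OF C1r that]]
    have "((\<lambda>w. r (proj2 w)) has_derivative (\<lambda>v. r' (proj2 w) (proj2 v))) (at w)" .
    moreover have "((\<lambda>w. (c * w $ 3) *\<^sub>R \<nu>) has_derivative (\<lambda>v. (c * v $ 3) *\<^sub>R \<nu>)) (at w)"
      by (intro bounded_linear_imp_has_derivative linearI[THEN linear_conv_bounded_linear[THEN iffD1]])
         (auto simp: algebra_simps)
    ultimately show ?thesis unfolding R_def R'_def by (rule has_derivative_add)
  qed
  have detR': "det (matrix (R' c w)) = c * (N (proj2 w) \<bullet> \<nu>)" if "proj2 w \<in> U" for c w
    unfolding R'_def N_def by (rule det_matrix_thickening[OF linr'[OF that]])
  have C1R: "C1_on (proj2 -` U) (R 1) (R' 1)"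
    unfolding C1_on_def
  proof (intro conjI ballI allI)
    show "(R 1 has_derivative R' 1 w) (at w)" if "w \<in> proj2 -` U" for w using R_deriv that by simp
    show "continuous_on (proj2 -` U) (\<lambda>w. R' 1 w v)" for v
      unfolding R'_def by (intro continuous_intros continuous_on_compose2[OF C1_onD(2)[OF C1r]]) auto
  qed
  have openpU: "open (proj2 -` U)"
    by (rule open_vimage[OF \<open>open U\<close>]) (intro continuous_intros)
  define w0 where "w0 = join3 (y0, 0)"
  have w0: "w0 \<in> proj2 -` U" by (simp add: w0_def y0)
  obtain rr where rr: "rr > 0" "ball w0 rr \<subseteq> proj2 -` U" "inj_on (R 1) (ball w0 rr)"
  proof -
    have lin: "linear (R' 1 w0)" by (rule C1_on_derivative_linear[OF C1R w0])
    moreover have "inj (R' 1 w0)"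
      using det_nz_iff_inj[OF lin] detR'[of w0 1] N_nu w0 by (simp add: w0_def)
    ultimately obtain h where h: "linear h" "h \<circ> R' 1 w0 = id"
      using linear_injective_left_inverse by blast
    show ?thesis
      by (rule has_derivative_locally_injective[OF w0 openpU h(1)[unfolded linear_conv_bounded_linear] h(2) C1_onD(1)[OF C1R]
           C1_on_onorm_derivative_close[OF C1R openpU w0]]) (use that in auto)
  qed
  \<comment> \<open>Half of the slope of \<open>\<phi>\<close> along \<open>\<nu>\<close> at the
    base point; on \<open>P\<close> the slope stays above \<open>m\<close>.\<close>
  define m where "m = (\<nu> \<bullet> \<nu>) / 2"
  have m: "m > 0" using nu by (simp add: m_def)
  define P where "P = W \<inter> (\<lambda>x. g x \<bullet> \<nu>) -` {m<..}"
  have openP: "open P" unfolding P_def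
    by (rule continuous_open_preimage[OF _ open_W]) (auto intro!: continuous_intros cont_g)
  have p_P: "r y0 \<in> P" using rW[OF y0] nu by (simp add: P_def m_def \<nu>_def)
  have "open ((U \<times> UNIV) \<inter> F -` P)"
    by (rule continuous_open_preimage[OF contF _ openP]) (simp add: open_Times \<open>open U\<close>)
  moreover have "(y0, 0) \<in> (U \<times> UNIV) \<inter> F -` P" using y0 p_P by (simp add: F_def)
  ultimately obtain A B where AB: "open A" "open B" "(y0, 0) \<in> A \<times> B" "A \<times> B \<subseteq> (U \<times> UNIV) \<inter> F -` P"
    by (rule open_prod_elim)
  from AB obtain a1 a2 where a12: "a1 > 0" "cball y0 a1 \<subseteq> A" "a2 > 0" "cball (0::real) a2 \<subseteq> B"
    by (metis SigmaE2 open_contains_cball)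
  \<comment> \<open>\<open>a1\<close> and \<open>a2\<close> keep the closed product \<open>D\<close>
    where the slope bound holds; rr / 3 gives \<open>2 * a < rr\<close>, so the product of radius
    \<open>a\<close> in both factors fits into the ball on which \<open>R 1\<close> is
    injective.\<close>
  define a where "a = min (min a1 a2) (rr / 3)"
  have a: "a > 0" "a \<le> a1" "a \<le> a2" "2 * a < rr" using a12 rr by (auto simp: a_def)
  define D where "D = cball y0 a \<times> cball (0::real) a"
  have D_sub: "D \<subseteq> (U \<times> UNIV) \<inter> F -` P"
  proof -
    have "cball y0 a \<subseteq> A" "cball 0 a \<subseteq> B"
      using a12 subset_cball[OF a(2)] subset_cball[OF a(3)] by blast+
    then show ?thesis unfolding D_def using AB(4) by blast
  qed
  have cball_U: "cball y0 a \<subseteq> U"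
  proof
    fix y assume "y \<in> cball y0 a"
    then have "(y, 0) \<in> D" using a(1) by (simp add: D_def)
    then show "y \<in> U" using D_sub by blast
  qed
  have F_P: "F (y, s) \<in> P" if "dist y0 y \<le> a" "\<bar>s\<bar> \<le> a" for y s
  proof -
    have "(y, s) \<in> D" using that by (simp add: D_def)
    then show ?thesis using D_sub by blast
  qed
  have F_W: "F (y, s) \<in> W" if "dist y0 y \<le> a" "\<bar>s\<bar> \<le> a" for y s
    using F_P[OF that] by (simp add: P_def)
  \<comment> \<open>\<open>\<phi>\<close> grows at least linearly with the height. This serves
    twice: zeros of \<open>\<phi>\<close> have height 0, and the cutoff bounds the rescaled height
    uniformly in \<open>n\<close>.\<close>
  have key: "m * \<bar>s\<bar> \<le> \<bar>\<phi> (F (y, s))\<bar>" if y: "dist y0 y \<le> a" and s: "\<bar>s\<bar> \<le> a" for y s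
  proof -
    have yU: "y \<in> U" using y cball_U by auto
    let ?q = "\<lambda>s. \<phi> (F (y, s)) - m * s"
    have dq: "\<exists>d. (?q has_real_derivative d) (at s) \<and> 0 \<le> d" if s: "\<bar>s\<bar> \<le> a" for s
    proof -
      have "((\<lambda>s. F (y, s)) has_derivative (\<lambda>h. h *\<^sub>R \<nu>)) (at s)"
        unfolding F_def by (auto intro!: derivative_eq_intros)
      from has_derivative_compose[OF this deriv[OF F_W[OF y s]]]
      have "((\<lambda>s. \<phi> (F (y, s))) has_real_derivative (g (F (y, s)) \<bullet> \<nu>)) (at s)"
        by (simp add: has_field_derivative_def mult_commute_abs)
      then have "(?q has_real_derivative (g (F (y, s)) \<bullet> \<nu> - m)) (at s)"
        by (auto intro!: derivative_eq_intros)
      moreover have "m < g (F (y, s)) \<bullet> \<nu>" using F_P[OF y s] by (simp add: P_def)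
      ultimately show ?thesis by force
    qed
    have q0: "?q 0 = 0" using phir[OF yU] by (simp add: F_def)
    show ?thesis
    proof (cases "s \<ge> 0")
      case True
      have "?q 0 \<le> ?q s"
        by (rule DERIV_nonneg_imp_nondecreasing[OF True]) (use dq s in auto)
      then show ?thesis using q0 True by simp
    next
      case False
      have "?q s \<le> ?q 0"
        by (rule DERIV_nonneg_imp_nondecreasing) (use dq s False in auto)
      then show ?thesis using q0 False m by (simp add: abs_if mult_less_0_iff)
    qed
  qed
  \<comment> \<open>The bound is on the rescaled height \<open>c * w $ 3\<close>, so that
    \<open>R c\<close> has the same image on \<open>Q c\<close> for every positive
    \<open>c\<close>.\<close>
  define Q where "Q = (\<lambda>c. {w. proj2 w \<in> ball y0 a \<and> \<bar>c * w $ 3\<bar> < a})"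
  have openQ: "open (Q c)" for c
  proof -
    have "Q c = (\<lambda>w. (proj2 w, c * w $ 3)) -` (ball y0 a \<times> ball 0 a)"
      by (auto simp: Q_def dist_real_def)
    then show ?thesis by (auto intro!: open_vimage continuous_intros open_Times)
  qed
  have Q_sub: "Q 1 \<subseteq> ball w0 rr"
  proof
    fix w assume w: "w \<in> Q 1"
    have "w - w0 = join3 (proj2 w - y0, w $ 3)"
      by (simp add: w0_def vec_eq_iff forall_3)
    then have "norm (w - w0) \<le> norm (proj2 w - y0) + norm (w $ 3)"
      using norm_Pair_le[of "proj2 w - y0" "w $ 3"] by simp
    also have "\<dots> < rr" using w a(4) by (simp add: Q_def dist_norm norm_minus_commute)
    finally show "w \<in> ball w0 rr" by (simp add: dist_norm norm_minus_commute)
  qed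
  have Q_U: "proj2 w \<in> U" if "w \<in> Q c" for c w
    using that cball_U by (auto simp: Q_def)
  have injR1: "inj_on (R 1) (Q 1)" using rr(3) Q_sub by (rule inj_on_subset)
  \<comment> \<open>Invariance of domain: the image is a neighbourhood of \<open>r y0\<close>, and
    every point of it has a unique chart point and height.\<close>
  have "open (R 1 ` Q 1)"
    by (rule invariance_of_domain[OF _ openQ injR1])
       (use Q_U in \<open>auto intro!: continuous_on_subset[OF C1_on_imp_continuous_on[OF C1R]]\<close>)
  moreover have "r y0 \<in> R 1 ` Q 1"
    by (rule image_eqI[of _ _ w0]) (use a(1) in \<open>simp_all add: R_def w0_def Q_def\<close>)
  ultimately obtain \<rho> where \<rho>: "\<rho> > 0" "cball (r y0) \<rho> \<subseteq> R 1 ` Q 1"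
    by (meson open_contains_cball)
  have RQ_W: "R c ` Q c \<subseteq> W" for c
    using F_W by (auto simp: RF Q_def)
  have image: "R c ` Q c = R 1 ` Q 1" and injR: "inj_on (R c) (Q c)" if "c > 0" for c
  proof -
    show "R c ` Q c = R 1 ` Q 1"
    proof (intro equalityI image_subsetI)
      show "R c w \<in> R 1 ` Q 1" if "w \<in> Q c" for w
        by (rule image_eqI[of _ _ "join3 (proj2 w, c * w $ 3)"]) (use that in \<open>auto simp: RF Q_def\<close>)
      show "R 1 w \<in> R c ` Q c" if "w \<in> Q 1" for w
        by (rule image_eqI[of _ _ "join3 (proj2 w, w $ 3 / c)"]) (use that \<open>c > 0\<close> in \<open>auto simp: RF Q_def\<close>)
    qed
    show "inj_on (R c) (Q c)"
    proof (rule inj_onI)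
      fix w w' assume w: "w \<in> Q c" "w' \<in> Q c" "R c w = R c w'"
      have "join3 (proj2 w, c * w $ 3) = join3 (proj2 w', c * w' $ 3)"
        by (rule inj_onD[OF injR1]) (use w in \<open>auto simp: RF Q_def\<close>)
      from arg_cong[OF this, of proj2] arg_cong[OF this, of "\<lambda>w. w $ 3"]
      have "proj2 w = proj2 w'" "w $ 3 = w' $ 3" using \<open>c > 0\<close> by auto
      then show "w = w'" by (metis join3_proj2)
    qed
  qed
  \<comment> \<open>The chart does not return to the ball from afar: a point of the ball is
    \<open>R 1 w\<close>, on the zero set \<open>key\<close> makes its height 0, and injectivity of
    \<open>r\<close> gives \<open>y = proj2 w\<close>.\<close>
  have r_near: "y \<in> ball y0 a" if y: "y \<in> U" "r y \<in> cball (r y0) \<rho>" for y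
  proof -
    obtain w where w: "w \<in> Q 1" "r y = R 1 w" using \<rho>(2) y(2) by blast
    have "m * \<bar>w $ 3\<bar> \<le> \<bar>\<phi> (r y)\<bar>" using key[of "proj2 w" "w $ 3"] w by (simp add: RF Q_def)
    then have "w $ 3 = 0" using phir[OF y(1)] m by (simp add: mult_le_0_iff)
    then have "r y = r (proj2 w)" using w(2) by (simp add: R_def)
    then have "y = proj2 w" using injr y(1) Q_U[OF w(1)] by (auto dest: inj_onD)
    then show ?thesis using w(1) by (simp add: Q_def)
  qed
  show ?thesis
  proof (rule that[OF \<rho>(1)])
    show ball_W: "cball (r y0) \<rho> \<subseteq> W" using \<rho>(2) RQ_W by blast
    fix k :: "real^3 \<Rightarrow> real"
    assume contk: "continuous_on W k" and k0: "\<And>x. x \<notin> ball (r y0) \<rho> \<Longrightarrow> k x = 0"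
    have contkr: "continuous_on U (\<lambda>y. k (r y))"
      by (rule continuous_on_compose2[OF contk contr]) (use rW in auto)
    have kr0: "k (r y) = 0" if "y \<in> U" "y \<notin> ball y0 a" for y
      using r_near[OF that(1)] that(2) k0[of "r y"] ball_subset_cball by blast
    show "integrable lborel (\<lambda>y. indicator U y * (k (r y) * area_element r y))"
      unfolding area
      by (rule integrable_indicator_cutoff[OF compact_cball cball_U])
         (use kr0 in \<open>auto intro!: continuous_intros contkr contN\<close>)
    fix \<epsilon> :: "nat \<Rightarrow> real" assume eps: "\<And>n. \<epsilon> n > 0" "\<epsilon> \<longlonglongrightarrow> 0"
    let ?kg = "\<lambda>x. k x * norm (g x)"
    have contkg: "continuous_on W ?kg" by (intro continuous_intros contk cont_g)
    \<comment> \<open>The integrand after the substitution \<open>x = R (\<epsilon> n) w\<close>;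
      the factor \<open>\<epsilon> n\<close> of the Jacobian has cancelled against the one in the
      denominator of the density.\<close>
    define G where "G = (\<lambda>n w. indicator (Q (\<epsilon> n)) w * (\<bar>N (proj2 w) \<bullet> \<nu>\<bar> * (bump (\<phi> (R (\<epsilon> n) w) / \<epsilon> n) * ?kg (R (\<epsilon> n) w))) :: real)"
    \<comment> \<open>The pointwise limit, as
      \<open>\<phi> (R (\<epsilon> n) w) / \<epsilon> n\<close> tends to the height times the slope
      of \<open>\<phi>\<close> along \<open>\<nu>\<close>.\<close>
    define G0 where "G0 = (\<lambda>w. indicator (ball y0 a) (proj2 w) * (\<bar>N (proj2 w) \<bullet> \<nu>\<bar> *
        (bump (w $ 3 * (g (r (proj2 w)) \<bullet> \<nu>)) * ?kg (r (proj2 w)))) :: real)"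
    have contRQ: "continuous_on (Q c) (R c)" for c
      by (intro continuous_at_imp_continuous_on ballI has_derivative_continuous[OF R_deriv[OF Q_U]])
    have measG: "G n \<in> borel_measurable borel" for n
    proof -
      have "(\<lambda>w. indicator (Q (\<epsilon> n)) w *\<^sub>R (\<bar>N (proj2 w) \<bullet> \<nu>\<bar> * (bump (\<phi> (R (\<epsilon> n) w) / \<epsilon> n) * ?kg (R (\<epsilon> n) w)))) \<in> borel_measurable borel"
        by (rule borel_measurable_continuous_on_indicator)
           (use openQ eps(1)[of n] RQ_W[of "\<epsilon> n"] Q_U in \<open>auto intro!: continuous_intros continuous_on_compose2[OF contN]
             continuous_on_compose2[OF cont_phi contRQ] continuous_on_compose2[OF contkg contRQ]\<close>)
      then show ?thesis by (simp add: G_def)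
    qed
    have layer: "(\<integral>x. indicator W x * layer_density k (\<epsilon> n) x \<partial>lborel) = (\<integral>w. G n w \<partial>lborel)" for n
    proof -
      let ?\<epsilon> = "\<epsilon> n" let ?f = "layer_density k ?\<epsilon>"
      have eq: "indicator W x * ?f x = indicator (R ?\<epsilon> ` Q ?\<epsilon>) x * ?f x" for x
      proof (cases "x \<in> ball (r y0) \<rho>")
        case True
        then have "x \<in> cball (r y0) \<rho>" using ball_subset_cball by blast
        then have "x \<in> W" "x \<in> R ?\<epsilon> ` Q ?\<epsilon>" using \<rho>(2) ball_W image[OF eps(1)[of n]] by blast+
        then show ?thesis by simp
      qed (simp add: layer_density_def k0)
      have contf: "continuous_on W ?f"
        unfolding layer_density_def
        using eps(1)[of n] by (intro continuous_intros contk cont_g cont_phi) auto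
      have "integrable lborel (\<lambda>x. indicator W x * ?f x)"
        by (rule integrable_indicator_cutoff[OF compact_cball ball_W contf])
           (use k0 in \<open>auto simp: layer_density_def\<close>)
      then have int: "integrable lborel (\<lambda>x. indicator (R ?\<epsilon> ` Q ?\<epsilon>) x * ?f x)" by (simp only: eq)
      have G_eq: "indicator (Q ?\<epsilon>) w * (\<bar>det (matrix (R' ?\<epsilon> w))\<bar> * ?f (R ?\<epsilon> w)) = G n w" for w
        using detR'[OF Q_U, of w ?\<epsilon> ?\<epsilon>] eps(1)[of n]
        by (cases "w \<in> Q ?\<epsilon>") (simp_all add: G_def layer_density_def abs_mult)
      have "(\<integral>x. indicator W x * ?f x \<partial>lborel) = (\<integral>x. indicator (R ?\<epsilon> ` Q ?\<epsilon>) x * ?f x \<partial>lborel)"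
        by (simp only: eq)
      also have "\<dots> = (\<integral>w. indicator (Q ?\<epsilon>) w * (\<bar>det (matrix (R' ?\<epsilon> w))\<bar> * ?f (R ?\<epsilon> w)) \<partial>lborel)"
      proof (rule lborel_integral_change_of_variables(1))
        show "R ?\<epsilon> ` Q ?\<epsilon> \<in> sets borel"
          unfolding image[OF eps(1)] using \<open>open (R 1 ` Q 1)\<close> by simp
        show "(\<lambda>w. indicator (Q ?\<epsilon>) w * (\<bar>det (matrix (R' ?\<epsilon> w))\<bar> * ?f (R ?\<epsilon> w))) \<in> borel_measurable borel"
          unfolding G_eq by (rule measG)
      qed (use openQ R_deriv Q_U injR[OF eps(1)] int in auto)
      finally show ?thesis by (simp only: G_eq)
    qed
    define K where "K = F ` D"
    have K: "compact K" "K \<subseteq> W"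
      unfolding K_def using D_sub
      by (auto simp: D_def P_def intro!: compact_continuous_image compact_Times continuous_on_subset[OF contF])
    obtain Bk where Bk: "\<And>x. x \<in> K \<Longrightarrow> \<bar>?kg x\<bar> \<le> Bk"
      using compact_imp_bounded[OF compact_continuous_image[OF continuous_on_subset[OF contkg K(2)] K(1)]]
      by (auto simp: bounded_iff)
    obtain BN where BN: "\<And>y. y \<in> cball y0 a \<Longrightarrow> norm (N y) \<le> BN"
      using compact_imp_bounded[OF compact_continuous_image[OF continuous_on_subset[OF contN cball_U] compact_cball]]
      unfolding bounded_iff by blast
    have "norm (N y0) \<le> BN" by (rule BN) (use a(1) in simp)
    then have BN0: "BN \<ge> 0" using norm_ge_zero[of "N y0"] by linarith
    \<comment> \<open>By \<open>key\<close> the cutoff vanishes at heights above 1 / m, so all the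
      \<open>G n\<close> are supported in this compact set.\<close>
    define T where "T = join3 ` (cball y0 a \<times> cball 0 (1 / m))"
    have T: "compact T" unfolding T_def
      by (intro compact_continuous_image continuous_intros compact_Times compact_cball)
    define bound where "bound = BN * norm \<nu> * Bk"
    have G_bound: "\<bar>G n w\<bar> \<le> indicator T w *\<^sub>R bound" for n w
    proof (cases "w \<in> Q (\<epsilon> n)")
      case True
      then have w: "dist y0 (proj2 w) < a" "\<bar>\<epsilon> n * w $ 3\<bar> < a" by (auto simp: Q_def)
      have k: "\<bar>?kg (R (\<epsilon> n) w)\<bar> \<le> Bk"
        by (rule Bk) (use w in \<open>auto simp: K_def RF D_def\<close>)
      have "\<bar>N (proj2 w) \<bullet> \<nu>\<bar> \<le> norm (N (proj2 w)) * norm \<nu>" by (rule Cauchy_Schwarz_ineq2)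
      also have "\<dots> \<le> BN * norm \<nu>" by (intro mult_right_mono BN) (use w in auto)
      finally have n: "\<bar>N (proj2 w) \<bullet> \<nu>\<bar> \<le> BN * norm \<nu>" .
      show ?thesis
      proof (cases "w \<in> T")
        case T: True
        have "\<bar>bump (\<phi> (R (\<epsilon> n) w) / \<epsilon> n) * ?kg (R (\<epsilon> n) w)\<bar> \<le> 1 * Bk"
          unfolding abs_mult by (intro mult_mono) (use k bump_le_1 bump_nonneg in \<open>auto simp: abs_mult\<close>)
        then have "\<bar>N (proj2 w) \<bullet> \<nu>\<bar> * \<bar>bump (\<phi> (R (\<epsilon> n) w) / \<epsilon> n) * ?kg (R (\<epsilon> n) w)\<bar> \<le> (BN * norm \<nu>) * Bk"
          by (intro mult_mono n) (use BN0 in auto)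
        then show ?thesis using T True by (simp add: G_def bound_def abs_mult)
      next
        case False
        have "1 / m < \<bar>w $ 3\<bar>"
        proof (rule ccontr)
          assume "\<not> ?thesis"
          then have "join3 (proj2 w, w $ 3) \<in> T" unfolding T_def using w by (intro imageI) auto
          then show False using False by simp
        qed
        then have "1 < m * \<bar>w $ 3\<bar>" using m by (simp add: field_simps)
        moreover have "m * \<bar>\<epsilon> n * w $ 3\<bar> \<le> \<bar>\<phi> (R (\<epsilon> n) w)\<bar>"
          unfolding RF by (rule key) (use w in auto)
        then have "m * \<bar>w $ 3\<bar> \<le> \<bar>\<phi> (R (\<epsilon> n) w) / \<epsilon> n\<bar>"
          using eps(1)[of n] by (simp add: abs_mult field_simps)
        ultimately have "bump (\<phi> (R (\<epsilon> n) w) / \<epsilon> n) = 0" by (intro bump_eq_0) simp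
        then show ?thesis using False by (simp add: G_def)
      qed
    next
      case False
      have "0 \<le> Bk" using Bk[of "F (y0, 0)"] a(1) by (force simp: K_def D_def)
      then show ?thesis using False BN0 by (simp add: G_def bound_def)
    qed
    have G_lim: "(\<lambda>n. G n w) \<longlonglongrightarrow> G0 w" for w
    proof (cases "proj2 w \<in> ball y0 a")
      case True
      let ?y = "proj2 w" and ?s = "w $ 3"
      have yU: "?y \<in> U" using True cball_U by auto
      have lim_es: "(\<lambda>n. \<epsilon> n * ?s) \<longlonglongrightarrow> 0" using tendsto_mult_right[OF eps(2), of ?s] by simp
      have "\<forall>\<^sub>F n in sequentially. \<bar>\<epsilon> n * ?s\<bar> < a"
        using order_tendstoD(2)[OF tendsto_rabs[OF lim_es]] a(1) by simp
      then have ev: "\<forall>\<^sub>F n in sequentially. \<bar>N ?y \<bullet> \<nu>\<bar> * (bump (\<phi> (R (\<epsilon> n) w) / \<epsilon> n) * ?kg (R (\<epsilon> n) w)) = G n w"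
        by eventually_elim (use True in \<open>simp add: G_def Q_def\<close>)
      have Rlim: "(\<lambda>n. R (\<epsilon> n) w) \<longlonglongrightarrow> r ?y"
        unfolding R_def using tendsto_add[OF tendsto_const tendsto_scaleR[OF lim_es tendsto_const], of "r ?y" \<nu>] by simp
      have "isCont ?kg (r ?y)"
        using contkg open_W rW[OF yU] continuous_on_eq_continuous_at by blast
      then have klim: "(\<lambda>n. ?kg (R (\<epsilon> n) w)) \<longlonglongrightarrow> ?kg (r ?y)"
        using Rlim by (rule isCont_tendsto_compose)
      have "((\<lambda>s. r ?y + (s * ?s) *\<^sub>R \<nu>) has_derivative (\<lambda>h. (h * ?s) *\<^sub>R \<nu>)) (at 0)"
        by (auto intro!: derivative_eq_intros)
      moreover have "(\<phi> has_derivative (\<lambda>v. g (r ?y) \<bullet> v)) (at (r ?y + (0 * ?s) *\<^sub>R \<nu>))"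
        using deriv[OF rW[OF yU]] by simp
      ultimately have "((\<lambda>s. \<phi> (r ?y + (s * ?s) *\<^sub>R \<nu>)) has_derivative (\<lambda>h. g (r ?y) \<bullet> ((h * ?s) *\<^sub>R \<nu>))) (at 0)"
        by (rule has_derivative_compose)
      moreover have "(\<lambda>h. g (r ?y) \<bullet> ((h * ?s) *\<^sub>R \<nu>)) = (*) (?s * (g (r ?y) \<bullet> \<nu>))"
        by (auto simp: fun_eq_iff)
      ultimately have "((\<lambda>s. \<phi> (r ?y + (s * ?s) *\<^sub>R \<nu>)) has_real_derivative (?s * (g (r ?y) \<bullet> \<nu>))) (at 0)"
        by (simp add: has_field_derivative_def)
      then have "((\<lambda>s. \<phi> (r ?y + (s * ?s) *\<^sub>R \<nu>) / s) \<longlongrightarrow> ?s * (g (r ?y) \<bullet> \<nu>)) (at 0)"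
        using phir[OF yU] by (simp add: has_field_derivative_iff)
      then have "(\<lambda>n. \<phi> (r ?y + (\<epsilon> n * ?s) *\<^sub>R \<nu>) / \<epsilon> n) \<longlonglongrightarrow> ?s * (g (r ?y) \<bullet> \<nu>)"
        unfolding tendsto_at_iff_sequentially using eps by (auto simp: o_def less_imp_neq[symmetric])
      then have "(\<lambda>n. bump (\<phi> (R (\<epsilon> n) w) / \<epsilon> n)) \<longlonglongrightarrow> bump (?s * (g (r ?y) \<bullet> \<nu>))"
        unfolding R_def by (rule isCont_tendsto_compose[OF isCont_bump])
      from tendsto_mult[OF tendsto_const tendsto_mult[OF this klim]]
      have "(\<lambda>n. \<bar>N ?y \<bullet> \<nu>\<bar> * (bump (\<phi> (R (\<epsilon> n) w) / \<epsilon> n) * ?kg (R (\<epsilon> n) w))) \<longlonglongrightarrow> G0 w"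
        using True by (simp add: G0_def)
      then show ?thesis using ev by (rule Lim_transform_eventually)
    qed (simp add: G_def G0_def Q_def)
    have measG0: "G0 \<in> borel_measurable borel"
      by (rule borel_measurable_LIMSEQ_real[OF G_lim]) (simp add: measG)
    have DCT: "integrable lborel G0" "(\<lambda>n. \<integral>w. G n w \<partial>lborel) \<longlonglongrightarrow> (\<integral>w. G0 w \<partial>lborel)"
      using integrable_dominated_convergence[of G0 lborel G "\<lambda>w. indicator T w *\<^sub>R bound"]
        integral_dominated_convergence[of G0 lborel G "\<lambda>w. indicator T w *\<^sub>R bound"]
        measG measG0 G_lim G_bound borel_integrable_compact[OF T, of "\<lambda>_. bound"] by auto
    have "(\<integral>w. G0 w \<partial>lborel) = (\<integral>y. \<integral>s. G0 (join3 (y, s)) \<partial>lborel \<partial>lborel)"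
      by (rule lborel_integral_join3[OF DCT(1)])
    also have "\<dots> = (\<integral>y. indicator U y * (k (r y) * area_element r y) \<partial>lborel)"
    proof (rule Bochner_Integration.integral_cong[OF refl])
      fix y :: "real^2"
      show "(\<integral>s. G0 (join3 (y, s)) \<partial>lborel) = indicator U y * (k (r y) * area_element r y)"
      proof (cases "y \<in> ball y0 a")
        case True
        then have yU: "y \<in> U" using cball_U by auto
        have c: "g (r y) \<bullet> \<nu> > 0"
          using F_P[of y 0] True m a(1) by (auto simp: P_def F_def)
        have "(\<integral>s. G0 (join3 (y, s)) \<partial>lborel) = (\<integral>s. (\<bar>N y \<bullet> \<nu>\<bar> * ?kg (r y)) * bump (s * (g (r y) \<bullet> \<nu>)) \<partial>lborel)"
          by (rule Bochner_Integration.integral_cong) (use True in \<open>auto simp: G0_def\<close>)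
        also have "\<dots> = (\<bar>N y \<bullet> \<nu>\<bar> * ?kg (r y)) * (1 / (g (r y) \<bullet> \<nu>))"
          by (simp add: integral_bump_scaled[OF c])
        also have "\<dots> = k (r y) * (\<bar>N y \<bullet> \<nu>\<bar> * norm (g (r y))) / (g (r y) \<bullet> \<nu>)" by simp
        also have "\<dots> = k (r y) * norm (N y)"
          using c by (simp add: area_identity[OF yU])
        finally show ?thesis using yU by (simp add: area)
      next
        case False
        then show ?thesis using kr0[of y] by (simp add: G0_def indicator_def)
      qed
    qed
    finally show "(\<lambda>n. \<integral>x. indicator W x * layer_density k (\<epsilon> n) x \<partial>lborel) \<longlonglongrightarrow>
        (\<integral>y. indicator U y * (k (r y) * area_element r y) \<partial>lborel)"
      using DCT(2) by (simp add: layer)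
  qed
qed

end

section \<open>Surface measure of a regular level set\<close>

text \<open>Making the cover disjoint cuts \<open>B\<close> into countably many Borel pieces, each
  inside a member of the cover; then countable additivity applies on both sides.\<close>

lemma emeasure_eq_by_countable_cover:
  assumes M: "sets M = sets borel" and N: "sets N = sets borel"
    and "countable \<C>" and borel: "\<And>X. X \<in> \<C> \<Longrightarrow> X \<in> sets borel"
    and eq: "\<And>X A. X \<in> \<C> \<Longrightarrow> A \<in> sets borel \<Longrightarrow> A \<subseteq> X \<Longrightarrow> emeasure M A = emeasure N A"
    and B: "B \<in> sets borel" "B \<subseteq> \<Union>\<C>"
  shows "emeasure M B = emeasure N B"
proof (cases "\<C> = {}")
  case True
  then show ?thesis using B by simp
next
  case False
  define X where "X = from_nat_into \<C>"
  have X: "X i \<in> \<C>" for i unfolding X_def using False by (rule from_nat_into)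
  have UnX: "(\<Union>i. X i) = \<Union>\<C>"
    unfolding X_def using range_from_nat_into[OF False \<open>countable \<C>\<close>] by simp
  define A where "A = (\<lambda>i. B \<inter> disjointed X i)"
  have Xb: "range X \<subseteq> sets borel" using X borel by blast
  have Ab: "A i \<in> sets borel" for i
    unfolding A_def using sets.range_disjointed_sets[OF Xb] B(1) by blast
  have disj: "disjoint_family A"
    unfolding A_def using disjoint_family_disjointed[of X] unfolding disjoint_family_on_def by blast
  have UnA: "(\<Union>i. A i) = B"
  proof -
    have "(\<Union>i. disjointed X i) = \<Union>\<C>" by (simp add: UN_disjointed_eq UnX)
    moreover have "(\<Union>i. A i) = B \<inter> (\<Union>i. disjointed X i)"
      unfolding A_def by (rule Int_UN_distrib[symmetric])
    ultimately show ?thesis using B(2) by auto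
  qed
  have "emeasure M (A i) = emeasure N (A i)" for i
    by (rule eq[OF X Ab]) (use disjointed_subset[of X i] in \<open>auto simp: A_def\<close>)
  then have "(\<Sum>i. emeasure M (A i)) = (\<Sum>i. emeasure N (A i))" by simp
  moreover have "(\<Sum>i. emeasure M (A i)) = emeasure M B"
    using suminf_emeasure[of A M] Ab disj M UnA by auto
  moreover have "(\<Sum>i. emeasure N (A i)) = emeasure N B"
    using suminf_emeasure[of A N] Ab disj N UnA by auto
  ultimately show ?thesis by simp
qed

text \<open>Indicators of open sets are increasing limits of continuous functions, so the measures
  agree on open subsets of the ball. Passing to the half ball makes both measures finite, which the
  uniqueness theorem for a generator requires.\<close>

lemma emeasure_eq_on_ball_by_continuous:
  fixes M N :: "'a::euclidean_space measure"
  assumes M: "sets M = sets borel" and N: "sets N = sets borel" and "\<rho> > 0"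
    and test: "\<And>k. continuous_on UNIV k \<Longrightarrow> (\<And>x. x \<notin> ball p \<rho> \<Longrightarrow> k x = 0) \<Longrightarrow>
       integrable M k \<and> integrable N k \<and> integral\<^sup>L M k = (integral\<^sup>L N k :: real)"
    and B: "B \<in> sets borel" "B \<subseteq> ball p (\<rho> / 2)"
  shows "emeasure M B = emeasure N B"
proof -
  have nn_eq: "(\<integral>\<^sup>+x. ennreal (k x) \<partial>M) = (\<integral>\<^sup>+x. ennreal (k x) \<partial>N)" "(\<integral>\<^sup>+x. ennreal (k x) \<partial>N) < \<infinity>"
    if "continuous_on UNIV k" "\<And>x. x \<notin> ball p \<rho> \<Longrightarrow> k x = 0" "\<And>x. 0 \<le> k x" for k
    using test[OF that(1,2)] that(3) by (simp_all add: nn_integral_eq_integral)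
  have open_eq: "emeasure M O' = emeasure N O'" if O': "open O'" "O' \<subseteq> ball p \<rho>" for O'
  proof -
    define k where "k = (\<lambda>j x. min 1 (real j * infdist x (- O')))"
    \<comment> \<open>\<open>infdist\<close> to the empty set is 0, so the complement of
      \<open>O'\<close> has to be nonempty for \<open>k\<close> to tend to the indicator.\<close>
    have "O' \<noteq> UNIV"
    proof
      assume "O' = UNIV"
      then have "bounded (UNIV :: 'a set)" using O'(2) bounded_subset[OF bounded_ball] by blast
      then show False using not_bounded_UNIV by blast
    qed
    then have ne: "- O' \<noteq> {}" by auto
    have lim: "(\<lambda>j. ennreal (k j x)) \<longlonglongrightarrow> indicator O' x" for x
    proof (cases "x \<in> O'")
      case True
      have pos: "infdist x (- O') > 0"
        using infdist_pos_not_in_closed[of "- O'" x] O'(1) ne True by auto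
      then obtain n where n: "1 < real n * infdist x (- O')" using ex_less_of_nat_mult by blast
      have "k j x = 1" if "j \<ge> n" for j
      proof -
        have "real n * infdist x (- O') \<le> real j * infdist x (- O')"
          using that pos by (intro mult_right_mono) auto
        then show ?thesis using n by (simp add: k_def)
      qed
      then have "\<forall>\<^sub>F j in sequentially. ennreal (k j x) = 1"
        unfolding eventually_sequentially by force
      then show ?thesis using True by (simp add: tendsto_eventually)
    qed (simp add: k_def)
    have inc: "incseq (\<lambda>j x. ennreal (k j x))"
      unfolding k_def by (intro incseq_SucI le_funI ennreal_leI min.mono mult_right_mono) (auto simp: infdist_nonneg)
    have ck: "continuous_on UNIV (k j)" for j
      unfolding k_def by (intro continuous_intros)
    have [measurable]: "k j \<in> borel_measurable borel" for j
      by (rule borel_measurable_continuous_onI[OF ck])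
    have LIM: "(\<lambda>j. \<integral>\<^sup>+x. ennreal (k j x) \<partial>M') \<longlonglongrightarrow> emeasure M' O'" if "sets M' = sets borel" for M'
    proof -
      have "(\<lambda>j. \<integral>\<^sup>+x. ennreal (k j x) \<partial>M') \<longlonglongrightarrow> (\<integral>\<^sup>+x. indicator O' x \<partial>M')"
        by (rule nn_integral_LIMSEQ[OF inc]) (use lim that in \<open>auto simp: measurable_cong_sets[OF that refl]\<close>)
      then show ?thesis using O'(1) that by simp
    qed
    have "(\<integral>\<^sup>+x. ennreal (k j x) \<partial>M) = (\<integral>\<^sup>+x. ennreal (k j x) \<partial>N)" for j
    proof (rule nn_eq(1)[OF ck])
      show "k j x = 0" if "x \<notin> ball p \<rho>" for x
      proof -
        have "x \<in> - O'" using that O'(2) by blast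
        then show ?thesis by (simp add: k_def)
      qed
    qed (simp add: k_def infdist_nonneg)
    then show ?thesis using LIM[OF M] LIM[OF N] LIMSEQ_unique by simp
  qed
  let ?b = "ball p (\<rho> / 2)"
  have bb: "?b \<subseteq> ball p \<rho>" using \<open>\<rho> > 0\<close> by (intro subset_ball) simp
  have fin: "emeasure N ?b < \<infinity>"
  proof -
    \<comment> \<open>A continuous function that is at least 1 on the half ball and 0 off the
      ball.\<close>
    let ?k = "\<lambda>x. max 0 (2 - 2 * dist p x / \<rho>)"
    have "emeasure N ?b = (\<integral>\<^sup>+x. indicator ?b x \<partial>N)" using N by simp
    also have "\<dots> \<le> (\<integral>\<^sup>+x. ennreal (?k x) \<partial>N)"
      using \<open>\<rho> > 0\<close> by (intro nn_integral_mono) (auto simp: indicator_def field_simps simp flip: ennreal_1 intro!: ennreal_leI)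
    also have "\<dots> < \<infinity>"
      by (rule nn_eq(2)) (use \<open>\<rho> > 0\<close> in \<open>auto intro!: continuous_intros simp: field_simps\<close>)
    finally show ?thesis .
  qed
  have dens: "emeasure (density M' (indicator ?b)) A = emeasure M' (?b \<inter> A)" if "sets M' = sets borel" "A \<in> sets borel" for M' A
    using that by (intro emeasure_restricted) auto
  have "density M (indicator ?b) = density N (indicator ?b)"
  proof (rule measure_eqI_generator_eq[where E = "{S. open S}" and \<Omega> = UNIV and A = "\<lambda>_. UNIV"])
    show "Int_stable {S :: 'a set. open S}" by (auto simp: Int_stable_def)
    show "sets (density M (indicator ?b)) = sigma_sets UNIV {S. open S}"
      using M by (simp add: borel_def)
    show "sets (density N (indicator ?b)) = sigma_sets UNIV {S. open S}"
      using N by (simp add: borel_def)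
    show "emeasure (density M (indicator ?b)) X = emeasure (density N (indicator ?b)) X" if "X \<in> {S. open S}" for X
      using that bb by (auto simp: dens M N intro!: open_eq)
    show "emeasure (density M (indicator ?b)) UNIV \<noteq> \<infinity>" for i :: nat
      using fin open_eq[OF _ bb] by (simp add: dens M)
  qed auto
  then have "emeasure M (?b \<inter> B) = emeasure N (?b \<inter> B)"
    using dens[OF M B(1)] dens[OF N B(1)] by metis
  moreover have "?b \<inter> B = B" using B(2) by blast
  ultimately show ?thesis by simp
qed

section \<open>Measures carried by a single chart\<close>

text \<open>Points outside \<open>U\<close> are sent to 0, which makes the map Borel on the whole
  plane; the density gives them no mass.\<close>

definition chart_measure :: "(real^2) set \<Rightarrow> (real^2 \<Rightarrow> real^3) \<Rightarrow> (real^3) measure" where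
  "chart_measure U r = distr (density lborel (\<lambda>y. ennreal (indicator U y * area_element r y))) borel (\<lambda>y. indicator U y *\<^sub>R r y)"

lemma sets_chart_measure [simp]: "sets (chart_measure U r) = sets borel"
  by (simp add: chart_measure_def)

lemma local_parametrization_measurable:
  assumes "local_parametrization S U r"
  shows "(\<lambda>y. indicator U y *\<^sub>R r y) \<in> borel_measurable borel"
    "(\<lambda>y. indicator U y * area_element r y) \<in> borel_measurable borel"
proof -
  have U: "open U" and sm: "smooth_on U r" using assms by (auto simp: local_parametrization_def)
  note C1 = smooth_on_imp_C1_on[OF sm]
  show "(\<lambda>y. indicator U y *\<^sub>R r y) \<in> borel_measurable borel"
    by (rule borel_measurable_continuous_on_indicator[OF _ C1_on_imp_continuous_on[OF C1]]) (use U in simp)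
  have "continuous_on U (area_element r)"
    unfolding area_element_def by (intro continuous_intros continuous_on_cross C1_onD(2)[OF C1])
  from borel_measurable_continuous_on_indicator[OF _ this] U
  show "(\<lambda>y. indicator U y * area_element r y) \<in> borel_measurable borel" by simp
qed

lemma area_element_nonneg: "0 \<le> area_element r y"
  by (simp add: area_element_def)

lemma emeasure_chart_measure:
  assumes "local_parametrization S U r" "B \<in> sets borel"
  shows "emeasure (chart_measure U r) B = (\<integral>\<^sup>+y\<in>{y\<in>U. r y \<in> B}. ennreal (area_element r y) \<partial>lborel)"
proof -
  note [measurable] = local_parametrization_measurable[OF assms(1)]
  have B': "(\<lambda>y. indicator U y *\<^sub>R r y) -` B \<in> sets borel"
    using measurable_sets[OF local_parametrization_measurable(1)[OF assms(1)] assms(2)] by simp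
  have "emeasure (chart_measure U r) B =
      (\<integral>\<^sup>+y. ennreal (indicator U y * area_element r y) * indicator ((\<lambda>y. indicator U y *\<^sub>R r y) -` B) y \<partial>lborel)"
    unfolding chart_measure_def
    by (subst emeasure_distr, simp, rule assms(2)) (simp add: emeasure_density B')
  also have "\<dots> = (\<integral>\<^sup>+y\<in>{y\<in>U. r y \<in> B}. ennreal (area_element r y) \<partial>lborel)"
    by (rule nn_integral_cong) (auto simp: indicator_def)
  finally show ?thesis .
qed

lemma chart_measure_integral:
  fixes k :: "real^3 \<Rightarrow> real"
  assumes "local_parametrization S U r" and [measurable]: "k \<in> borel_measurable borel"
  shows "integral\<^sup>L (chart_measure U r) k = (\<integral>y. indicator U y * (k (r y) * area_element r y) \<partial>lborel)"
    and "integrable (chart_measure U r) k \<longleftrightarrow> integrable lborel (\<lambda>y. indicator U y * (k (r y) * area_element r y))"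
proof -
  note [measurable] = local_parametrization_measurable[OF assms(1)]
  have eq: "(indicator U y * area_element r y) * k (indicator U y *\<^sub>R r y) = indicator U y * (k (r y) * area_element r y)" for y
    by (auto simp: indicator_def)
  show "integral\<^sup>L (chart_measure U r) k = (\<integral>y. indicator U y * (k (r y) * area_element r y) \<partial>lborel)"
    unfolding chart_measure_def
    by (simp add: integral_distr integral_density area_element_nonneg eq)
  show "integrable (chart_measure U r) k \<longleftrightarrow> integrable lborel (\<lambda>y. indicator U y * (k (r y) * area_element r y))"
    unfolding chart_measure_def
    by (simp add: integrable_distr_eq integrable_density area_element_nonneg eq)
qed

text \<open>Chart images are open in \<open>S\<close> only, so the Lindelof property is applied to
  the open sets of the ambient space that cut them out.\<close>

lemma countable_chart_cover:
  assumes "smooth_surface S"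
  obtains \<C> where "countable \<C>" "\<And>X. X \<in> \<C> \<Longrightarrow> \<exists>U r. local_parametrization S U r \<and> X = r ` U" "\<Union>\<C> = S"
proof -
  define \<F> where "\<F> = {G. open G \<and> (\<exists>U r. local_parametrization S U r \<and> S \<inter> G = r ` U)}"
  obtain \<F>' where F': "\<F>' \<subseteq> \<F>" "countable \<F>'" "\<Union>\<F>' = \<Union>\<F>"
    by (rule Lindelof[of \<F>]) (auto simp: \<F>_def)
  have cover: "S \<subseteq> \<Union>\<F>"
  proof
    fix p assume "p \<in> S"
    then obtain U r where Ur: "local_parametrization S U r" "p \<in> r ` U"
      using assms unfolding smooth_surface_def by blast
    then obtain G where "open G" "r ` U = S \<inter> G"
      unfolding local_parametrization_def openin_open by blast
    then show "p \<in> \<Union>\<F>" using Ur unfolding \<F>_def by blast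
  qed
  show ?thesis
  proof (rule that[of "(\<inter>) S ` \<F>'"])
    show "\<exists>U r. local_parametrization S U r \<and> X = r ` U" if X: "X \<in> (\<inter>) S ` \<F>'" for X
    proof -
      from X obtain G where "G \<in> \<F>" "X = S \<inter> G" using F'(1) by blast
      then show ?thesis unfolding \<F>_def by auto
    qed
    have "\<Union> ((\<inter>) S ` \<F>') = S \<inter> \<Union>\<F>'" by blast
    then show "\<Union> ((\<inter>) S ` \<F>') = S" using F'(3) cover by auto
  qed (use F'(2) in auto)
qed

lemma chart_image_borel:
  assumes "closed S" "local_parametrization S U r"
  shows "r ` U \<in> sets borel" "r ` U \<subseteq> S"
proof -
  from assms(2) obtain G where "open G" "r ` U = S \<inter> G"
    unfolding local_parametrization_def openin_open by blast
  then show "r ` U \<in> sets borel" "r ` U \<subseteq> S" using assms(1) by auto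
qed

context regular_level
begin

text \<open>A \<open>k\<close> that vanishes off a ball inside \<open>W\<close> is Borel although it
  is continuous on \<open>W\<close> only, so the limit in the chart can be read as an integral
  against the chart measure.\<close>

lemma chart_measure_layer_limit:
  assumes chart: "local_parametrization {x. \<phi> x = 0} U r" and y0: "y0 \<in> U"
  shows "\<exists>\<rho>>0. cball (r y0) \<rho> \<subseteq> W \<and> (\<forall>k. continuous_on W k \<longrightarrow> (\<forall>x. x \<notin> ball (r y0) \<rho> \<longrightarrow> k x = 0) \<longrightarrow>
      k \<in> borel_measurable borel \<and> integrable (chart_measure U r) k \<and>
      (\<forall>\<epsilon>. (\<forall>n. \<epsilon> n > 0) \<longrightarrow> \<epsilon> \<longlonglongrightarrow> 0 \<longrightarrow>
        (\<lambda>n. \<integral>x. indicator W x * layer_density k (\<epsilon> n) x \<partial>lborel) \<longlonglongrightarrow> integral\<^sup>L (chart_measure U r) k))"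
proof (rule chart_layer_limit[OF assms])
  fix \<rho>
  assume \<rho>: "\<rho> > 0" "cball (r y0) \<rho> \<subseteq> W"
    and int: "\<And>k. continuous_on W k \<Longrightarrow> (\<And>x. x \<notin> ball (r y0) \<rho> \<Longrightarrow> k x = 0) \<Longrightarrow>
        integrable lborel (\<lambda>y. indicator U y * (k (r y) * area_element r y))"
    and lim: "\<And>k \<epsilon>. continuous_on W k \<Longrightarrow> (\<And>x. x \<notin> ball (r y0) \<rho> \<Longrightarrow> k x = 0) \<Longrightarrow>
        (\<And>n. \<epsilon> n > 0) \<Longrightarrow> \<epsilon> \<longlonglongrightarrow> 0 \<Longrightarrow>
        (\<lambda>n. \<integral>x. indicator W x * layer_density k (\<epsilon> n) x \<partial>lborel) \<longlonglongrightarrow>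
          (\<integral>y. indicator U y * (k (r y) * area_element r y) \<partial>lborel)"
  show ?thesis
  proof (intro exI[of _ \<rho>] conjI allI impI \<rho>)
    fix k :: "real^3 \<Rightarrow> real" assume k: "continuous_on W k" "\<forall>x. x \<notin> ball (r y0) \<rho> \<longrightarrow> k x = 0"
    have "(\<lambda>x. indicator W x *\<^sub>R k x) \<in> borel_measurable borel"
      by (rule borel_measurable_continuous_on_indicator[OF _ k(1)]) (simp add: open_W)
    moreover have "(\<lambda>x. indicator W x *\<^sub>R k x) = k"
    proof
      fix x
      have "x \<in> W" if "k x \<noteq> 0"
        using k(2) \<rho>(2) ball_subset_cball[of "r y0" \<rho>] that by blast
      then show "indicator W x *\<^sub>R k x = k x" by (cases "k x = 0") auto
    qed
    ultimately show meas: "k \<in> borel_measurable borel" by simp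
    show "integrable (chart_measure U r) k"
      using int[of k] k by (simp add: chart_measure_integral[OF chart meas])
    fix \<epsilon> :: "nat \<Rightarrow> real" assume "\<forall>n. \<epsilon> n > 0" "\<epsilon> \<longlonglongrightarrow> 0"
    then show "(\<lambda>n. \<integral>x. indicator W x * layer_density k (\<epsilon> n) x \<partial>lborel) \<longlonglongrightarrow> integral\<^sup>L (chart_measure U r) k"
      using lim[of k \<epsilon>] k by (simp add: chart_measure_integral[OF chart meas])
  qed
qed

text \<open>The layer integrals do not mention a chart, so near a common point both chart measures
  integrate continuous functions to the same limit and hence agree on a small ball. Lindelof covers
  the overlap by countably many such balls.\<close>

lemma chart_measures_agree:
  assumes c1: "local_parametrization {x. \<phi> x = 0} U1 r1" and c2: "local_parametrization {x. \<phi> x = 0} U2 r2"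
    and B: "B \<in> sets borel" "B \<subseteq> r1 ` U1" "B \<subseteq> r2 ` U2"
  shows "emeasure (chart_measure U1 r1) B = emeasure (chart_measure U2 r2) B"
proof -
  let ?M = "chart_measure U1 r1" and ?N = "chart_measure U2 r2"
  define \<F> where "\<F> = {X. open X \<and> (\<forall>A\<in>sets borel. A \<subseteq> X \<longrightarrow> emeasure ?M A = emeasure ?N A)}"
  have "p \<in> \<Union>\<F>" if p: "p \<in> r1 ` U1 \<inter> r2 ` U2" for p
  proof -
    from p obtain y1 y2 where y: "y1 \<in> U1" "y2 \<in> U2" "p = r1 y1" "p = r2 y2" by blast
    obtain \<rho>1 where r1: "\<rho>1 > 0" "\<forall>k. continuous_on W k \<longrightarrow> (\<forall>x. x \<notin> ball p \<rho>1 \<longrightarrow> k x = 0) \<longrightarrow>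
      k \<in> borel_measurable borel \<and> integrable ?M k \<and>
      (\<forall>\<epsilon>. (\<forall>n. \<epsilon> n > 0) \<longrightarrow> \<epsilon> \<longlonglongrightarrow> 0 \<longrightarrow>
        (\<lambda>n. \<integral>x. indicator W x * layer_density k (\<epsilon> n) x \<partial>lborel) \<longlonglongrightarrow> integral\<^sup>L ?M k)"
      using chart_measure_layer_limit[OF c1 y(1)] unfolding y(3)[symmetric] by (elim exE conjE)
    obtain \<rho>2 where r2: "\<rho>2 > 0" "\<forall>k. continuous_on W k \<longrightarrow> (\<forall>x. x \<notin> ball p \<rho>2 \<longrightarrow> k x = 0) \<longrightarrow>
      k \<in> borel_measurable borel \<and> integrable ?N k \<and>
      (\<forall>\<epsilon>. (\<forall>n. \<epsilon> n > 0) \<longrightarrow> \<epsilon> \<longlonglongrightarrow> 0 \<longrightarrow>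
        (\<lambda>n. \<integral>x. indicator W x * layer_density k (\<epsilon> n) x \<partial>lborel) \<longlonglongrightarrow> integral\<^sup>L ?N k)"
      using chart_measure_layer_limit[OF c2 y(2)] unfolding y(4)[symmetric] by (elim exE conjE)
    let ?\<rho> = "min \<rho>1 \<rho>2"
    have test: "integrable ?M k \<and> integrable ?N k \<and> integral\<^sup>L ?M k = integral\<^sup>L ?N k"
      if k: "continuous_on UNIV k" "\<And>x. x \<notin> ball p ?\<rho> \<Longrightarrow> k x = 0" for k :: "real^3 \<Rightarrow> real"
    proof -
      have ck: "continuous_on W k" using k(1) continuous_on_subset by blast
      have k12: "\<forall>x. x \<notin> ball p \<rho>1 \<longrightarrow> k x = 0" "\<forall>x. x \<notin> ball p \<rho>2 \<longrightarrow> k x = 0"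
        using k(2) by auto
      have eps: "\<forall>n. inverse (real (Suc n)) > 0" "(\<lambda>n. inverse (real (Suc n))) \<longlonglongrightarrow> 0"
        using LIMSEQ_inverse_real_of_nat by auto
      note l1 = r1(2)[THEN spec, THEN mp, OF ck, THEN mp, OF k12(1)]
        and l2 = r2(2)[THEN spec, THEN mp, OF ck, THEN mp, OF k12(2)]
      have "(\<lambda>n. \<integral>x. indicator W x * layer_density k (inverse (real (Suc n))) x \<partial>lborel) \<longlonglongrightarrow> integral\<^sup>L ?M k"
        using l1[THEN conjunct2, THEN conjunct2, THEN spec, THEN mp, OF eps(1), THEN mp, OF eps(2)] .
      moreover have "(\<lambda>n. \<integral>x. indicator W x * layer_density k (inverse (real (Suc n))) x \<partial>lborel) \<longlonglongrightarrow> integral\<^sup>L ?N k"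
        using l2[THEN conjunct2, THEN conjunct2, THEN spec, THEN mp, OF eps(1), THEN mp, OF eps(2)] .
      ultimately have "integral\<^sup>L ?M k = integral\<^sup>L ?N k" by (rule LIMSEQ_unique)
      then show ?thesis using l1 l2 by blast
    qed
    have "ball p (?\<rho> / 2) \<in> \<F>"
      unfolding \<F>_def using emeasure_eq_on_ball_by_continuous[of ?M ?N ?\<rho> p] test r1(1) r2(1)
      by simp
    then show ?thesis using r1(1) r2(1) by (intro UnionI[of "ball p (?\<rho> / 2)"]) auto
  qed
  then have BF: "B \<subseteq> \<Union>\<F>" using B by blast
  obtain \<F>' where F': "\<F>' \<subseteq> \<F>" "countable \<F>'" "\<Union>\<F>' = \<Union>\<F>"
    by (rule Lindelof[of \<F>]) (auto simp: \<F>_def)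
  show ?thesis
    by (rule emeasure_eq_by_countable_cover[OF _ _ F'(2)]) (use F' BF B(1) in \<open>auto simp: \<F>_def\<close>)
qed

end

section \<open>Existence and uniqueness of the surface measure\<close>

lemma suminf_commute_ennreal:
  fixes f :: "nat \<Rightarrow> nat \<Rightarrow> ennreal"
  shows "(\<Sum>i. \<Sum>j. f i j) = (\<Sum>j. \<Sum>i. f i j)"
proof -
  have "(\<Sum>j. \<Sum>i. f i j) = (\<integral>\<^sup>+j. (\<Sum>i. f i j) \<partial>count_space UNIV)"
    by (rule nn_integral_count_space_nat[symmetric])
  also have "\<dots> = (\<Sum>i. \<integral>\<^sup>+j. f i j \<partial>count_space UNIV)"
    by (rule nn_integral_suminf) simp
  also have "\<dots> = (\<Sum>i. \<Sum>j. f i j)"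
    by (simp add: nn_integral_count_space_nat)
  finally show ?thesis by simp
qed

lemma glued_measure_exists:
  fixes M :: "nat \<Rightarrow> 'a::topological_space measure"
  assumes M: "\<And>i. sets (M i) = sets borel" and D: "\<And>i. D i \<in> sets borel"
  obtains \<mu> where "sets \<mu> = sets borel" "\<And>B. B \<in> sets borel \<Longrightarrow> emeasure \<mu> B = (\<Sum>i. emeasure (M i) (B \<inter> D i))"
proof -
  let ?f = "\<lambda>B. \<Sum>i. emeasure (M i) (B \<inter> D i)"
  let ?\<mu> = "measure_of UNIV (sets (borel :: 'a measure)) ?f"
  have sa: "sigma_algebra UNIV (sets (borel :: 'a measure))"
    using sets.sigma_algebra_axioms[of "borel :: 'a measure"] by simp
  have "countably_additive (sets borel) ?f"
    unfolding countably_additive_def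
  proof (intro allI impI)
    fix A :: "nat \<Rightarrow> 'a set"
    assume A: "range A \<subseteq> sets borel" "disjoint_family A" "\<Union> (range A) \<in> sets borel"
    have "(\<Sum>j. emeasure (M i) (A j \<inter> D i)) = emeasure (M i) (\<Union> (range A) \<inter> D i)" for i
    proof -
      have "disjoint_family (\<lambda>j. A j \<inter> D i)"
        using A(2) unfolding disjoint_family_on_def by blast
      moreover have "range (\<lambda>j. A j \<inter> D i) \<subseteq> sets (M i)" using A(1) D M by auto
      ultimately have "(\<Sum>j. emeasure (M i) (A j \<inter> D i)) = emeasure (M i) (\<Union>j. A j \<inter> D i)"
        by (rule suminf_emeasure[rotated])
      then show ?thesis by simp
    qed
    then show "(\<Sum>j. ?f (A j)) = ?f (\<Union> (range A))"
      by (subst suminf_commute_ennreal) simp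
  qed
  then have "emeasure ?\<mu> B = ?f B" if "B \<in> sets borel" for B
    by (intro emeasure_measure_of_sigma[OF sa]) (use that in \<open>auto simp: positive_def\<close>)
  moreover have "sets ?\<mu> = sets borel"
    by (rule sigma_algebra.sets_measure_of_eq[OF sa])
  ultimately show ?thesis using that by blast
qed

text \<open>Countably many chart images cover \<open>S\<close>, on each of them the defining formula
  fixes the measure, and the complement of \<open>S\<close> is null.\<close>

lemma is_surface_measure_unique:
  assumes "closed S" "smooth_surface S" and \<mu>: "is_surface_measure S \<mu>" and \<nu>: "is_surface_measure S \<nu>"
  shows "\<mu> = \<nu>"
proof (rule measure_eqI)
  have sets: "sets \<mu> = sets borel" "sets \<nu> = sets borel"
    and null: "emeasure \<mu> (- S) = 0" "emeasure \<nu> (- S) = 0"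
    using \<mu> \<nu> by (auto simp: is_surface_measure_def)
  then show "sets \<mu> = sets \<nu>" by simp
  fix B assume "B \<in> sets \<mu>"
  then have B: "B \<in> sets borel" by (simp add: sets)
  have S: "S \<in> sets borel" using \<open>closed S\<close> by simp
  obtain \<C> where C: "countable \<C>" "\<And>X. X \<in> \<C> \<Longrightarrow> \<exists>U r. local_parametrization S U r \<and> X = r ` U" "\<Union>\<C> = S"
    using countable_chart_cover[OF \<open>smooth_surface S\<close>] by blast
  have "emeasure \<mu> (B \<inter> S) = emeasure \<nu> (B \<inter> S)"
  proof (rule emeasure_eq_by_countable_cover[OF sets C(1)])
    show "X \<in> sets borel" if "X \<in> \<C>" for X using C(2)[OF that] chart_image_borel[OF \<open>closed S\<close>] by blast
    show "emeasure \<mu> A = emeasure \<nu> A" if "X \<in> \<C>" "A \<in> sets borel" "A \<subseteq> X" for X A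
    proof -
      from C(2)[OF that(1)] obtain U r where Ur: "local_parametrization S U r" "X = r ` U" by blast
      have "emeasure \<mu>' A = (\<integral>\<^sup>+y\<in>{y\<in>U. r y \<in> A}. ennreal (area_element r y) \<partial>lborel)"
        if "is_surface_measure S \<mu>'" for \<mu>'
        using that Ur \<open>A \<in> sets borel\<close> \<open>A \<subseteq> X\<close> unfolding is_surface_measure_def by simp
      from this[OF \<mu>] this[OF \<nu>] show ?thesis by simp
    qed
  qed (use B S C(3) in auto)
  moreover have "emeasure \<mu>' B = emeasure \<mu>' (B \<inter> S)" if "sets \<mu>' = sets borel" "emeasure \<mu>' (- S) = 0" for \<mu>'
  proof (rule emeasure_eq_AE)
    have "AE x in \<mu>'. x \<in> S"
      by (rule AE_I[OF _ that(2)]) (use S that(1) in auto)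
    then show "AE x in \<mu>'. (x \<in> B) = (x \<in> B \<inter> S)" by (rule AE_mp) simp
  qed (use B S that in auto)
  ultimately show "emeasure \<mu> B = emeasure \<nu> B" using sets null by metis
qed

context regular_level
begin

text \<open>Chart measures are glued along a countable chart cover that has been made disjoint. On
  each piece one chart is chosen, and \<open>chart_measures_agree\<close> says that the choice is
  correct for every other chart as well.\<close>

lemma surface_measure_exists:
  assumes closed: "closed {x. \<phi> x = 0}" and surface: "smooth_surface {x. \<phi> x = 0}"
  shows "\<exists>\<mu>. is_surface_measure {x. \<phi> x = 0} \<mu>"
proof -
  let ?Z = "{x. \<phi> x = 0}"
  \<comment> \<open>The property that survives gluing: inside \<open>X\<close> the measure is right
    for all charts at once.\<close>
  define good where "good = (\<lambda>X M. sets M = sets borel \<and> (\<forall>U r B. local_parametrization ?Z U r \<longrightarrow> B \<in> sets borel \<longrightarrow>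
      B \<subseteq> r ` U \<longrightarrow> B \<subseteq> X \<longrightarrow> emeasure M B = emeasure (chart_measure U r) B))"
  obtain \<C> where C: "countable \<C>" "\<And>X. X \<in> \<C> \<Longrightarrow> \<exists>U r. local_parametrization ?Z U r \<and> X = r ` U" "\<Union>\<C> = ?Z"
    using countable_chart_cover[OF surface] by blast
  \<comment> \<open>The empty set makes the family nonempty, so that \<open>from_nat_into\<close>
    enumerates exactly its members.\<close>
  define X where "X = from_nat_into (insert {} \<C>)"
  have rangeX: "range X = insert {} \<C>"
    unfolding X_def by (rule range_from_nat_into) (use C(1) in auto)
  have ex: "\<exists>M. good (X i) M" and Xb: "X i \<in> sets borel" for i
  proof -
    consider "X i = {}" | U r where "local_parametrization ?Z U r" "X i = r ` U"
    proof -
      have "X i \<in> insert {} \<C>" using rangeX rangeI[of X i] by simp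
      then show thesis
      proof (elim insertE)
        assume "X i = {}" then show thesis by (rule that(1))
      next
        assume "X i \<in> \<C>"
        from C(2)[OF this] obtain U r where "local_parametrization ?Z U r" "X i = r ` U" by (elim exE conjE)
        then show thesis by (rule that(2))
      qed
    qed
    then have "X i \<in> sets borel \<and> (\<exists>M. good (X i) M)"
    proof cases
      case 1
      have "good {} borel" by (simp add: good_def)
      then show ?thesis unfolding 1 by blast
    next
      case 2
      have "good (r ` U) (chart_measure U r)"
        unfolding good_def
      proof (intro conjI allI impI)
        fix U' r' B
        assume "local_parametrization ?Z U' r'" "B \<in> sets borel" "B \<subseteq> r' ` U'" "B \<subseteq> r ` U"
        then show "emeasure (chart_measure U r) B = emeasure (chart_measure U' r') B"
          by (intro chart_measures_agree[OF 2(1)])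
      qed simp
      then show ?thesis unfolding 2(2) using chart_image_borel(1)[OF closed 2(1)] by blast
    qed
    then show "\<exists>M. good (X i) M" "X i \<in> sets borel" by auto
  qed
  from ex obtain M where M: "\<And>i. good (X i) (M i)" by metis
  define D where "D = disjointed X"
  have Db: "D i \<in> sets borel" for i
    unfolding D_def using sets.range_disjointed_sets[of X borel] Xb by blast
  have UnD: "(\<Union>i. D i) = ?Z"
    unfolding D_def UN_disjointed_eq using rangeX C(3) by auto
  have D_X: "D i \<subseteq> X i" for i unfolding D_def by (rule disjointed_subset)
  obtain \<mu> where \<mu>: "sets \<mu> = sets borel" "\<And>B. B \<in> sets borel \<Longrightarrow> emeasure \<mu> B = (\<Sum>i. emeasure (M i) (B \<inter> D i))"
    by (rule glued_measure_exists[of M D]) (use M Db in \<open>auto simp: good_def\<close>)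
  have "is_surface_measure ?Z \<mu>"
    unfolding is_surface_measure_def
  proof (intro conjI allI impI ballI)
    show "emeasure \<mu> (- ?Z) = 0"
    proof -
      have "- ?Z \<inter> D i = {}" for i using UnD by blast
      moreover have "- ?Z \<in> sets borel" by (intro borel_open open_Compl closed)
      ultimately show ?thesis by (simp only: \<mu>(2)) simp
    qed
    fix U r B assume chart: "local_parametrization ?Z U r" and B: "B \<in> sets borel" "B \<subseteq> r ` U"
    have "emeasure (M i) (B \<inter> D i) = emeasure (chart_measure U r) (B \<inter> D i)" for i
    proof -
      have "B \<inter> D i \<in> sets borel" "B \<inter> D i \<subseteq> r ` U" "B \<inter> D i \<subseteq> X i" using B Db D_X by auto
      then show ?thesis using M[of i] chart unfolding good_def by blast
    qed
    then have "emeasure \<mu> B = (\<Sum>i. emeasure (chart_measure U r) (B \<inter> D i))"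
      using \<mu>(2)[OF B(1)] by simp
    also have "\<dots> = emeasure (chart_measure U r) (\<Union>i. B \<inter> D i)"
    proof (rule suminf_emeasure)
      show "disjoint_family (\<lambda>i. B \<inter> D i)"
        using disjoint_family_disjointed[of X] unfolding D_def disjoint_family_on_def by blast
    qed (use B Db in auto)
    also have "(\<Union>i. B \<inter> D i) = B \<inter> (\<Union>i. D i)" by (rule Int_UN_distrib[symmetric])
    also have "\<dots> = B" unfolding UnD using B(2) chart_image_borel(2)[OF closed chart] by blast
    finally show "emeasure \<mu> B = (\<integral>\<^sup>+y\<in>{y\<in>U. r y \<in> B}. ennreal (area_element r y) \<partial>lborel)"
      using emeasure_chart_measure[OF chart B(1)] by simp
  qed (rule \<mu>(1))
  then show ?thesis by blast
qed

lemma is_surface_measure_surface_measure: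
  assumes "closed {x. \<phi> x = 0}" "smooth_surface {x. \<phi> x = 0}"
  shows "is_surface_measure {x. \<phi> x = 0} (surface_measure {x. \<phi> x = 0})"
proof -
  obtain \<mu> where \<mu>: "is_surface_measure {x. \<phi> x = 0} \<mu>" using surface_measure_exists[OF assms] by blast
  show ?thesis
    unfolding surface_measure_def
    by (rule theI[of "is_surface_measure {x. \<phi> x = 0}", OF \<mu>]) (rule is_surface_measure_unique[OF assms _ \<mu>])
qed

text \<open>A chart image is relatively open, hence contains all of the surface in a small ball
  around \<open>p\<close>; for functions supported there, surface measure and chart measure give the
  same integrals.\<close>

lemma surface_layer_limit_local:
  assumes closed: "closed {x. \<phi> x = 0}" and surface: "smooth_surface {x. \<phi> x = 0}"
    and p: "\<phi> p = 0"
  shows "\<exists>\<rho>>0. cball p \<rho> \<subseteq> W \<and> (\<forall>k. continuous_on W k \<longrightarrow> (\<forall>x. x \<notin> ball p \<rho> \<longrightarrow> k x = 0) \<longrightarrow>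
      integrable (surface_measure {x. \<phi> x = 0}) k \<and>
      (\<forall>\<epsilon>. (\<forall>n. \<epsilon> n > 0) \<longrightarrow> \<epsilon> \<longlonglongrightarrow> 0 \<longrightarrow>
        (\<lambda>n. \<integral>x. indicator W x * layer_density k (\<epsilon> n) x \<partial>lborel) \<longlonglongrightarrow>
          integral\<^sup>L (surface_measure {x. \<phi> x = 0}) k))"
proof -
  let ?Z = "{x. \<phi> x = 0}"
  define \<mu> where "\<mu> = surface_measure ?Z"
  have \<mu>: "is_surface_measure ?Z \<mu>"
    unfolding \<mu>_def by (rule is_surface_measure_surface_measure[OF closed surface])
  then have sets: "sets \<mu> = sets borel" and null: "emeasure \<mu> (- ?Z) = 0"
    by (auto simp: is_surface_measure_def)
  obtain U r where chart: "local_parametrization ?Z U r" and "p \<in> r ` U"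
    using surface p unfolding smooth_surface_def by blast
  then obtain y0 where y0: "y0 \<in> U" "p = r y0" by blast
  obtain G where G: "open G" "r ` U = ?Z \<inter> G"
    using chart unfolding local_parametrization_def openin_open by blast
  have rU: "r ` U \<in> sets borel" by (rule chart_image_borel(1)[OF closed chart])
  have restrict: "chart_measure U r = density \<mu> (indicator (r ` U))"
  proof (rule measure_eqI)
    fix B assume "B \<in> sets (chart_measure U r)"
    then have B: "B \<in> sets borel" by simp
    have "emeasure (density \<mu> (indicator (r ` U))) B = emeasure \<mu> (r ` U \<inter> B)"
      using B rU sets by (intro emeasure_restricted) auto
    also have "\<dots> = (\<integral>\<^sup>+y\<in>{y\<in>U. r y \<in> r ` U \<inter> B}. ennreal (area_element r y) \<partial>lborel)"
      using \<mu> chart B rU unfolding is_surface_measure_def by blast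
    also have "{y\<in>U. r y \<in> r ` U \<inter> B} = {y\<in>U. r y \<in> B}" by blast
    also have "(\<integral>\<^sup>+y\<in>\<dots>. ennreal (area_element r y) \<partial>lborel) = emeasure (chart_measure U r) B"
      by (rule emeasure_chart_measure[OF chart B, symmetric])
    finally show "emeasure (chart_measure U r) B = emeasure (density \<mu> (indicator (r ` U))) B" by simp
  qed (simp add: sets)
  have AE_Z: "AE x in \<mu>. x \<in> ?Z"
    by (rule AE_I[OF _ null]) (auto simp: sets intro!: borel_open open_Compl closed)
  obtain \<rho>1 where \<rho>1: "\<rho>1 > 0" "cball p \<rho>1 \<subseteq> W" "\<forall>k. continuous_on W k \<longrightarrow> (\<forall>x. x \<notin> ball p \<rho>1 \<longrightarrow> k x = 0) \<longrightarrow>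
      k \<in> borel_measurable borel \<and> integrable (chart_measure U r) k \<and>
      (\<forall>\<epsilon>. (\<forall>n. \<epsilon> n > 0) \<longrightarrow> \<epsilon> \<longlonglongrightarrow> 0 \<longrightarrow>
        (\<lambda>n. \<integral>x. indicator W x * layer_density k (\<epsilon> n) x \<partial>lborel) \<longlonglongrightarrow> integral\<^sup>L (chart_measure U r) k)"
    using chart_measure_layer_limit[OF chart y0(1)] unfolding y0(2)[symmetric] by (elim exE conjE)
  have "p \<in> G" using G(2) y0 by blast
  then obtain \<rho>2 where \<rho>2: "\<rho>2 > 0" "ball p \<rho>2 \<subseteq> G" using G(1) openE by blast
  let ?\<rho> = "min \<rho>1 \<rho>2"
  show ?thesis
    unfolding \<mu>_def[symmetric]
  proof (intro exI[of _ ?\<rho>] conjI)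
    show "?\<rho> > 0" using \<rho>1(1) \<rho>2(1) by simp
    show "cball p ?\<rho> \<subseteq> W" using \<rho>1(2) subset_cball[of ?\<rho> \<rho>1] by auto
    show "\<forall>k. continuous_on W k \<longrightarrow> (\<forall>x. x \<notin> ball p ?\<rho> \<longrightarrow> k x = 0) \<longrightarrow> integrable \<mu> k \<and>
      (\<forall>\<epsilon>. (\<forall>n. \<epsilon> n > 0) \<longrightarrow> \<epsilon> \<longlonglongrightarrow> 0 \<longrightarrow>
        (\<lambda>n. \<integral>x. indicator W x * layer_density k (\<epsilon> n) x \<partial>lborel) \<longlonglongrightarrow> integral\<^sup>L \<mu> k)"
    proof (rule allI, rule impI, rule impI)
      fix k :: "real^3 \<Rightarrow> real" assume k: "continuous_on W k" "\<forall>x. x \<notin> ball p ?\<rho> \<longrightarrow> k x = 0"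
      have k1: "\<forall>x. x \<notin> ball p \<rho>1 \<longrightarrow> k x = 0" using k(2) by auto
      note l = \<rho>1(3)[THEN spec, THEN mp, OF k(1), THEN mp, OF k1]
      have meas: "k \<in> borel_measurable \<mu>" using l measurable_cong_sets[OF sets refl] by blast
      have meas_ind: "indicator (r ` U) \<in> borel_measurable \<mu>" using rU sets by simp
      have AE_k: "AE x in \<mu>. indicator (r ` U) x * k x = k x"
      proof (rule AE_mp[OF AE_Z], rule AE_I2, rule impI)
        fix x assume x: "x \<in> ?Z"
        show "indicator (r ` U) x * k x = k x"
        proof (cases "k x = 0")
          case False
          then have "x \<in> ball p \<rho>2" using k(2) by auto
          then have "x \<in> r ` U" using x G(2) \<rho>2(2) by blast
          then show ?thesis by simp
        qed simp
      qed
      have dens: "density \<mu> (indicator (r ` U)) = density \<mu> (\<lambda>x. ennreal (indicator (r ` U) x))"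
        by (simp add: ennreal_indicator)
      have meas_ind_r: "(indicator (r ` U) :: _ \<Rightarrow> real) \<in> borel_measurable \<mu>" using rU sets by simp
      have "integral\<^sup>L (chart_measure U r) k = (\<integral>x. indicator (r ` U) x * k x \<partial>\<mu>)"
        unfolding restrict dens using integral_density[OF meas meas_ind_r] by simp
      also have "\<dots> = integral\<^sup>L \<mu> k"
        by (rule integral_cong_AE) (use meas meas_ind_r AE_k in auto)
      finally have int: "integral\<^sup>L (chart_measure U r) k = integral\<^sup>L \<mu> k" .
      have "integrable \<mu> (\<lambda>x. indicator (r ` U) x * k x)"
        using l integrable_density[OF meas meas_ind_r] unfolding restrict dens by simp
      then have "integrable \<mu> k"
        using integrable_cong_AE[of "\<lambda>x. indicator (r ` U) x * k x" \<mu> k] meas meas_ind_r AE_k by auto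
      then show "integrable \<mu> k \<and> (\<forall>\<epsilon>. (\<forall>n. \<epsilon> n > 0) \<longrightarrow> \<epsilon> \<longlonglongrightarrow> 0 \<longrightarrow>
        (\<lambda>n. \<integral>x. indicator W x * layer_density k (\<epsilon> n) x \<partial>lborel) \<longlonglongrightarrow> integral\<^sup>L \<mu> k)"
        using l unfolding int by blast
    qed
  qed
qed

end

section \<open>The global layer limit by a partition of unity\<close>

lemma compact_positive_lower_bound:
  fixes f :: "'a::topological_space \<Rightarrow> real"
  assumes "compact K" "continuous_on K f" "\<And>x. x \<in> K \<Longrightarrow> f x > 0"
  shows "\<exists>e>0. \<forall>x\<in>K. e \<le> f x"
proof (cases "K = {}")
  case True
  then show ?thesis by (auto intro: exI[of _ 1])
next
  case False
  then obtain z where "z \<in> K" "\<And>x. x \<in> K \<Longrightarrow> f z \<le> f x"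
    using continuous_attains_inf[OF assms(1) _ assms(2)] by blast
  then show ?thesis using assms(3) by (intro exI[of _ "f z"]) blast
qed

context regular_level
begin

lemma continuous_on_layer_density:
  assumes "continuous_on W k" "\<epsilon> > 0"
  shows "continuous_on W (layer_density k \<epsilon>)"
  unfolding layer_density_def
  using assms(2) by (intro continuous_intros assms(1) cont_g cont_phi) auto

lemma integrable_layer_density:
  assumes C: "compact C" "C \<subseteq> W" and far: "\<And>x. x \<in> W \<Longrightarrow> x \<notin> C \<Longrightarrow> \<bar>\<phi> x\<bar> > e"
    and "continuous_on W k" "0 < \<epsilon>" "\<epsilon> \<le> e"
  shows "integrable lborel (\<lambda>x. indicator W x * layer_density k \<epsilon> x)"
proof (rule integrable_indicator_cutoff[OF C continuous_on_layer_density[OF assms(4,5)]])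
  fix x assume "x \<in> W" "x \<notin> C"
  then have "1 \<le> \<bar>\<phi> x / \<epsilon>\<bar>" using far[of x] assms(5,6) by (simp add: abs_divide)
  then show "layer_density k \<epsilon> x = 0" by (simp add: layer_density_def bump_eq_0)
qed

text \<open>Hat functions of finitely many balls split \<open>k\<close> into pieces that
  \<open>surface_layer_limit_local\<close> handles. Their sum is under control only near the
  surface, and thin layers do not leave that region.\<close>

lemma surface_layer_limit:
  assumes compactZ: "compact {x. \<phi> x = 0}" and surface: "smooth_surface {x. \<phi> x = 0}"
    and C: "compact C" "C \<subseteq> W" and far: "\<And>x. x \<in> W \<Longrightarrow> x \<notin> C \<Longrightarrow> \<bar>\<phi> x\<bar> > e0" and "e0 > 0"
    and k: "continuous_on W k" and k_meas: "k \<in> borel_measurable borel" and eps: "\<And>n. \<epsilon> n > 0" "\<epsilon> \<longlonglongrightarrow> 0"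
  shows "(\<lambda>n. \<integral>x. indicator W x * layer_density k (\<epsilon> n) x \<partial>lborel) \<longlonglongrightarrow>
           integral\<^sup>L (surface_measure {x. \<phi> x = 0}) k"
proof -
  let ?Z = "{x. \<phi> x = 0}"
  define \<mu> where "\<mu> = surface_measure ?Z"
  have closed: "closed ?Z" by (rule compact_imp_closed[OF compactZ])
  have is\<mu>: "is_surface_measure ?Z \<mu>"
    unfolding \<mu>_def by (rule is_surface_measure_surface_measure[OF closed surface])
  have AE_Z: "AE x in \<mu>. x \<in> ?Z"
    by (rule AE_I[of _ _ "- ?Z"]) (use is\<mu> in \<open>auto simp: is_surface_measure_def intro!: borel_open open_Compl closed\<close>)
  define good where "good = (\<lambda>p \<rho>. \<rho> > 0 \<and> (\<forall>k. continuous_on W k \<longrightarrow> (\<forall>x. x \<notin> ball p \<rho> \<longrightarrow> k x = 0) \<longrightarrow>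
      integrable \<mu> k \<and>
      (\<forall>\<epsilon>. (\<forall>n. \<epsilon> n > 0) \<longrightarrow> \<epsilon> \<longlonglongrightarrow> 0 \<longrightarrow>
        (\<lambda>n. \<integral>x. indicator W x * layer_density k (\<epsilon> n) x \<partial>lborel) \<longlonglongrightarrow> integral\<^sup>L \<mu> k)))"
  have "\<exists>\<rho>. good p \<rho>" if "p \<in> ?Z" for p
    using surface_layer_limit_local[OF closed surface, of p] that unfolding good_def \<mu>_def by auto
  then obtain \<rho> where \<rho>: "\<And>p. p \<in> ?Z \<Longrightarrow> good p (\<rho> p)" by metis
  obtain P where P: "P \<subseteq> ?Z" "finite P" "?Z \<subseteq> (\<Union>p\<in>P. ball p (\<rho> p))"
  proof (rule compactE_image[OF compactZ, of ?Z "\<lambda>p. ball p (\<rho> p)"])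
    show "?Z \<subseteq> (\<Union>p\<in>?Z. ball p (\<rho> p))"
    proof
      fix p assume "p \<in> ?Z"
      moreover from \<rho>[OF this] have "p \<in> ball p (\<rho> p)" by (simp add: good_def)
      ultimately show "p \<in> (\<Union>p\<in>?Z. ball p (\<rho> p))" by blast
    qed
  qed auto
  define hat where "hat = (\<lambda>p x. max 0 (\<rho> p - dist p x))"
  define s where "s = (\<lambda>x. \<Sum>p\<in>P. hat p x)"
  have cont_hat: "continuous_on A (hat p)" for A p
    unfolding hat_def by (intro continuous_intros)
  have conts: "continuous_on A s" for A
    unfolding s_def by (intro continuous_intros cont_hat)
  have s_pos: "s x > 0" if "x \<in> ?Z" for x
  proof -
    obtain p where "p \<in> P" "x \<in> ball p (\<rho> p)" using P(3) \<open>x \<in> ?Z\<close> by blast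
    then have "0 < hat p x" by (simp add: hat_def)
    also have "hat p x \<le> s x"
      unfolding s_def by (rule member_le_sum[OF \<open>p \<in> P\<close>]) (auto simp: hat_def P(2))
    finally show ?thesis .
  qed
  obtain \<eta> where \<eta>: "\<eta> > 0" "\<forall>x\<in>?Z. \<eta> \<le> s x"
    using compact_positive_lower_bound[OF compactZ conts s_pos] by auto
  \<comment> \<open>The part of \<open>C\<close> where the hats may fail to form a partition of
    unity. It avoids the zero set, so \<open>\<phi>\<close> is bounded away from 0 on it.\<close>
  define C' where "C' = C \<inter> {x. s x \<le> \<eta> / 2}"
  have "closed {x. s x \<le> \<eta> / 2}"
    by (rule closed_Collect_le) (auto intro: conts)
  then have C': "compact C'" unfolding C'_def by (rule compact_Int_closed[OF C(1)])
  have "continuous_on C' (\<lambda>x. \<bar>\<phi> x\<bar>)"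
    by (intro continuous_intros continuous_on_subset[OF cont_phi]) (use C(2) in \<open>auto simp: C'_def\<close>)
  moreover have "0 < \<bar>\<phi> x\<bar>" if "x \<in> C'" for x
    using \<eta>(2) that \<eta>(1) by (cases "\<phi> x = 0") (auto simp: C'_def)
  ultimately obtain e1 where e1: "e1 > 0" "\<forall>x\<in>C'. e1 \<le> \<bar>\<phi> x\<bar>"
    using compact_positive_lower_bound[OF C'] by blast
  \<comment> \<open>The maximum keeps the quotient continuous on all of \<open>W\<close>; where
    \<open>s\<close> is at least \<eta> / 2, the pieces add up to \<open>k\<close>.\<close>
  define kp where "kp = (\<lambda>p x. k x * hat p x / max (s x) (\<eta> / 2))"
  have contkp: "continuous_on W (kp p)" for p
    unfolding kp_def using \<eta>(1) by (intro continuous_intros k cont_hat conts) auto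
  have kp_sum: "(\<Sum>p\<in>P. kp p x) = k x" if "s x \<ge> \<eta> / 2" for x
  proof -
    have "s x \<noteq> 0" using that \<eta>(1) by linarith
    moreover have "(\<Sum>p\<in>P. hat p x) = s x" by (simp add: s_def)
    ultimately show ?thesis using that
      by (simp add: kp_def max_absorb1 flip: sum_divide_distrib sum_distrib_left)
  qed
  have kp0: "\<forall>x. x \<notin> ball p (\<rho> p) \<longrightarrow> kp p x = 0" for p
    by (simp add: kp_def hat_def)
  have kp_lim: "integrable \<mu> (kp p)"
      "(\<lambda>n. \<integral>x. indicator W x * layer_density (kp p) (\<epsilon> n) x \<partial>lborel) \<longlonglongrightarrow> integral\<^sup>L \<mu> (kp p)" if "p \<in> P" for p
  proof -
    have "good p (\<rho> p)" using \<rho> P(1) that by blast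
    note l = this[unfolded good_def, THEN conjunct2, THEN spec, THEN mp, OF contkp, THEN mp, OF kp0]
    show "integrable \<mu> (kp p)" using l by (rule conjunct1)
    show "(\<lambda>n. \<integral>x. indicator W x * layer_density (kp p) (\<epsilon> n) x \<partial>lborel) \<longlonglongrightarrow> integral\<^sup>L \<mu> (kp p)"
      using l eps by simp
  qed
  have lim: "(\<lambda>n. \<Sum>p\<in>P. \<integral>x. indicator W x * layer_density (kp p) (\<epsilon> n) x \<partial>lborel) \<longlonglongrightarrow> (\<Sum>p\<in>P. integral\<^sup>L \<mu> (kp p))"
    by (rule tendsto_sum) (rule kp_lim(2))
  have "(\<Sum>p\<in>P. integral\<^sup>L \<mu> (kp p)) = (\<integral>x. (\<Sum>p\<in>P. kp p x) \<partial>\<mu>)"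
    by (rule Bochner_Integration.integral_sum[symmetric]) (rule kp_lim(1))
  also have "\<dots> = integral\<^sup>L \<mu> k"
  proof (rule integral_cong_AE)
    have "(\<lambda>x. \<Sum>p\<in>P. kp p x) \<in> borel_measurable \<mu>"
      using kp_lim(1) by (intro borel_measurable_sum) auto
    then show "(\<lambda>x. \<Sum>p\<in>P. kp p x) \<in> borel_measurable \<mu>" .
    show AE: "AE x in \<mu>. (\<Sum>p\<in>P. kp p x) = k x"
    proof (rule AE_mp[OF AE_Z], rule AE_I2, rule impI)
      fix x assume "x \<in> ?Z"
      then have "s x \<ge> \<eta> / 2" using \<eta> by auto
      then show "(\<Sum>p\<in>P. kp p x) = k x" by (rule kp_sum)
    qed
    show "k \<in> borel_measurable \<mu>"
      by (subst measurable_cong_sets[of \<mu> borel, OF _ refl]) (use k_meas is\<mu> in \<open>auto simp: is_surface_measure_def\<close>)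
  qed
  finally have lim': "(\<lambda>n. \<Sum>p\<in>P. \<integral>x. indicator W x * layer_density (kp p) (\<epsilon> n) x \<partial>lborel) \<longlonglongrightarrow> integral\<^sup>L \<mu> k"
    using lim by simp
  \<comment> \<open>Below \<open>e0\<close> the layer lies in \<open>C\<close>, and below
    \<open>e1\<close> it misses \<open>C'\<close>.\<close>
  have "\<forall>\<^sub>F n in sequentially. \<epsilon> n < min e0 e1"
    by (rule order_tendstoD(2)[OF eps(2)]) (use \<open>e0 > 0\<close> e1(1) in simp)
  then have ev: "\<forall>\<^sub>F n in sequentially. (\<Sum>p\<in>P. \<integral>x. indicator W x * layer_density (kp p) (\<epsilon> n) x \<partial>lborel) =
      (\<integral>x. indicator W x * layer_density k (\<epsilon> n) x \<partial>lborel)"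
  proof eventually_elim
    case (elim n)
    have "(\<Sum>p\<in>P. \<integral>x. indicator W x * layer_density (kp p) (\<epsilon> n) x \<partial>lborel) =
        (\<integral>x. (\<Sum>p\<in>P. indicator W x * layer_density (kp p) (\<epsilon> n) x) \<partial>lborel)"
      by (rule Bochner_Integration.integral_sum[symmetric], rule integrable_layer_density[OF C far contkp eps(1)])
         (use elim in auto)
    also have "\<dots> = (\<integral>x. indicator W x * layer_density k (\<epsilon> n) x \<partial>lborel)"
    proof (rule Bochner_Integration.integral_cong[OF refl])
      fix x
      have sum: "(\<Sum>p\<in>P. indicator W x * layer_density (kp p) (\<epsilon> n) x) =
          indicator W x * (bump (\<phi> x / \<epsilon> n) / \<epsilon> n * ((\<Sum>p\<in>P. kp p x) * norm (g x)))"
        by (simp add: layer_density_def sum_distrib_left sum_distrib_right)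
      show "(\<Sum>p\<in>P. indicator W x * layer_density (kp p) (\<epsilon> n) x) = indicator W x * layer_density k (\<epsilon> n) x"
      proof (cases "x \<in> W \<and> bump (\<phi> x / \<epsilon> n) \<noteq> 0")
        case True
        then have "\<not> 1 \<le> \<bar>\<phi> x / \<epsilon> n\<bar>" using bump_eq_0(1) by blast
        then have small: "\<bar>\<phi> x\<bar> < \<epsilon> n" using eps(1)[of n] by (simp add: abs_divide)
        then have "x \<in> C" using far[of x] True elim by force
        moreover have "x \<notin> C'" using e1(2) small elim by force
        ultimately have "s x \<ge> \<eta> / 2" by (simp add: C'_def)
        then show ?thesis unfolding sum by (simp add: kp_sum layer_density_def)
      qed (auto simp: sum layer_density_def)
    qed
    finally show ?case .
  qed
  show ?thesis
    unfolding \<mu>_def[symmetric] by (rule Lim_transform_eventually[OF lim' ev])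
qed

end

section \<open>Mixed derivatives, limits of derivatives, neighbourhoods of compact sets\<close>

text \<open>Two mean value theorems: one along \<open>v\<close> for the increment of
  \<open>g\<close> in direction \<open>w\<close>, then one along \<open>w\<close> for the derivative
  in direction \<open>v\<close>.\<close>

lemma second_difference_mean_value:
  fixes g :: "'a::euclidean_space \<Rightarrow> real"
  assumes g: "C1_on S g g'" and D: "C1_on S (\<lambda>x. g' x v) D'"
    and ball: "ball z \<delta> \<subseteq> S" and h: "h > 0" "h * (norm v + norm w) < \<delta>"
  shows "\<exists>x\<in>ball z \<delta>. g (z + h *\<^sub>R v + h *\<^sub>R w) - g (z + h *\<^sub>R v) - g (z + h *\<^sub>R w) + g z = h * (h * D' x w)"
proof -
  have inb: "z + s *\<^sub>R v + r *\<^sub>R w \<in> ball z \<delta>" if "0 \<le> s" "s \<le> h" "0 \<le> r" "r \<le> h" for s r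
  proof -
    have "norm (s *\<^sub>R v + r *\<^sub>R w) \<le> s * norm v + r * norm w"
      using norm_triangle_ineq[of "s *\<^sub>R v" "r *\<^sub>R w"] that by simp
    also have "\<dots> \<le> h * norm v + h * norm w"
      using that by (intro add_mono mult_right_mono) auto
    also have "\<dots> < \<delta>" using h(2) by (simp add: algebra_simps)
    finally have "norm (s *\<^sub>R v + r *\<^sub>R w) < \<delta>" .
    moreover have "z - (z + s *\<^sub>R v + r *\<^sub>R w) = - (s *\<^sub>R v + r *\<^sub>R w)" by simp
    ultimately show ?thesis unfolding mem_ball dist_norm by (metis norm_minus_cancel)
  qed
  have dline: "((\<lambda>s. f (p + s *\<^sub>R d)) has_real_derivative f' (p + s *\<^sub>R d) d) (at s)"
    if f: "C1_on S f f'" and p: "p + s *\<^sub>R d \<in> S" for f :: "'a \<Rightarrow> real" and f' p d s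
  proof -
    have "((\<lambda>s. p + s *\<^sub>R d) has_derivative (\<lambda>h. h *\<^sub>R d)) (at s)"
      by (auto intro!: derivative_eq_intros)
    from has_derivative_compose[OF this C1_onD(1)[OF f p]]
    have "((\<lambda>s. f (p + s *\<^sub>R d)) has_derivative (\<lambda>h. f' (p + s *\<^sub>R d) (h *\<^sub>R d))) (at s)" .
    moreover have "(\<lambda>h. f' (p + s *\<^sub>R d) (h *\<^sub>R d)) = (*) (f' (p + s *\<^sub>R d) d)"
      using linear_scale[OF C1_on_derivative_linear[OF f p]] by (auto simp: fun_eq_iff)
    ultimately show ?thesis by (simp add: has_field_derivative_def)
  qed
  let ?q = "\<lambda>s. g ((z + h *\<^sub>R w) + s *\<^sub>R v) - g (z + s *\<^sub>R v)"
  have "\<exists>\<xi>. 0 < \<xi> \<and> \<xi> < h \<and> ?q h - ?q 0 = (h - 0) * (g' ((z + h *\<^sub>R w) + \<xi> *\<^sub>R v) v - g' (z + \<xi> *\<^sub>R v) v)"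
  proof (rule MVT2[OF h(1)])
    fix s assume s: "0 \<le> s" "s \<le> h"
    have "(z + h *\<^sub>R w) + s *\<^sub>R v \<in> S" "z + s *\<^sub>R v \<in> S"
      using inb[of s h] inb[of s 0] s h(1) ball by (auto simp: add_ac)
    then show "(?q has_real_derivative (g' ((z + h *\<^sub>R w) + s *\<^sub>R v) v - g' (z + s *\<^sub>R v) v)) (at s)"
      by (intro DERIV_diff dline[OF g])
  qed
  then obtain \<xi> where \<xi>: "0 < \<xi>" "\<xi> < h"
    "?q h - ?q 0 = h * (g' ((z + h *\<^sub>R w) + \<xi> *\<^sub>R v) v - g' (z + \<xi> *\<^sub>R v) v)" by auto
  have "\<exists>\<eta>. 0 < \<eta> \<and> \<eta> < h \<and> g' ((z + \<xi> *\<^sub>R v) + h *\<^sub>R w) v - g' ((z + \<xi> *\<^sub>R v) + 0 *\<^sub>R w) v =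
      (h - 0) * D' ((z + \<xi> *\<^sub>R v) + \<eta> *\<^sub>R w) w"
  proof (rule MVT2[OF h(1)])
    fix r assume "0 \<le> r" "r \<le> h"
    then have "(z + \<xi> *\<^sub>R v) + r *\<^sub>R w \<in> S" using inb[of \<xi> r] \<xi> ball by auto
    then show "((\<lambda>r. g' ((z + \<xi> *\<^sub>R v) + r *\<^sub>R w) v) has_real_derivative D' ((z + \<xi> *\<^sub>R v) + r *\<^sub>R w) w) (at r)"
      by (rule dline[OF D])
  qed
  then obtain \<eta> where \<eta>: "0 < \<eta>" "\<eta> < h"
    "g' ((z + \<xi> *\<^sub>R v) + h *\<^sub>R w) v - g' (z + \<xi> *\<^sub>R v) v = h * D' ((z + \<xi> *\<^sub>R v) + \<eta> *\<^sub>R w) w" by auto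
  show ?thesis
  proof (rule bexI)
    show "(z + \<xi> *\<^sub>R v) + \<eta> *\<^sub>R w \<in> ball z \<delta>" using inb[of \<xi> \<eta>] \<xi> \<eta> by simp
    show "g (z + h *\<^sub>R v + h *\<^sub>R w) - g (z + h *\<^sub>R v) - g (z + h *\<^sub>R w) + g z = h * (h * D' ((z + \<xi> *\<^sub>R v) + \<eta> *\<^sub>R w) w)"
      using \<xi>(3) \<eta>(3) by (simp add: add_ac)
  qed
qed

text \<open>The second difference is symmetric in \<open>v\<close> and \<open>w\<close>, so values
  of the two mixed derivatives at nearby points coincide; continuity leaves no room for a gap at
  \<open>z\<close>.\<close>

lemma C1_on_mixed_derivatives_eq:
  fixes g :: "'a::euclidean_space \<Rightarrow> real"
  assumes g: "C1_on S g g'" and "open S" "z \<in> S"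
    and Dv: "C1_on S (\<lambda>x. g' x v) Dv'" and Dw: "C1_on S (\<lambda>x. g' x w) Dw'"
  shows "Dv' z w = Dw' z v"
proof (rule ccontr)
  assume ne: "Dv' z w \<noteq> Dw' z v"
  define e where "e = \<bar>Dv' z w - Dw' z v\<bar> / 2"
  have e: "e > 0" using ne by (simp add: e_def)
  define Q where "Q = S \<inter> (\<lambda>x. \<bar>Dv' x w - Dv' z w\<bar> + \<bar>Dw' x v - Dw' z v\<bar>) -` {..<e}"
  have "open Q" unfolding Q_def
    by (rule continuous_open_preimage[OF _ \<open>open S\<close>])
       (intro continuous_intros C1_onD(2)[OF Dv] C1_onD(2)[OF Dw], simp)
  moreover have "z \<in> Q" using e \<open>z \<in> S\<close> by (simp add: Q_def)
  ultimately obtain \<delta> where \<delta>: "\<delta> > 0" "ball z \<delta> \<subseteq> Q" by (rule openE)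
  have ball: "ball z \<delta> \<subseteq> S" using \<delta>(2) by (auto simp: Q_def)
  \<comment> \<open>The summand 1 keeps the denominator positive when both directions are 0.\<close>
  define h where "h = \<delta> / (2 * (norm v + norm w + 1))"
  have pos: "norm v + norm w + 1 > 0" using norm_ge_zero[of v] norm_ge_zero[of w] by linarith
  have h: "h > 0" "h * (norm v + norm w) < \<delta>"
  proof -
    show hpos: "h > 0" unfolding h_def using \<delta>(1) pos by simp
    have double: "a < 2 * (a + 1)" if "0 \<le> a" for a :: real using that by simp
    have "norm v + norm w < 2 * (norm v + norm w + 1)"
      by (rule double) (intro add_nonneg_nonneg norm_ge_zero)
    then have "h * (norm v + norm w) < h * (2 * (norm v + norm w + 1))"
      using hpos by (rule mult_strict_left_mono)
    also have "\<dots> = \<delta>" unfolding h_def using pos by (simp add: field_simps)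
    finally show "h * (norm v + norm w) < \<delta>" .
  qed
  have h': "h * (norm w + norm v) < \<delta>" using h(2) by (simp add: add.commute)
  obtain x where x: "x \<in> ball z \<delta>"
    "g (z + h *\<^sub>R v + h *\<^sub>R w) - g (z + h *\<^sub>R v) - g (z + h *\<^sub>R w) + g z = h * (h * Dv' x w)"
    using second_difference_mean_value[OF g Dv ball h] by blast
  obtain y where y: "y \<in> ball z \<delta>"
    "g (z + h *\<^sub>R w + h *\<^sub>R v) - g (z + h *\<^sub>R w) - g (z + h *\<^sub>R v) + g z = h * (h * Dw' y v)"
    using second_difference_mean_value[OF g Dw ball h(1) h'] by blast
  have comm: "z + h *\<^sub>R w + h *\<^sub>R v = z + h *\<^sub>R v + h *\<^sub>R w" by (simp add: add_ac)
  have "h * (h * Dv' x w) = h * (h * Dw' y v)" using x(2) y(2) unfolding comm by linarith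
  then have "Dv' x w = Dw' y v" using h(1) by simp
  moreover have "\<bar>Dv' x w - Dv' z w\<bar> < e" "\<bar>Dw' y v - Dw' z v\<bar> < e"
    using x(1) y(1) \<delta>(2) by (force simp: Q_def)+
  moreover have False if "p = q" "\<bar>p - a\<bar> < \<bar>a - b\<bar> / 2" "\<bar>q - b\<bar> < \<bar>a - b\<bar> / 2" for a b p q :: real
    using that by (auto simp: abs_if split: if_splits)
  ultimately show False unfolding e_def by blast
qed

text \<open>\<open>K\<close> bounds the second derivatives, so the error of the first order
  expansion at \<open>t0\<close> is quadratic with a constant independent of \<open>n\<close>, and
  the estimate passes to the limit. It takes the place of uniform convergence of the derivatives:
  \<open>B n\<close> has to converge at \<open>t0\<close> alone.\<close>

lemma derivative_of_limit_quadratic: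
  fixes A B :: "nat \<Rightarrow> real \<Rightarrow> real"
  assumes "\<delta> > 0"
    and A: "\<And>n s. \<bar>s - t0\<bar> < \<delta> \<Longrightarrow> (A n has_real_derivative B n s) (at s)"
    and B: "\<And>n s. \<bar>s - t0\<bar> < \<delta> \<Longrightarrow> (B n has_real_derivative B' n s) (at s)"
    and B': "\<And>n s. \<bar>s - t0\<bar> < \<delta> \<Longrightarrow> \<bar>B' n s\<bar> \<le> K"
    and a: "\<And>s. \<bar>s - t0\<bar> < \<delta> \<Longrightarrow> (\<lambda>n. A n s) \<longlonglongrightarrow> a s" and b: "(\<lambda>n. B n t0) \<longlonglongrightarrow> b"
  shows "(a has_real_derivative b) (at t0)"
proof -
  \<comment> \<open>The constant is \<open>K\<close> and not half of it, because the mean value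
    inequality is used twice: for \<open>B n\<close>, and for \<open>A n\<close> minus its linear
    part.\<close>
  have quad: "\<bar>A n t - A n t0 - (t - t0) * B n t0\<bar> \<le> K * \<bar>t - t0\<bar> * \<bar>t - t0\<bar>" if t: "\<bar>t - t0\<bar> < \<delta>" for n t
  proof -
    let ?S = "cball t0 \<bar>t - t0\<bar>"
    have S: "\<bar>s - t0\<bar> < \<delta>" "\<bar>s - t0\<bar> \<le> \<bar>t - t0\<bar>" if "s \<in> ?S" for s
      using that t by (auto simp: dist_real_def abs_minus_commute)
    have lip: "\<bar>B n s - B n t0\<bar> \<le> K * \<bar>t - t0\<bar>" if s: "s \<in> ?S" for s
    proof -
      have "norm (B n s - B n t0) \<le> K * norm (s - t0)"
      proof (rule field_differentiable_bound[where S = ?S and f' = "B' n"])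
        show "(B n has_field_derivative B' n z) (at z within ?S)" if "z \<in> ?S" for z
          using B[OF S(1)[OF that]] by (rule has_field_derivative_at_within)
        show "norm (B' n z) \<le> K" if "z \<in> ?S" for z using B'[OF S(1)[OF that]] by simp
      qed (use s in auto)
      also have "\<dots> \<le> K * \<bar>t - t0\<bar>"
        using S(2)[OF s] B'[of t0 n] \<open>\<delta> > 0\<close> by (intro mult_left_mono) auto
      finally show ?thesis by simp
    qed
    have "norm ((A n t - t * B n t0) - (A n t0 - t0 * B n t0)) \<le> (K * \<bar>t - t0\<bar>) * norm (t - t0)"
    proof (rule field_differentiable_bound[where S = ?S and f' = "\<lambda>s. B n s - B n t0"])
      show "((\<lambda>s. A n s - s * B n t0) has_field_derivative B n z - B n t0) (at z within ?S)" if "z \<in> ?S" for z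
      proof -
        have "((\<lambda>s. A n s - s * B n t0) has_real_derivative B n z - 1 * B n t0) (at z)"
          by (intro DERIV_diff A[OF S(1)[OF that]] DERIV_cmult_right DERIV_ident)
        then show ?thesis by (simp add: has_field_derivative_at_within)
      qed
      show "norm (B n z - B n t0) \<le> K * \<bar>t - t0\<bar>" if "z \<in> ?S" for z using lip[OF that] by simp
    qed (auto simp: dist_real_def abs_minus_commute)
    then show ?thesis by (simp add: algebra_simps)
  qed
  have lim_quad: "\<bar>a t - a t0 - (t - t0) * b\<bar> \<le> K * \<bar>t - t0\<bar> * \<bar>t - t0\<bar>" if t: "\<bar>t - t0\<bar> < \<delta>" for t
  proof (rule LIMSEQ_le_const2)
    show "(\<lambda>n. \<bar>A n t - A n t0 - (t - t0) * B n t0\<bar>) \<longlonglongrightarrow> \<bar>a t - a t0 - (t - t0) * b\<bar>"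
      using a[OF t] a[of t0] b \<open>\<delta> > 0\<close> by (intro tendsto_intros) auto
  qed (use quad[OF t] in auto)
  have "((\<lambda>t. (a t - a t0) / (t - t0) - b) \<longlongrightarrow> 0) (at t0)"
  proof (rule Lim_null_comparison)
    show "\<forall>\<^sub>F t in at t0. norm ((a t - a t0) / (t - t0) - b) \<le> K * \<bar>t - t0\<bar>"
      unfolding eventually_at
    proof (intro exI[of _ \<delta>] conjI ballI impI \<open>\<delta> > 0\<close>)
      fix t assume "t \<noteq> t0 \<and> dist t t0 < \<delta>"
      then have t: "t - t0 \<noteq> 0" "\<bar>t - t0\<bar> < \<delta>" by (auto simp: dist_real_def)
      have "(a t - a t0) / (t - t0) - b = (a t - a t0 - (t - t0) * b) / (t - t0)"
        using t(1) by (simp add: field_simps)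
      then show "norm ((a t - a t0) / (t - t0) - b) \<le> K * \<bar>t - t0\<bar>"
        using lim_quad[OF t(2)] t(1) by (simp add: abs_divide divide_le_eq)
    qed
    have "((\<lambda>t. K * \<bar>t - t0\<bar>) \<longlongrightarrow> K * \<bar>t0 - t0\<bar>) (at t0)" by (intro tendsto_intros)
    then show "((\<lambda>t. K * \<bar>t - t0\<bar>) \<longlongrightarrow> 0) (at t0)" by simp
  qed
  then show ?thesis
    unfolding has_field_derivative_iff by (rule LIM_zero_cancel)
qed

text \<open>Gronwall in both time directions: \<open>exp (- c * s) * m s\<close> is nonincreasing
  and \<open>exp (c * s) * m s\<close> is nondecreasing.\<close>

lemma exponential_growth_bound:
  fixes m :: "real \<Rightarrow> real"
  assumes deriv: "\<And>s. \<bar>s - t0\<bar> < \<delta> \<Longrightarrow> (m has_real_derivative m' s) (at s)"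
    and bound: "\<And>s. \<bar>s - t0\<bar> < \<delta> \<Longrightarrow> \<bar>m' s\<bar> \<le> c * m s"
    and t: "\<bar>t - t0\<bar> < \<delta>"
  shows "m t \<le> exp (c * \<bar>t - t0\<bar>) * m t0"
proof (cases "t0 \<le> t")
  case True
  have "exp (- c * t) * m t \<le> exp (- c * t0) * m t0"
  proof (rule DERIV_nonpos_imp_nonincreasing[OF True])
    fix s assume "t0 \<le> s" "s \<le> t"
    then have s: "\<bar>s - t0\<bar> < \<delta>" using t by auto
    have "((\<lambda>s. exp (- c * s) * m s) has_real_derivative exp (- c * s) * (m' s - c * m s)) (at s)"
      by (auto intro!: derivative_eq_intros deriv[OF s] simp: algebra_simps)
    moreover have "exp (- c * s) * (m' s - c * m s) \<le> 0"
      using bound[OF s] by (intro mult_nonneg_nonpos) auto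
    ultimately show "\<exists>y. ((\<lambda>s. exp (- c * s) * m s) has_real_derivative y) (at s) \<and> y \<le> 0" by blast
  qed
  then have "exp (c * t) * (exp (- c * t) * m t) \<le> exp (c * t) * (exp (- c * t0) * m t0)" by simp
  then show ?thesis using True by (simp add: algebra_simps flip: exp_add mult.assoc)
next
  case False
  then have le: "t \<le> t0" by simp
  have "exp (c * t) * m t \<le> exp (c * t0) * m t0"
  proof (rule DERIV_nonneg_imp_nondecreasing[OF le])
    fix s assume "t \<le> s" "s \<le> t0"
    then have s: "\<bar>s - t0\<bar> < \<delta>" using t by auto
    have "((\<lambda>s. exp (c * s) * m s) has_real_derivative exp (c * s) * (m' s + c * m s)) (at s)"
      by (auto intro!: derivative_eq_intros deriv[OF s] simp: algebra_simps)
    moreover have "exp (c * s) * (m' s + c * m s) \<ge> 0"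
      using bound[OF s] by (intro mult_nonneg_nonneg) auto
    ultimately show "\<exists>y. ((\<lambda>s. exp (c * s) * m s) has_real_derivative y) (at s) \<and> 0 \<le> y" by blast
  qed
  then have "exp (- c * t) * (exp (c * t) * m t) \<le> exp (- c * t) * (exp (c * t0) * m t0)" by simp
  then show ?thesis using False by (simp add: algebra_simps flip: exp_add mult.assoc)
qed

text \<open>The tube lemma, in the form that extends an open condition from time \<open>t0\<close>
  to an interval of times.\<close>

lemma compact_slice_time_interval:
  fixes Q :: "('a::topological_space \<times> real) set"
  assumes "compact K" "open Q" "\<And>x. x \<in> K \<Longrightarrow> (x, t0) \<in> Q"
  shows "\<exists>\<delta>>0. \<forall>x\<in>K. \<forall>t. \<bar>t - t0\<bar> < \<delta> \<longrightarrow> (x, t) \<in> Q"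
proof -
  have "\<exists>U V. openin euclidean U \<and> openin euclidean V \<and> K \<subseteq> U \<and> t0 \<in> V \<and> U \<times> V \<subseteq> Q"
  proof (rule tube_lemma_left)
    show "openin (prod_topology euclidean euclidean) Q" using \<open>open Q\<close> by simp
  qed (use assms(1,3) in auto)
  then obtain U V where UV: "open V" "K \<subseteq> U" "t0 \<in> V" "U \<times> V \<subseteq> Q"
    unfolding open_openin[symmetric] by (elim exE conjE)
  from UV(1,3) obtain \<delta> where \<delta>: "\<delta> > 0" "ball t0 \<delta> \<subseteq> V" by (rule openE)
  have "(x, t) \<in> Q" if "x \<in> K" "\<bar>t - t0\<bar> < \<delta>" for x t
  proof -
    have "t \<in> V" using that(2) \<delta>(2) by (auto simp: dist_real_def abs_minus_commute)
    then show ?thesis using UV(2,4) that(1) by blast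
  qed
  then show ?thesis using \<delta>(1) by blast
qed

text \<open>Sublevel sets of the distance to \<open>K\<close> at the levels d / 2 and d. Later
  \<open>K\<close> is the surface at one time, \<open>U\<close> catches the zeros at nearby times,
  \<open>C\<close> carries the layers, and \<open>W\<close> is the domain of integration.\<close>

lemma compact_open_neighbourhoods:
  fixes K :: "'a::euclidean_space set"
  assumes "compact K" "open N" "K \<subseteq> N"
  shows "\<exists>U C W. open U \<and> compact C \<and> open W \<and> compact (closure W) \<and> K \<subseteq> U \<and> U \<subseteq> C \<and> C \<subseteq> W \<and> closure W \<subseteq> N"
proof (cases "K = {}")
  case True
  then show ?thesis by (intro exI[of _ "{}"]) auto
next
  case False
  obtain d where d: "d > 0" "{x. infdist x K \<le> d} \<subseteq> N"
    using compact_in_open_separated[OF False assms] by blast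
  have bdd: "bounded {x. infdist x K \<le> d}"
  proof -
    obtain z B where B: "\<And>y. y \<in> K \<Longrightarrow> dist z y \<le> B"
      using compact_imp_bounded[OF \<open>compact K\<close>] unfolding bounded_def by blast
    have "dist z x \<le> B + d" if "infdist x K \<le> d" for x
    proof -
      obtain y where "y \<in> K" "infdist x K = dist x y"
        using infdist_attains_inf[OF compact_imp_closed[OF \<open>compact K\<close>] False] by blast
      then show ?thesis using B[of y] that dist_triangle[of z x y] by (simp add: dist_commute)
    qed
    then show ?thesis unfolding bounded_def by blast
  qed
  have closed: "closed {x. infdist x K \<le> r}" for r
    by (rule closed_Collect_le) (intro continuous_intros)+
  have open': "open {x. infdist x K < r}" for r
    by (rule open_Collect_less) (intro continuous_intros)+
  have clW: "closure {x. infdist x K < d} \<subseteq> {x. infdist x K \<le> d}"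
    by (rule closure_minimal[OF _ closed]) auto
  have sub: "{x. infdist x K \<le> d / 2} \<subseteq> {x. infdist x K \<le> d}" using d(1) by auto
  show ?thesis
  proof (intro exI conjI)
    show "open {x. infdist x K < d / 2}" "open {x. infdist x K < d}" by (rule open')+
    show "compact {x. infdist x K \<le> d / 2}"
      using closed bounded_subset[OF bdd sub] compact_eq_bounded_closed by blast
    show "compact (closure {x. infdist x K < d})"
      using bounded_subset[OF bdd clW] compact_eq_bounded_closed closed_closure by blast
    show "closure {x. infdist x K < d} \<subseteq> N" using clW d(2) by blast
  qed (use d(1) in auto)
qed

section \<open>The first variation\<close>

text \<open>Smoothness of \<open>f\<close> is asked away from 0, since a function homogeneous of
  degree one that is differentiable at 0 is linear.\<close>

locale moving_surface =
  fixes T :: "real set" and \<phi> :: "real^3 \<Rightarrow> real \<Rightarrow> real" and f :: "real^3 \<Rightarrow> real"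
  assumes open_T: "open T"
    and smooth_phi: "smooth_on (UNIV \<times> T) (\<lambda>z. \<phi> (fst z) (snd z))"
    and smooth_f: "smooth_on (UNIV - {0}) f"
    and homogeneous: "\<And>s p. s > 0 \<Longrightarrow> f (s *\<^sub>R p) = s * f p"
begin

text \<open>\<open>D v = \<partial>\<^sub>v \<phi>\<close> and \<open>DD v w = \<partial>\<^sub>w \<partial>\<^sub>v \<phi>\<close> in space-time, so \<open>D (0, 1) = \<phi>\<^sub>t\<close>, and \<open>G = \<nabla>\<phi>\<close>;
  \<open>E\<close> and \<open>EE\<close> are the same for \<open>f\<close>.\<close>

definition P :: "(real^3) \<times> real \<Rightarrow> real" where "P z = \<phi> (fst z) (snd z)"

definition D :: "(real^3) \<times> real \<Rightarrow> (real^3) \<times> real \<Rightarrow> real" where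
  "D v z = frechet_derivative P (at z) v"

definition DD :: "(real^3) \<times> real \<Rightarrow> (real^3) \<times> real \<Rightarrow> (real^3) \<times> real \<Rightarrow> real" where
  "DD v w z = frechet_derivative (D v) (at z) w"

definition G :: "(real^3) \<times> real \<Rightarrow> real^3" where
  "G z = (\<chi> i. D (axis i 1, 0) z)"

definition E :: "real^3 \<Rightarrow> real^3 \<Rightarrow> real" where
  "E v p = frechet_derivative f (at p) v"

definition EE :: "real^3 \<Rightarrow> real^3 \<Rightarrow> real^3 \<Rightarrow> real" where
  "EE v w p = frechet_derivative (E v) (at p) w"

text \<open>The region of space-time where the unit normal is defined.\<close>

definition R where "R = {z \<in> UNIV \<times> T. G z \<noteq> 0}"

lemma C1_P: "C1_on (UNIV \<times> T) P (\<lambda>z v. D v z)"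
  and C1_D: "C1_on (UNIV \<times> T) (D v) (\<lambda>z w. DD v w z)"
  and C1_DD: "C1_on (UNIV \<times> T) (DD v w) (\<lambda>z. frechet_derivative (DD v w) (at z))"
proof -
  have sP: "smooth_on (UNIV \<times> T) P" using smooth_phi by (simp add: P_def[abs_def])
  have sD: "smooth_on (UNIV \<times> T) (D v)" using smooth_on_derivative[OF sP] by (simp add: D_def[abs_def])
  have sDD: "smooth_on (UNIV \<times> T) (DD v w)" using smooth_on_derivative[OF sD] by (simp add: DD_def[abs_def])
  show "C1_on (UNIV \<times> T) P (\<lambda>z v. D v z)"
    using smooth_on_imp_C1_on[OF sP] by (simp add: D_def)
  show "C1_on (UNIV \<times> T) (D v) (\<lambda>z w. DD v w z)"
    using smooth_on_imp_C1_on[OF sD] by (simp add: DD_def)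
  show "C1_on (UNIV \<times> T) (DD v w) (\<lambda>z. frechet_derivative (DD v w) (at z))"
    by (rule smooth_on_imp_C1_on[OF sDD])
qed

lemma C1_f: "C1_on (UNIV - {0}) f (\<lambda>p v. E v p)"
  and C1_E: "C1_on (UNIV - {0}) (E v) (\<lambda>p w. EE v w p)"
  and C1_EE: "C1_on (UNIV - {0}) (EE v w) (\<lambda>p. frechet_derivative (EE v w) (at p))"
proof -
  have sE: "smooth_on (UNIV - {0}) (E v)" using smooth_on_derivative[OF smooth_f] by (simp add: E_def[abs_def])
  have sEE: "smooth_on (UNIV - {0}) (EE v w)" using smooth_on_derivative[OF sE] by (simp add: EE_def[abs_def])
  show "C1_on (UNIV - {0}) f (\<lambda>p v. E v p)"
    using smooth_on_imp_C1_on[OF smooth_f] by (simp add: E_def)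
  show "C1_on (UNIV - {0}) (E v) (\<lambda>p w. EE v w p)"
    using smooth_on_imp_C1_on[OF sE] by (simp add: EE_def)
  show "C1_on (UNIV - {0}) (EE v w) (\<lambda>p. frechet_derivative (EE v w) (at p))"
    by (rule smooth_on_imp_C1_on[OF sEE])
qed

lemma open_domain: "open (UNIV \<times> T)"
  by (intro open_Times open_UNIV open_T)

lemma DD_commute: "z \<in> UNIV \<times> T \<Longrightarrow> DD v w z = DD w v z"
  by (rule C1_on_mixed_derivatives_eq[OF C1_P open_domain _ C1_D C1_D])

lemma C1_G: "C1_on (UNIV \<times> T) G (\<lambda>z w. \<chi> i. DD (axis i 1, 0) w z)"
  unfolding G_def[abs_def] by (rule C1_on_vec) (rule C1_D)

lemma open_R: "open R"
proof -
  have "R = (UNIV \<times> T) \<inter> G -` (- {0})" by (auto simp: R_def)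
  moreover have "open ((UNIV \<times> T) \<inter> G -` (- {0}))"
    by (rule continuous_open_preimage[OF C1_on_imp_continuous_on[OF C1_G] open_domain]) auto
  ultimately show ?thesis by simp
qed

lemma R_subset: "R \<subseteq> UNIV \<times> T" and G_R: "G ` R \<subseteq> UNIV - {0}"
  by (auto simp: R_def)

lemma linear_expand_cart:
  fixes L :: "real^3 \<Rightarrow> real"
  assumes "linear L"
  shows "L v = (\<chi> i. L (axis i 1)) \<bullet> v"
proof -
  have "L v = L (\<Sum>i\<in>UNIV. v $ i *s axis i 1)" by (simp add: basis_expansion)
  also have "\<dots> = (\<Sum>i\<in>UNIV. v $ i * L (axis i 1))"
    by (simp add: linear_sum[OF assms] linear_scale[OF assms] scalar_mult_eq_scaleR)
  finally show ?thesis by (simp add: inner_vec_def mult.commute)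
qed

lemma D_space: "z \<in> UNIV \<times> T \<Longrightarrow> D (v, 0) z = G z \<bullet> v"
proof -
  assume z: "z \<in> UNIV \<times> T"
  obtain x t where xt: "z = (x, t)" by (cases z)
  have "linear (\<lambda>v. D (v, 0) (x, t))"
    by (rule C1_on_derivative_linear[OF C1_on_slice[OF C1_P]]) (use z xt in auto)
  from linear_expand_cart[OF this, of v] show ?thesis by (simp add: G_def xt)
qed

lemma phi_has_derivative:
  assumes "t \<in> T"
  shows "((\<lambda>x. \<phi> x t) has_derivative (\<lambda>v. G (x, t) \<bullet> v)) (at x)"
  using C1_onD(1)[OF C1_on_slice[OF C1_P assms], of x] D_space[of "(x, t)"] assms by (simp add: P_def)

lemma grad_phi: "t \<in> T \<Longrightarrow> grad (\<lambda>y. \<phi> y t) x = G (x, t)"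
proof -
  assume "t \<in> T"
  from frechet_derivative_at[OF phi_has_derivative[OF this]]
  have "frechet_derivative (\<lambda>x. \<phi> x t) (at x) = (\<lambda>v. G (x, t) \<bullet> v)" by simp
  then show ?thesis by (simp add: grad_def inner_axis vec_eq_iff)
qed

lemma deriv_phi: "t \<in> T \<Longrightarrow> deriv (\<lambda>s. \<phi> x s) t = D (0, 1) (x, t)"
  using C1_on_time_derivative[OF C1_P, of x t] by (intro DERIV_imp_deriv) (simp add: P_def)

lemma grad_f: "grad f p = (\<chi> i. E (axis i 1) p)"
  by (simp add: grad_def E_def)

lemma C1_grad_f: "C1_on (UNIV - {0}) (grad f) (\<lambda>p w. \<chi> i. EE (axis i 1) w p)"
proof -
  have "grad f = (\<lambda>p. \<chi> i. E (axis i 1) p)" by (simp add: fun_eq_iff grad_f)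
  then show ?thesis using C1_on_vec[of "UNIV - {0}" "\<lambda>i. E (axis i 1)" "\<lambda>i p w. EE (axis i 1) w p"] C1_E by simp
qed

lemma E_eq_inner: "p \<noteq> 0 \<Longrightarrow> E v p = grad f p \<bullet> v"
  unfolding grad_f by (rule linear_expand_cart) (rule C1_on_derivative_linear[OF C1_f], simp)

lemma f_has_derivative: "p \<noteq> 0 \<Longrightarrow> (f has_derivative (\<lambda>v. grad f p \<bullet> v)) (at p)"
  using C1_onD(1)[OF C1_f, of p] E_eq_inner by simp

section \<open>Consequences of homogeneity\<close>

lemma f_0: "f 0 = 0"
  using homogeneous[of 2 0] by simp

text \<open>Differentiate \<open>f (s *\<^sub>R p) = s * f p\<close> in \<open>s\<close> at 1; the
  identity holds on a half-line, which is a neighbourhood of 1.\<close>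

lemma euler_identity:
  assumes "p \<noteq> 0"
  shows "grad f p \<bullet> p = f p"
proof -
  have "((\<lambda>s. s *\<^sub>R p) has_derivative (\<lambda>h. h *\<^sub>R p)) (at (1::real))"
    by (auto intro!: derivative_eq_intros)
  moreover have "(f has_derivative (\<lambda>v. grad f p \<bullet> v)) (at (1 *\<^sub>R p))"
    using f_has_derivative[OF assms] by simp
  ultimately have "((\<lambda>s. f (s *\<^sub>R p)) has_derivative (\<lambda>h. grad f p \<bullet> (h *\<^sub>R p))) (at 1)"
    by (rule has_derivative_compose)
  moreover have "((\<lambda>s. s * f p) has_derivative (\<lambda>h. h * f p)) (at 1)"
    by (auto intro!: derivative_eq_intros)
  then have "((\<lambda>s. f (s *\<^sub>R p)) has_derivative (\<lambda>h. h * f p)) (at 1)"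
    by (rule has_derivative_transform_within_open[where s = "{0<..}"]) (auto simp: homogeneous)
  ultimately have "(\<lambda>h. grad f p \<bullet> (h *\<^sub>R p)) = (\<lambda>h. h * f p)" by (rule has_derivative_unique)
  from fun_cong[OF this, of 1] show ?thesis by simp
qed

text \<open>Differentiate the homogeneity relation in \<open>p\<close> instead. The gradient is
  homogeneous of degree 0, so the normalization of the normal drops out of
  \<open>grad f\<close>.\<close>

lemma grad_f_scale:
  assumes "s > 0" "p \<noteq> 0"
  shows "grad f (s *\<^sub>R p) = grad f p"
proof -
  have "((\<lambda>p. s *\<^sub>R p) has_derivative (\<lambda>v. s *\<^sub>R v)) (at p)"
    by (auto intro!: derivative_eq_intros)
  moreover have "(f has_derivative (\<lambda>v. grad f (s *\<^sub>R p) \<bullet> v)) (at (s *\<^sub>R p))"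
    by (rule f_has_derivative) (use assms in simp)
  ultimately have "((\<lambda>p. f (s *\<^sub>R p)) has_derivative (\<lambda>v. grad f (s *\<^sub>R p) \<bullet> (s *\<^sub>R v))) (at p)"
    by (rule has_derivative_compose)
  moreover have "((\<lambda>p. s * f p) has_derivative (\<lambda>v. s * (grad f p \<bullet> v))) (at p)"
    by (rule has_derivative_mult_right[OF f_has_derivative[OF assms(2)]])
  ultimately have eq: "(\<lambda>v. grad f (s *\<^sub>R p) \<bullet> (s *\<^sub>R v)) = (\<lambda>v. s * (grad f p \<bullet> v))"
    unfolding homogeneous[OF assms(1)] by (rule has_derivative_unique)
  have "grad f (s *\<^sub>R p) \<bullet> v = grad f p \<bullet> v" for v
    using fun_cong[OF eq, of v] assms(1) by simp
  then have "\<forall>v. grad f (s *\<^sub>R p) \<bullet> v = grad f p \<bullet> v" ..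
  then show ?thesis unfolding vector_eq_rdot .
qed

text \<open>Differentiating Euler's identity produces the gradient on both sides; what remains is
  the Hessian paired with \<open>p\<close>.\<close>

lemma hessian_f_radial:
  assumes "p \<noteq> 0"
  shows "(\<chi> i. EE (axis i 1) w p) \<bullet> p = 0"
proof -
  have id: "((\<lambda>p. p) has_derivative (\<lambda>v. v)) (at p)" by (rule has_derivative_ident)
  have "((\<lambda>p. grad f p \<bullet> p) has_derivative (\<lambda>w. grad f p \<bullet> w + (\<chi> i. EE (axis i 1) w p) \<bullet> p)) (at p)"
    by (rule has_derivative_inner[OF C1_onD(1)[OF C1_grad_f] id]) (use assms in simp)
  moreover have "((\<lambda>p. grad f p \<bullet> p) has_derivative (\<lambda>w. grad f p \<bullet> w)) (at p)"
    by (rule has_derivative_transform_within_open[OF f_has_derivative[OF assms], where s = "- {0}"])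
       (use assms euler_identity in auto)
  ultimately have "(\<lambda>w. grad f p \<bullet> w + (\<chi> i. EE (axis i 1) w p) \<bullet> p) = (\<lambda>w. grad f p \<bullet> w)"
    by (rule has_derivative_unique)
  from fun_cong[OF this, of w] show ?thesis by simp
qed

text \<open>The divergence of \<open>x \<mapsto> \<nabla>f(\<nabla>\<phi>(x, t))\<close>.\<close>

definition div_grad_f :: "(real^3) \<times> real \<Rightarrow> real" where
  "div_grad_f z = (\<Sum>i\<in>UNIV. EE (axis i 1) (\<chi> k. DD (axis k 1, 0) (axis i 1, 0) z) (G z))"

section \<open>Integrands and variation fields\<close>

text \<open>By homogeneity this is \<open>f\<close> of the unit normal times the coarea
  factor.\<close>

definition energy :: "(real^3) \<times> real \<Rightarrow> real" where "energy z = f (G z)"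

text \<open>The claimed integrand times the coarea factor, as \<open>tangential_integrand\<close>
  shows.\<close>

definition flux :: "(real^3) \<times> real \<Rightarrow> real" where "flux z = - (D (0, 1) z * div_grad_f z)"

text \<open>\<open>C1_EE\<close> speaks of fixed directions, while the directions in
  \<open>div_grad_f\<close> vary with \<open>z\<close>; linearity of the derivative expands them
  along the axes.\<close>

lemma C1_flux: "\<exists>flux'. C1_on R flux flux'"
proof -
  have expand: "flux z = - (D (0, 1) z * (\<Sum>i\<in>UNIV. \<Sum>k\<in>UNIV. EE (axis i 1) (axis k 1) (G z) * DD (axis k 1, 0) (axis i 1, 0) z))"
    if "z \<in> R" for z
  proof -
    have "G z \<noteq> 0" using that by (simp add: R_def)
    then have lin: "linear (\<lambda>w. EE (axis i 1) w (G z))" for i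
      by (intro C1_on_derivative_linear[OF C1_E]) simp
    have "EE (axis i 1) (\<chi> k. DD (axis k 1, 0) (axis i 1, 0) z) (G z) =
        (\<Sum>k\<in>UNIV. EE (axis i 1) (axis k 1) (G z) * DD (axis k 1, 0) (axis i 1, 0) z)" for i
      using linear_expand_cart[OF lin[of i], of "\<chi> k. DD (axis k 1, 0) (axis i 1, 0) z"] by (simp add: inner_vec_def)
    then show ?thesis by (simp add: flux_def div_grad_f_def)
  qed
  note C1_GR = C1_on_subset[OF C1_G R_subset]
  \<comment> \<open>The derivative is left to unification, as only its existence is claimed.\<close>
  have "\<exists>F'. C1_on R (\<lambda>z. - (D (0, 1) z * (\<Sum>i\<in>UNIV. \<Sum>k\<in>UNIV. EE (axis i 1) (axis k 1) (G z) * DD (axis k 1, 0) (axis i 1, 0) z))) F'"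
    by (rule exI, rule C1_on_minus, rule C1_on_mult, rule C1_on_subset[OF C1_D R_subset], rule C1_on_sum, rule C1_on_sum,
        rule C1_on_mult, rule C1_on_compose[OF C1_GR C1_EE G_R], rule C1_on_subset[OF C1_DD R_subset])
  then obtain F' where F': "C1_on R (\<lambda>z. - (D (0, 1) z * (\<Sum>i\<in>UNIV. \<Sum>k\<in>UNIV. EE (axis i 1) (axis k 1) (G z) * DD (axis k 1, 0) (axis i 1, 0) z))) F'" ..
  have "C1_on R flux F'"
    unfolding C1_on_def
  proof (intro conjI ballI allI)
    show "(flux has_derivative F' z) (at z)" if "z \<in> R" for z
      by (rule has_derivative_transform_within_open[OF C1_onD(1)[OF F' that] open_R that]) (simp add: expand)
  qed (rule C1_onD(2)[OF F'])
  then show ?thesis by blast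
qed

text \<open>For \<open>V = \<phi>_t grad f (G)\<close> the first equation is Euler's identity. In
  the second, the part of the divergence of \<open>V\<close> in which \<open>\<phi>_t\<close> is
  differentiated equals the time derivative of \<open>f (G)\<close>, by symmetry of mixed
  derivatives, and cancels it.\<close>

lemma energy_variation:
  "\<exists>b' V V'. C1_on R energy b' \<and> C1_on R V V' \<and> (\<forall>z\<in>R. G z \<bullet> V z = D (0, 1) z * energy z \<and>
     b' z (0, 1) - divergence_x V' z = flux z)"
proof -
  note C1_GR = C1_on_subset[OF C1_G R_subset]
  define G' where "G' = (\<lambda>z w. (\<chi> i. DD (axis i 1, 0) w z) :: real^3)"
  define Hf where "Hf = (\<lambda>p w. (\<chi> i. EE (axis i 1) w p) :: real^3)"
  define V where "V = (\<lambda>z. D (0, 1) z *\<^sub>R grad f (G z))"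
  define V' where "V' = (\<lambda>z w. D (0, 1) z *\<^sub>R Hf (G z) (G' z w) + DD (0, 1) w z *\<^sub>R grad f (G z))"
  have C1_GR': "C1_on R G G'" unfolding G'_def by (rule C1_GR)
  have C1_b: "C1_on R energy (\<lambda>z w. E (G' z w) (G z))"
    unfolding energy_def[abs_def] by (rule C1_on_compose[OF C1_GR' C1_f G_R])
  have C1_V: "C1_on R V V'"
    unfolding V_def V'_def Hf_def
    by (rule C1_on_scaleR[OF C1_on_subset[OF C1_D R_subset] C1_on_compose[OF C1_GR' C1_grad_f G_R]])
  have "G z \<bullet> V z = D (0, 1) z * energy z \<and> E (G' z (0, 1)) (G z) - divergence_x V' z = flux z" if z: "z \<in> R" for z
  proof
    have zT: "z \<in> UNIV \<times> T" and nz: "G z \<noteq> 0" using z by (auto simp: R_def)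
    show "G z \<bullet> V z = D (0, 1) z * energy z"
      using euler_identity[OF nz] by (simp add: V_def energy_def inner_commute)
    have "divergence_x V' z = (\<Sum>i\<in>UNIV. V' z (axis i 1, 0) $ i)"
    proof -
      have "(Basis :: (real^3) set) = range (\<lambda>i. axis i 1)" by (auto simp: Basis_vec_def)
      moreover have "inj (\<lambda>i::3. axis i (1::real))" by (simp add: inj_on_def axis_eq_axis)
      ultimately show ?thesis
        using sum.reindex[of "\<lambda>i::3. axis i 1" UNIV "\<lambda>b. V' z (b, 0) \<bullet> b"]
        by (simp add: divergence_x_def o_def inner_axis)
    qed
    also have "\<dots> = D (0, 1) z * div_grad_f z + (\<Sum>i\<in>UNIV. DD (0, 1) (axis i 1, 0) z * grad f (G z) $ i)"
      by (simp add: V'_def Hf_def G'_def div_grad_f_def sum.distrib sum_distrib_left)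
    also have "(\<Sum>i\<in>UNIV. DD (0, 1) (axis i 1, 0) z * grad f (G z) $ i) = grad f (G z) \<bullet> G' z (0, 1)"
      by (simp add: inner_vec_def G'_def DD_commute[OF zT, of "(0, 1)"] mult.commute)
    also have "\<dots> = E (G' z (0, 1)) (G z)" using E_eq_inner[OF nz] by simp
    finally show "E (G' z (0, 1)) (G z) - divergence_x V' z = flux z" by (simp add: flux_def)
  qed
  then show ?thesis
    using C1_b C1_V by (intro exI[of _ "\<lambda>z w. E (G' z w) (G z)"] exI[of _ V] exI[of _ V'] conjI) auto
qed

text \<open>A general \<open>b\<close> has no Euler identity, so the field is taken along
  \<open>G\<close>. It is applied to \<open>flux\<close> and to 1, whose derivatives only have to be
  bounded.\<close>

lemma C1_normal_variation:
  assumes b: "C1_on R b b'"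
  shows "\<exists>V V'. C1_on R V V' \<and> (\<forall>z\<in>R. G z \<bullet> V z = D (0, 1) z * b z)"
proof -
  note C1_GR = C1_on_subset[OF C1_G R_subset]
  have nz: "G z \<bullet> G z \<noteq> 0" if "z \<in> R" for z using that by (simp add: R_def)
  let ?V = "\<lambda>z. (D (0, 1) z * b z * inverse (G z \<bullet> G z)) *\<^sub>R G z"
  have "\<exists>V'. C1_on R ?V V'"
    by (rule exI, rule C1_on_scaleR[OF C1_on_mult[OF C1_on_mult[OF C1_on_subset[OF C1_D R_subset] b]
       C1_on_inverse[OF C1_on_inner[OF C1_GR C1_GR] nz]] C1_GR])
  then obtain V' where "C1_on R ?V V'" ..
  moreover have "\<forall>z\<in>R. G z \<bullet> ?V z = D (0, 1) z * b z" using nz by simp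
  ultimately show ?thesis by (intro exI[of _ ?V] exI[of _ V'] conjI)
qed

text \<open>Near \<open>x\<close> the normal inside \<open>grad f\<close> may be replaced by
  \<open>G\<close>. The Jacobian \<open>L\<close> then has values orthogonal to the normal, so the
  tangential divergence is the full one, and the transport equation turns the normal speed into
  \<open>\<phi>_t\<close>.\<close>

lemma tangential_integrand:
  assumes t: "t \<in> T" and nz: "G (x, t) \<noteq> 0"
    and transport: "deriv (\<lambda>s. \<phi> x s) t + v \<bullet> grad (\<lambda>y. \<phi> y t) x = 0"
  shows "tangential_div (unit_normal \<phi> t x) (\<lambda>y. grad f (unit_normal \<phi> t y)) x * (v \<bullet> unit_normal \<phi> t x) * norm (G (x, t))
    = flux (x, t)"
proof -
  let ?g = "G (x, t)"
  have normal: "unit_normal \<phi> t y = (1 / norm (G (y, t))) *\<^sub>R G (y, t)" for y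
    by (simp add: unit_normal_def grad_phi[OF t])
  define L where "L = (\<lambda>w. (\<chi> i. EE (axis i 1) (\<chi> k. DD (axis k 1, 0) (w, 0) (x, t)) ?g) :: real^3)"
  have C1_Gt: "C1_on UNIV (\<lambda>y. G (y, t)) (\<lambda>y w. \<chi> i. DD (axis i 1, 0) (w, 0) (y, t))"
    by (rule C1_on_slice[OF C1_G t])
  have "((\<lambda>y. grad f (G (y, t))) has_derivative L) (at x)"
    unfolding L_def
    using has_derivative_compose[OF C1_onD(1)[OF C1_Gt UNIV_I] C1_onD(1)[OF C1_grad_f, of ?g]] nz by simp
  \<comment> \<open>On this open set \<open>grad_f_scale\<close> identifies the two fields, so they
    have the same derivative at \<open>x\<close>.\<close>
  moreover have "open {y. G (y, t) \<noteq> 0}"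
    by (rule open_Collect_neq[OF C1_on_imp_continuous_on[OF C1_Gt]]) simp
  ultimately have deriv: "((\<lambda>y. grad f (unit_normal \<phi> t y)) has_derivative L) (at x)"
    by (rule has_derivative_transform_within_open) (use nz in \<open>auto simp: normal grad_f_scale\<close>)
  then have linL: "linear L" by (rule has_derivative_linear)
  have jac: "jacobian (\<lambda>y. grad f (unit_normal \<phi> t y)) (at x) = matrix L"
    using frechet_derivative_at[OF deriv] by (simp add: jacobian_def)
  have tr: "trace (matrix L) = div_grad_f (x, t)"
    by (simp add: trace_def matrix_def L_def div_grad_f_def)
  have "L w \<bullet> ?g = 0" for w
    unfolding L_def by (rule hessian_f_radial[OF nz])
  then have "(matrix L *v unit_normal \<phi> t x) \<bullet> unit_normal \<phi> t x = 0"
    by (simp add: fun_cong[OF matrix_vector_mul(2)[OF linL]] normal)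
  then have "tangential_div (unit_normal \<phi> t x) (\<lambda>y. grad f (unit_normal \<phi> t y)) x = div_grad_f (x, t)"
    by (simp add: tangential_div_def div_field_def jac tr)
  moreover have "(v \<bullet> unit_normal \<phi> t x) * norm ?g = - D (0, 1) (x, t)"
    using transport nz by (simp add: normal grad_phi[OF t] deriv_phi[OF t])
  ultimately show ?thesis by (simp add: flux_def mult.assoc)
qed

end

section \<open>Layer integrals over a time window\<close>

text \<open>One \<open>W\<close> serves for a whole interval of times: the surfaces stay inside it,
  the normal is defined on it, and layers up to thickness \<open>e0\<close> stay in the compact set
  \<open>C\<close>.\<close>

locale surface_window = moving_surface +
  fixes t0 \<delta> e0 :: real and W C :: "(real^3) set"
  assumes \<delta>: "\<delta> > 0" and ball_T: "ball t0 \<delta> \<subseteq> T"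
    and open_W: "open W" and C: "compact C" "C \<subseteq> W"
    and W_R: "W \<times> ball t0 \<delta> \<subseteq> R"
    and e0: "e0 > 0" and far: "\<And>x t. x \<in> W \<Longrightarrow> t \<in> ball t0 \<delta> \<Longrightarrow> x \<notin> C \<Longrightarrow> \<bar>P (x, t)\<bar> > e0"
    and zero_in: "\<And>x t. t \<in> ball t0 \<delta> \<Longrightarrow> \<phi> x t = 0 \<Longrightarrow> x \<in> W"
    and surface: "\<And>t. t \<in> ball t0 \<delta> \<Longrightarrow> compact {x. \<phi> x t = 0} \<and> smooth_surface {x. \<phi> x t = 0}"
begin

text \<open>The numerator \<open>e0\<close> keeps every layer of the sequence, from the first on,
  inside \<open>C\<close>.\<close>

definition eps :: "nat \<Rightarrow> real" where "eps n = e0 / real (Suc n)"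

text \<open>Unlike in \<open>layer_density\<close>, there is no gradient factor: \<open>b\<close>
  already contains it, and \<open>surface_density\<close> divides it out in the limit.\<close>

definition layer :: "((real^3) \<times> real \<Rightarrow> real) \<Rightarrow> nat \<Rightarrow> real \<Rightarrow> real" where
  "layer b n t = (\<integral>x. indicator W x * (bump (P (x, t) / eps n) / eps n * b (x, t)) \<partial>lborel)"

lemma eps_pos: "eps n > 0" and eps_le: "eps n \<le> e0" and eps_lim: "eps \<longlonglongrightarrow> 0"
proof -
  show "eps n > 0" using e0 by (simp add: eps_def)
  show "eps n \<le> e0" using e0 by (simp add: eps_def field_simps)
  have "(\<lambda>n. e0 * inverse (real (Suc n))) \<longlonglongrightarrow> e0 * 0"
    by (intro tendsto_intros LIMSEQ_inverse_real_of_nat)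
  then show "eps \<longlonglongrightarrow> 0" by (simp add: eps_def[abs_def] divide_inverse)
qed

lemma far_bump:
  assumes "x \<in> W" "t \<in> ball t0 \<delta>" "x \<notin> C"
  shows "bump (P (x, t) / eps n) = 0"
proof (rule bump_eq_0)
  show "1 \<le> \<bar>P (x, t) / eps n\<bar>"
    using far[OF assms] eps_pos[of n] eps_le[of n] by (simp add: abs_divide)
qed

lemma continuous_slice:
  assumes "continuous_on R b" "t \<in> ball t0 \<delta>"
  shows "continuous_on W (\<lambda>x. b (x, t))"
  by (rule continuous_on_compose2[OF assms(1)]) (use W_R assms(2) in \<open>auto intro!: continuous_intros\<close>)

lemma continuous_on_P: "t \<in> ball t0 \<delta> \<Longrightarrow> continuous_on W (\<lambda>x. P (x, t))"
  by (rule continuous_slice[OF continuous_on_subset[OF C1_on_imp_continuous_on[OF C1_P] R_subset]])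

lemma layer_integrable:
  assumes "continuous_on R b" "t \<in> ball t0 \<delta>"
  shows "integrable lborel (\<lambda>x. indicator W x * (bump (P (x, t) / eps n) / eps n * b (x, t)))"
proof (rule integrable_indicator_cutoff[OF C])
  show "continuous_on W (\<lambda>x. bump (P (x, t) / eps n) / eps n * b (x, t))"
    using eps_pos[of n] by (intro continuous_intros continuous_slice[OF assms] continuous_on_P[OF assms(2)]) auto
  fix x assume "x \<in> W" "x \<notin> C"
  then show "bump (P (x, t) / eps n) / eps n * b (x, t) = 0" by (simp add: far_bump[OF _ assms(2)])
qed

text \<open>Layer integrals are closed under differentiation in time. Neither
  \<open>bump_deriv\<close> nor a further power of 1 / eps survives, so the step can be iterated
  with bounds uniform in \<open>n\<close>.\<close>

lemma layer_has_derivative: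
  assumes b: "C1_on R b b'" and V: "C1_on R V V'" and GV: "\<forall>z\<in>R. G z \<bullet> V z = D (0, 1) z * b z"
    and t: "t \<in> ball t0 \<delta>"
  shows "(layer b n has_real_derivative layer (\<lambda>z. b' z (0, 1) - divergence_x V' z) n t) (at t)"
  unfolding layer_def
proof (rule cutoff_integral_has_derivative[where I = "ball t0 \<delta>" and P = P and P' = "\<lambda>z v. D v z" and b = b and b' = b'
      and V = V and V' = V' and e = e0 and H = "\<lambda>s. bump (s / eps n) / eps n" and H' = "\<lambda>s. bump_deriv (s / eps n) / (eps n * eps n)",
      OF open_W open_ball C t])
  show "C1_on (W \<times> ball t0 \<delta>) P (\<lambda>z v. D v z)"
    using C1_P R_subset W_R by (auto intro: C1_on_subset)
  show "C1_on (W \<times> ball t0 \<delta>) V V'" "C1_on (W \<times> ball t0 \<delta>) b b'"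
    using b V W_R by (auto intro: C1_on_subset)
  show "e0 < \<bar>P (x, s)\<bar>" if "x \<in> W" "s \<in> ball t0 \<delta>" "x \<notin> C" for x s
    by (rule far[OF that])
  show "((\<lambda>s. bump (s / eps n) / eps n) has_real_derivative bump_deriv (s / eps n) / (eps n * eps n)) (at s)" for s
  proof -
    have "((\<lambda>s. s / eps n) has_real_derivative 1 / eps n) (at s)"
      by (intro DERIV_cdivide DERIV_ident)
    from DERIV_cdivide[OF DERIV_chain2[OF bump_has_derivative this], of "eps n"] show ?thesis by simp
  qed
  show "continuous_on UNIV (\<lambda>s. bump_deriv (s / eps n) / (eps n * eps n))"
    using eps_pos[of n] by (intro continuous_intros continuous_on_compose2[OF continuous_bump_deriv[of UNIV]]) auto
  show "bump (s / eps n) / eps n = 0" "bump_deriv (s / eps n) / (eps n * eps n) = 0" if "e0 < \<bar>s\<bar>" for s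
  proof -
    have "1 \<le> \<bar>s / eps n\<bar>" using that eps_pos[of n] eps_le[of n] by (simp add: abs_divide)
    then show "bump (s / eps n) / eps n = 0" "bump_deriv (s / eps n) / (eps n * eps n) = 0"
      by (simp_all add: bump_eq_0)
  qed
  show "D (V (x, t), 0) (x, t) = D (0, 1) (x, t) * b (x, t)" if "x \<in> W" for x
  proof -
    have "(x, t) \<in> R" using W_R that t by blast
    then show ?thesis using GV D_space[of "(x, t)"] R_subset by auto
  qed
qed

text \<open>On \<open>C\<close> times the closed half interval \<open>b\<close> is bounded, and the
  weight is nonnegative. So every layer integral is controlled by the one of the constant 1.\<close>

lemma layer_bound:
  assumes b: "continuous_on R b"
  shows "\<exists>c\<ge>0. \<forall>t n. \<bar>t - t0\<bar> < \<delta> / 2 \<longrightarrow> \<bar>layer b n t\<bar> \<le> c * layer (\<lambda>_. 1) n t"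
proof -
  let ?K = "C \<times> cball t0 (\<delta> / 2)"
  have KR: "?K \<subseteq> R" using W_R C(2) \<delta> by force
  have "compact (b ` ?K)"
    by (intro compact_continuous_image continuous_on_subset[OF b KR] compact_Times C(1) compact_cball)
  then have "bounded (b ` ?K)" by (rule compact_imp_bounded)
  then obtain c where c: "\<forall>z\<in>?K. \<bar>b z\<bar> \<le> c" unfolding bounded_iff by auto
  have "\<bar>layer b n t\<bar> \<le> max c 0 * layer (\<lambda>_. 1) n t" if t: "\<bar>t - t0\<bar> < \<delta> / 2" for t n
  proof -
    have tb: "t \<in> ball t0 \<delta>" "t \<in> cball t0 (\<delta> / 2)" using t \<delta> by (auto simp: dist_real_def abs_minus_commute)
    have int: "integrable lborel (\<lambda>x. indicator W x * (bump (P (x, t) / eps n) / eps n * max c 0))"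
      by (rule layer_integrable[OF _ tb(1), of "\<lambda>_. max c 0"]) simp
    have "\<bar>layer b n t\<bar> \<le> (\<integral>x. indicator W x * (bump (P (x, t) / eps n) / eps n * max c 0) \<partial>lborel)"
      unfolding layer_def
    proof (rule integral_abs_bound_integral[OF layer_integrable[OF b tb(1)] int])
      fix x
      show "\<bar>indicator W x * (bump (P (x, t) / eps n) / eps n * b (x, t))\<bar>
          \<le> indicator W x * (bump (P (x, t) / eps n) / eps n * max c 0)"
      proof (cases "x \<in> W \<and> x \<in> C")
        case True
        then have "\<bar>b (x, t)\<bar> \<le> max c 0" using c tb(2) by force
        moreover have q: "0 \<le> bump (P (x, t) / eps n) / eps n"
          using bump_nonneg[of "P (x, t) / eps n"] eps_pos[of n] by simp
        ultimately have "\<bar>bump (P (x, t) / eps n) / eps n * b (x, t)\<bar> \<le> bump (P (x, t) / eps n) / eps n * max c 0"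
          unfolding abs_mult[of "bump (P (x, t) / eps n) / eps n"] abs_of_nonneg[OF q] by (rule mult_left_mono)
        moreover have ind: "indicator W x = (1 :: real)" using True by simp
        ultimately show ?thesis unfolding ind mult_1_left by blast
      qed (auto simp: far_bump[OF _ tb(1)] indicator_def)
    qed
    also have "\<dots> = max c 0 * layer (\<lambda>_. 1) n t"
      unfolding layer_def by (subst integral_mult_right_zero[symmetric]) (simp add: mult_ac)
    finally show ?thesis .
  qed
  then show ?thesis by (intro exI[of _ "max c 0"]) auto
qed

text \<open>The value 0 at critical points makes this a Borel function on all of space. It agrees
  with the conventions elsewhere: there \<open>unit_normal\<close> is 0, and so is
  \<open>f\<close>.\<close>

definition surface_density :: "((real^3) \<times> real \<Rightarrow> real) \<Rightarrow> real \<Rightarrow> real^3 \<Rightarrow> real" where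
  "surface_density b t x = (if G (x, t) = 0 then 0 else b (x, t) / norm (G (x, t)))"

lemma layer_limit:
  assumes b: "continuous_on R b" and t: "t \<in> ball t0 \<delta>"
  shows "(\<lambda>n. layer b n t) \<longlonglongrightarrow> (\<integral>x. surface_density b t x \<partial>surface_measure (zero_level \<phi> t))"
proof -
  have tT: "t \<in> T" using t ball_T by blast
  have WR: "(x, t) \<in> R" if "x \<in> W" for x using W_R that t by blast
  have contG: "continuous_on UNIV (\<lambda>x. G (x, t))"
    by (rule C1_on_imp_continuous_on[OF C1_on_slice[OF C1_G tT]])
  interpret level: regular_level "\<lambda>x. \<phi> x t" "\<lambda>x. G (x, t)" W
  proof
    show "G (x, t) \<noteq> 0" if "x \<in> W" for x using WR[OF that] by (simp add: R_def)
  qed (use open_W phi_has_derivative[OF tT] continuous_on_subset[OF contG] zero_in[OF t] in auto)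
  let ?S = "{x. G (x, t) \<noteq> 0}"
  have openS: "open ?S" by (rule open_Collect_neq[OF contG]) simp
  have contS: "continuous_on ?S (\<lambda>x. b (x, t) / norm (G (x, t)))"
  proof (intro continuous_intros continuous_on_subset[OF contG])
    show "continuous_on ?S (\<lambda>x. b (x, t))"
      by (rule continuous_on_compose2[OF b]) (use tT in \<open>auto simp: R_def intro!: continuous_intros\<close>)
  qed auto
  have "(\<lambda>x. indicator ?S x *\<^sub>R (b (x, t) / norm (G (x, t)))) \<in> borel_measurable borel"
    by (rule borel_measurable_continuous_on_indicator[OF _ contS]) (use openS in simp)
  moreover have "(\<lambda>x. indicator ?S x *\<^sub>R (b (x, t) / norm (G (x, t)))) = surface_density b t"
    by (auto simp: surface_density_def fun_eq_iff)
  ultimately have meas: "surface_density b t \<in> borel_measurable borel" by simp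
  have WS: "W \<subseteq> ?S" using WR by (auto simp: R_def)
  have cont: "continuous_on W (surface_density b t)"
    by (rule continuous_on_eq[OF continuous_on_subset[OF contS WS]]) (use WS in \<open>auto simp: surface_density_def\<close>)
  have eq: "indicator W x * level.layer_density (surface_density b t) (eps n) x =
      indicator W x * (bump (P (x, t) / eps n) / eps n * b (x, t))" for x n
    using WS by (cases "x \<in> W") (auto simp: level.layer_density_def surface_density_def P_def)
  have "(\<lambda>n. \<integral>x. indicator W x * level.layer_density (surface_density b t) (eps n) x \<partial>lborel) \<longlonglongrightarrow>
      integral\<^sup>L (surface_measure {x. \<phi> x t = 0}) (surface_density b t)"
    by (rule level.surface_layer_limit[OF _ _ C _ e0 cont meas eps_pos eps_lim])
       (use surface[OF t] far[OF _ t] in \<open>auto simp: P_def\<close>)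
  then show ?thesis by (simp add: eq layer_def zero_level_def)
qed

lemma Jn_eq:
  assumes "t \<in> T"
  shows "Jn f \<phi> t = (\<integral>x. surface_density energy t x \<partial>surface_measure (zero_level \<phi> t))"
proof -
  have "f (unit_normal \<phi> t x) = surface_density energy t x" for x
    using homogeneous[of "1 / norm (G (x, t))" "G (x, t)"]
    by (simp add: unit_normal_def grad_phi[OF assms] surface_density_def energy_def f_0)
  then show ?thesis by (simp add: Jn_def)
qed

lemma Jn_has_derivative:
  "((\<lambda>s. Jn f \<phi> s) has_real_derivative (\<integral>x. surface_density flux t0 x \<partial>surface_measure (zero_level \<phi> t0))) (at t0)"
proof -
  have t0: "t0 \<in> ball t0 \<delta>" using \<delta> by simp
  have inb: "s \<in> ball t0 \<delta>" if "\<bar>s - t0\<bar> < \<delta> / 2" for s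
    using that \<delta> by (simp add: dist_real_def abs_minus_commute)
  obtain eb V0 V0' where e: "C1_on R energy eb" "C1_on R V0 V0'"
    and V0: "\<forall>z\<in>R. G z \<bullet> V0 z = D (0, 1) z * energy z \<and> eb z (0, 1) - divergence_x V0' z = flux z"
    using energy_variation by (elim exE conjE)
  obtain flux' where flux: "C1_on R flux flux'" using C1_flux by (elim exE)
  obtain V1 V1' where V1: "C1_on R V1 V1'" "\<forall>z\<in>R. G z \<bullet> V1 z = D (0, 1) z * flux z"
    using C1_normal_variation[OF flux] by (elim exE conjE)
  have one: "C1_on R (\<lambda>_. 1 :: real) (\<lambda>_ _. 0)" by (rule C1_on_const)
  \<comment> \<open>For \<open>b = 1\<close>: its layer integral bounds all others, and this field
    gives the differential inequality for its growth.\<close>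
  obtain V2 V2' where V2: "C1_on R V2 V2'" "\<forall>z\<in>R. G z \<bullet> V2 z = D (0, 1) z * 1"
    using C1_normal_variation[OF one] by (elim exE conjE)
  let ?L1 = "\<lambda>z. flux' z (0, 1) - divergence_x V1' z" and ?L2 = "\<lambda>z. 0 - divergence_x V2' z"
  have contL: "continuous_on R ?L1" "continuous_on R ?L2"
    unfolding divergence_x_def
    by (intro continuous_intros C1_onD(2)[OF flux] C1_onD(2)[OF V1(1)] C1_onD(2)[OF V2(1)])+
  obtain c1 where c1: "c1 \<ge> 0" "\<forall>t n. \<bar>t - t0\<bar> < \<delta> / 2 \<longrightarrow> \<bar>layer ?L1 n t\<bar> \<le> c1 * layer (\<lambda>_. 1) n t"
    using layer_bound[OF contL(1)] by (elim exE conjE)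
  obtain c2 where c2: "c2 \<ge> 0" "\<forall>t n. \<bar>t - t0\<bar> < \<delta> / 2 \<longrightarrow> \<bar>layer ?L2 n t\<bar> \<le> c2 * layer (\<lambda>_. 1) n t"
    using layer_bound[OF contL(2)] by (elim exE conjE)
  have dM: "(layer (\<lambda>_. 1) n has_real_derivative layer ?L2 n s) (at s)" if "\<bar>s - t0\<bar> < \<delta> / 2" for n s
    by (rule layer_has_derivative[OF one V2 inb[OF that]])
  have dB: "(layer flux n has_real_derivative layer ?L1 n s) (at s)" if "\<bar>s - t0\<bar> < \<delta> / 2" for n s
    by (rule layer_has_derivative[OF flux V1 inb[OF that]])
  have dA: "(layer energy n has_real_derivative layer flux n s) (at s)" if s: "\<bar>s - t0\<bar> < \<delta> / 2" for n s
  proof -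
    have "(layer energy n has_real_derivative layer (\<lambda>z. eb z (0, 1) - divergence_x V0' z) n s) (at s)"
      by (rule layer_has_derivative[OF e _ inb[OF s]]) (use V0 in blast)
    moreover have "layer (\<lambda>z. eb z (0, 1) - divergence_x V0' z) n s = layer flux n s"
      unfolding layer_def
    proof (rule Bochner_Integration.integral_cong[OF refl])
      fix x
      have "(x, s) \<in> R" if "x \<in> W" using W_R inb[OF s] that by blast
      then show "indicator W x * (bump (P (x, s) / eps n) / eps n * (eb (x, s) (0, 1) - divergence_x V0' (x, s))) =
          indicator W x * (bump (P (x, s) / eps n) / eps n * flux (x, s))"
        using V0 by (cases "x \<in> W") auto
    qed
    ultimately show ?thesis by simp
  qed
  \<comment> \<open>The starting value for Gronwall: at \<open>t0\<close> the layer integrals of 1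
    converge, hence are bounded in \<open>n\<close>.\<close>
  have "Bseq (\<lambda>n. layer (\<lambda>_. 1) n t0)"
    by (rule convergent_imp_Bseq[OF convergentI[OF layer_limit[OF _ t0]]]) simp
  then obtain m where m: "\<And>n. \<bar>layer (\<lambda>_. 1) n t0\<bar> \<le> m" unfolding Bseq_def by auto
  have bound: "\<bar>layer ?L1 n s\<bar> \<le> c1 * (exp (c2 * \<delta>) * m)" if s: "\<bar>s - t0\<bar> < \<delta> / 2" for n s
  proof -
    have "layer (\<lambda>_. 1) n s \<le> exp (c2 * \<bar>s - t0\<bar>) * layer (\<lambda>_. 1) n t0"
      by (rule exponential_growth_bound[OF dM _ s]) (use c2(2) in auto)
    also have "\<dots> \<le> exp (c2 * \<bar>s - t0\<bar>) * m"
      using m[of n] by (intro mult_left_mono) auto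
    also have "\<dots> \<le> exp (c2 * \<delta>) * m"
    proof (rule mult_right_mono)
      show "exp (c2 * \<bar>s - t0\<bar>) \<le> exp (c2 * \<delta>)" using s c2(1) \<delta> by (simp add: mult_left_mono)
      show "0 \<le> m" using m[of 0] by linarith
    qed
    finally have "c1 * layer (\<lambda>_. 1) n s \<le> c1 * (exp (c2 * \<delta>) * m)" using c1(1) by (rule mult_left_mono)
    then show ?thesis using c1(2) s by (meson order_trans)
  qed
  have "((\<lambda>s. \<integral>x. surface_density energy s x \<partial>surface_measure (zero_level \<phi> s)) has_real_derivative
      (\<integral>x. surface_density flux t0 x \<partial>surface_measure (zero_level \<phi> t0))) (at t0)"
    by (rule derivative_of_limit_quadratic[where \<delta> = "\<delta> / 2", OF _ dA dB bound
          layer_limit[OF C1_on_imp_continuous_on[OF e(1)] inb] layer_limit[OF C1_on_imp_continuous_on[OF flux] t0]])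
       (use \<delta> in auto)
  then show ?thesis
    by (rule has_field_derivative_transform_within_open[OF _ open_ball t0]) (use Jn_eq ball_T in auto)
qed

end

section \<open>Existence of a time window, and the theorem\<close>

context moving_surface
begin

text \<open>The danger is that zeros of \<open>\<phi>\<close> appear outside \<open>W\<close> at
  nearby times. The hypothesis \<open>bdd\<close> confines them to a fixed ball, which excludes
  arrivals from infinity; on the rest of that ball compactness keeps \<open>\<phi>\<close> away from
  0.\<close>

lemma surface_window_exists:
  assumes t0: "t0 \<in> T"
    and surface: "\<And>t. t \<in> T \<Longrightarrow> compact {x. \<phi> x t = 0} \<and> smooth_surface {x. \<phi> x t = 0}"
    and bdd: "\<And>K. compact K \<Longrightarrow> K \<subseteq> T \<Longrightarrow> bounded (\<Union>t\<in>K. {x. \<phi> x t = 0})"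
    and nondegenerate: "\<And>x. \<phi> x t0 = 0 \<Longrightarrow> G (x, t0) \<noteq> 0"
  shows "\<exists>\<delta> e0 W C. surface_window T \<phi> f t0 \<delta> e0 W C"
proof -
  let ?Z = "{x. \<phi> x t0 = 0}"
  have contP: "continuous_on (UNIV \<times> T) P" by (rule C1_on_imp_continuous_on[OF C1_P])
  have contPt: "continuous_on A (\<lambda>x. P (x, t0))" for A
    by (rule continuous_on_subset[OF C1_on_imp_continuous_on[OF C1_on_slice[OF C1_P t0]] subset_UNIV])
  define N where "N = (\<lambda>x. (x, t0)) -` R"
  have "open N" unfolding N_def by (rule open_vimage[OF open_R]) (intro continuous_intros)
  have "?Z \<subseteq> N" using nondegenerate t0 by (auto simp: N_def R_def)
  have "compact ?Z" using surface[OF t0] by blast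
  from compact_open_neighbourhoods[OF this \<open>open N\<close> \<open>?Z \<subseteq> N\<close>] obtain U C W where UCW: "open U" "compact C" "open W" "compact (closure W)" "?Z \<subseteq> U" "U \<subseteq> C" "C \<subseteq> W" "closure W \<subseteq> N"
    by (elim exE conjE)
  have clW: "(x, t0) \<in> R" if "x \<in> closure W" for x using UCW(8) that by (auto simp: N_def)
  obtain \<delta>1 where d1: "\<delta>1 > 0" "\<forall>x\<in>closure W. \<forall>t. \<bar>t - t0\<bar> < \<delta>1 \<longrightarrow> (x, t) \<in> R"
    proof -
    have "\<exists>\<delta>>0. \<forall>x\<in>closure W. \<forall>t. \<bar>t - t0\<bar> < \<delta> \<longrightarrow> (x, t) \<in> R"
      by (rule compact_slice_time_interval[OF UCW(4) open_R clW])
    then show ?thesis using that by (elim exE conjE)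
  qed
  have Znz: "0 < \<bar>P (x, t0)\<bar>" if "x \<notin> U" for x
    using UCW(5) that by (auto simp: P_def)
  \<comment> \<open>Around \<open>C\<close> inside \<open>W\<close>: the lower bound on this set
    yields the threshold e / 2 of the window.\<close>
  let ?KA = "closure W - U"
  have KA: "compact ?KA" by (rule compact_diff[OF UCW(4,1)])
  have "continuous_on ?KA (\<lambda>x. \<bar>P (x, t0)\<bar>)" by (intro continuous_intros contPt)
  then obtain e where e: "e > 0" "\<forall>x\<in>?KA. e \<le> \<bar>P (x, t0)\<bar>"
    using compact_positive_lower_bound[OF KA] Znz by (metis DiffD2)
  define Q where "Q = (\<lambda>c. (UNIV \<times> T) \<inter> (\<lambda>z. \<bar>P z\<bar>) -` {c<..})"
  have openQ: "open (Q c)" for c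
    unfolding Q_def by (rule continuous_open_preimage[OF _ open_domain]) (auto intro!: continuous_intros contP)
  have QA: "(x, t0) \<in> Q (e / 2)" if "x \<in> ?KA" for x
    using e that t0 by (force simp: Q_def)
  obtain \<delta>2 where d2: "\<delta>2 > 0" "\<forall>x\<in>?KA. \<forall>t. \<bar>t - t0\<bar> < \<delta>2 \<longrightarrow> (x, t) \<in> Q (e / 2)"
    proof -
    have "\<exists>\<delta>>0. \<forall>x\<in>?KA. \<forall>t. \<bar>t - t0\<bar> < \<delta> \<longrightarrow> (x, t) \<in> Q (e / 2)"
      by (rule compact_slice_time_interval[OF KA openQ QA])
    then show ?thesis using that by (elim exE conjE)
  qed
  obtain \<delta>3 where d3: "\<delta>3 > 0" "cball t0 \<delta>3 \<subseteq> T" using open_T t0 open_contains_cball by blast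
  obtain r where r: "\<forall>x\<in>(\<Union>t\<in>cball t0 \<delta>3. {x. \<phi> x t = 0}). norm x \<le> r"
    using bdd[OF compact_cball d3(2)] unfolding bounded_iff by (elim exE)
  let ?KB = "cball 0 r - U"
  have KB: "compact ?KB" by (rule compact_diff[OF compact_cball UCW(1)])
  have QB: "(x, t0) \<in> Q 0" if "x \<in> ?KB" for x
    using Znz[of x] that t0 by (simp add: Q_def)
  obtain \<delta>4 where d4: "\<delta>4 > 0" "\<forall>x\<in>?KB. \<forall>t. \<bar>t - t0\<bar> < \<delta>4 \<longrightarrow> (x, t) \<in> Q 0"
    proof -
    have "\<exists>\<delta>>0. \<forall>x\<in>?KB. \<forall>t. \<bar>t - t0\<bar> < \<delta> \<longrightarrow> (x, t) \<in> Q 0"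
      by (rule compact_slice_time_interval[OF KB openQ QB])
    then show ?thesis using that by (elim exE conjE)
  qed
  \<comment> \<open>In order: the normal stays defined on \<open>W\<close>, \<open>P\<close> stays
    large off \<open>C\<close>, times stay in \<open>T\<close> with zeros in the ball of radius
    \<open>r\<close>, and no zero appears in that ball outside \<open>U\<close>.\<close>
  define \<delta> where "\<delta> = min (min \<delta>1 \<delta>2) (min \<delta>3 \<delta>4)"
  have near: "\<bar>t - t0\<bar> < \<delta>1" "\<bar>t - t0\<bar> < \<delta>2" "\<bar>t - t0\<bar> < \<delta>4" "t \<in> cball t0 \<delta>3" if "t \<in> ball t0 \<delta>" for t
    using that by (auto simp: \<delta>_def dist_real_def abs_minus_commute)
  have "surface_window T \<phi> f t0 \<delta> (e / 2) W C"
  proof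
    show "\<delta> > 0" using d1 d2 d3 d4 by (simp add: \<delta>_def)
    show ballT: "ball t0 \<delta> \<subseteq> T" using near(4) d3(2) by blast
    show "open W" "compact C" "C \<subseteq> W" by (fact UCW)+
    show "W \<times> ball t0 \<delta> \<subseteq> R" using d1(2) near(1) closure_subset[of W] by auto
    show "e / 2 > 0" using e(1) by simp
    show "e / 2 < \<bar>P (x, t)\<bar>" if "x \<in> W" "t \<in> ball t0 \<delta>" "x \<notin> C" for x t
    proof -
      have "x \<in> ?KA" using that(1,3) UCW(6) closure_subset[of W] by blast
      then have "(x, t) \<in> Q (e / 2)" using d2(2) near(2)[OF that(2)] by blast
      then show ?thesis by (simp add: Q_def)
    qed
    show "x \<in> W" if t: "t \<in> ball t0 \<delta>" and x: "\<phi> x t = 0" for x t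
    proof (rule ccontr)
      assume "x \<notin> W"
      moreover have "norm x \<le> r" using r near(4)[OF t] x by blast
      ultimately have "x \<in> ?KB" using UCW(6,7) by auto
      then have "(x, t) \<in> Q 0" using d4(2) near(3)[OF t] by blast
      then show False using x by (simp add: Q_def P_def)
    qed
    show "compact {x. \<phi> x t = 0} \<and> smooth_surface {x. \<phi> x t = 0}" if "t \<in> ball t0 \<delta>" for t
      using surface ballT that by blast
  qed
  then show ?thesis by blast
qed

end

theorem mainTheorem1:
  fixes T :: "real set"
    and \<phi> :: "real^3 \<Rightarrow> real \<Rightarrow> real"
    and u :: "real^3 \<Rightarrow> real \<Rightarrow> real^3"
    and f :: "real^3 \<Rightarrow> real"
    and \<Omega> :: "real \<Rightarrow> (real^3) set"
  assumes "open T" and "is_interval T"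
    and "smooth_on {(x, t). t \<in> T} (\<lambda>(x, t). \<phi> x t)"
    and "smooth_on {(x, t). t \<in> T} (\<lambda>(x, t). u x t)"
    and transport: "\<And>x t. t \<in> T \<Longrightarrow> deriv (\<lambda>s. \<phi> x s) t + u x t \<bullet> grad (\<lambda>y. \<phi> y t) x = 0"
    and domain: "\<And>t. t \<in> T \<Longrightarrow> open (\<Omega> t) \<and> connected (\<Omega> t) \<and> interior (closure (\<Omega> t)) = \<Omega> t"
    and boundary: "\<And>t. t \<in> T \<Longrightarrow> frontier (\<Omega> t) = zero_level \<phi> t"
    and closed_surface: "\<And>t. t \<in> T \<Longrightarrow> compact (zero_level \<phi> t) \<and> smooth_surface (zero_level \<phi> t)"
    and locally_bounded: "\<And>K. compact K \<Longrightarrow> K \<subseteq> T \<Longrightarrow> bounded (\<Union>t\<in>K. zero_level \<phi> t)"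
    and nondegenerate: "\<And>t. t \<in> T \<Longrightarrow> \<exists>N. open N \<and> zero_level \<phi> t \<subseteq> N \<and>
           (\<forall>x\<in>N. norm (grad (\<lambda>y. \<phi> y t) x) > 0)"
    and "smooth_on (UNIV - {0}) f"
    and homogeneous: "\<And>s p. s > 0 \<Longrightarrow> f (s *\<^sub>R p) = s * f p"
    and "t \<in> T"
  shows "((\<lambda>s. Jn f \<phi> s) has_real_derivative
           (\<integral>x. tangential_div (unit_normal \<phi> t x) (\<lambda>y. grad f (unit_normal \<phi> t y)) x *
                (u x t \<bullet> unit_normal \<phi> t x)
             \<partial>surface_measure (zero_level \<phi> t))) (at t)"
proof -
  have "{(x :: real^3, t). t \<in> T} = UNIV \<times> T" by auto
  then have "smooth_on (UNIV \<times> T) (\<lambda>z. \<phi> (fst z) (snd z))"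
    using assms(3) by (simp add: case_prod_beta')
  then interpret moving_surface T \<phi> f
    using assms(1,11) homogeneous by unfold_locales
  have nonzero: "G (x, t) \<noteq> 0" if "\<phi> x t = 0" for x
  proof -
    obtain N where "zero_level \<phi> t \<subseteq> N" "\<forall>x\<in>N. norm (grad (\<lambda>y. \<phi> y t) x) > 0"
      using nondegenerate[OF \<open>t \<in> T\<close>] by (elim exE conjE)
    then have "norm (grad (\<lambda>y. \<phi> y t) x) > 0" using that by (auto simp: zero_level_def)
    then show ?thesis by (simp add: grad_phi[OF \<open>t \<in> T\<close>])
  qed
  have "\<exists>\<delta> e0 W C. surface_window T \<phi> f t \<delta> e0 W C"
    by (rule surface_window_exists[OF \<open>t \<in> T\<close> closed_surface[unfolded zero_level_def]
          locally_bounded[unfolded zero_level_def] nonzero])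
  then obtain \<delta> e0 W C where "surface_window T \<phi> f t \<delta> e0 W C" by (elim exE)
  then interpret surface_window T \<phi> f t \<delta> e0 W C .
  have "surface_density flux t x = tangential_div (unit_normal \<phi> t x) (\<lambda>y. grad f (unit_normal \<phi> t y)) x *
      (u x t \<bullet> unit_normal \<phi> t x)" for x
  proof (cases "G (x, t) = 0")
    \<comment> \<open>At a critical point both sides are 0, since division by zero makes the unit
      normal 0.\<close>
    case True
    then show ?thesis by (simp add: surface_density_def unit_normal_def grad_phi[OF \<open>t \<in> T\<close>])
  next
    case False
    then show ?thesis
      by (simp add: surface_density_def tangential_integrand[OF \<open>t \<in> T\<close> False transport[OF \<open>t \<in> T\<close>], symmetric])
  qed
  then show ?thesis using Jn_has_derivative by simp
qed

end
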